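(* Let $d\ge1$, let $p\ge2$ be an even integer with $p\ge\frac8d$, and let $\langle\gamma\rangle\in\{-1,1\}$. Let $u$ be the maximal solution of $$ i u_t+\langle\gamma\rangle\Delta u+\int_0^1 e^{-i\sigma\Delta}\Big[\big|e^{i\sigma\Delta}u\big|^p\, e^{i\sigma\Delta}u\Big]\,d\sigma=0$$ on $\mathbb{R}^d$ with initial data $u(0)=u_0\in\mathcal{S}(\mathbb{R}^d)$. Define the variance $v(t)=\int_{\mathbb{R}^d}|x|^2|u(t,x)|^2dx$ and $$\dot v_1(t)=4\,\mathrm{Im}\int_{\mathbb{R}^d}\overline{u(t,x)}\,\big(x\cdot\nabla u(t,x)\big)\,dx .$$ Then, for times $t$ in the maximal interval of existence: (a) In the defocusing case $\langle\gamma\rangle=-1$, for $-\frac12\le t\le0$, $$v(t)\le v(0)-\dot v_1(0)\,t+C(p,d)\,E(u)\,t^2,$$ where $C(p,d)>0$ is a constant depending only on $p$ and $d$. (b) In the focusing case $\langle\gamma\rangle=1$, for $t<0$, $$v(t)\le v(0)+\dot v_1(0)\,t-8E(u)\,t^2 .$$ (c) In both cases, for $t<0$, $$\dot v_1(t)\ge\dot v_1(0)-16\,E(u)\,t .$$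
   Context: The (conserved) energy is $$E(u)=-\frac{\langle\gamma\rangle}{2}\int_{\mathbb{R}^d}|\nabla u|^2dx+\frac1{p+2}\int_{\mathbb{R}^d}\int_0^1|e^{i\sigma\Delta}u|^{p+2}\,d\sigma\,dx .$$ $\dot v_1$ is a notation for the quantity displayed in the claim (it is the part of the time derivative of $v$ coming from the linear term, divided by $\langle\gamma\rangle$). The solution is assumed sufficiently regular and decaying (as for Schwartz data) for the quantities to be well defined. *)

theory Defs
  imports "HOL-Analysis.Analysis"
begin

definition pd :: "'n::finite \<Rightarrow> (real^'n \<Rightarrow> complex) \<Rightarrow> real^'n \<Rightarrow> complex" where
  "pd j f x = frechet_derivative f (at x) (axis j 1)"

primrec iter_pd :: "'n::finite list \<Rightarrow> (real^'n \<Rightarrow> complex) \<Rightarrow> real^'n \<Rightarrow> complex" where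
  "iter_pd [] f = f"
| "iter_pd (j # js) f = pd j (iter_pd js f)"

definition grad :: "(real^'n::finite \<Rightarrow> complex) \<Rightarrow> real^'n \<Rightarrow> complex^'n" where
  "grad f x = (\<chi> j. pd j f x)"

definition x_dot_grad :: "(real^'n::finite \<Rightarrow> complex) \<Rightarrow> real^'n \<Rightarrow> complex" where
  "x_dot_grad f x = (\<Sum>j\<in>UNIV. x $ j *\<^sub>R grad f x $ j)"

definition laplacian :: "(real^'n::finite \<Rightarrow> complex) \<Rightarrow> real^'n \<Rightarrow> complex" where
  "laplacian f x = (\<Sum>j\<in>UNIV. pd j (pd j f) x)"

definition schwartz_seminorm ::
    "nat \<Rightarrow> 'n::finite list \<Rightarrow> (real^'n \<Rightarrow> complex) \<Rightarrow> real" where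
  "schwartz_seminorm k js f = (SUP x. norm x ^ k * norm (iter_pd js f x))"

text \<open>The first conjunct says that \<open>f\<close> is \<open>C\<^sup>\<infinity>\<close>: all iterated partial derivatives are
  (Frechet) differentiable, hence continuous.\<close>

definition schwartz :: "(real^'n::finite \<Rightarrow> complex) \<Rightarrow> bool" where
  "schwartz f \<longleftrightarrow>
     (\<forall>js x. iter_pd js f differentiable (at x)) \<and>
     (\<forall>k js. bounded (range (\<lambda>x. norm x ^ k * norm (iter_pd js f x))))"

definition fourier :: "(real^'n::finite \<Rightarrow> complex) \<Rightarrow> real^'n \<Rightarrow> complex" where
  "fourier f \<xi> = (LINT x|lborel. exp (- \<i> * of_real (x \<bullet> \<xi>)) * f x)"

text \<open>The operator \<open>exp (i \<sigma> \<Delta>)\<close> is the Fourier multiplier with symbol \<open>exp (- i \<sigma> |\<xi>|\<^sup>2)\<close>; it is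
  only applied to Schwartz functions, for which all the integrals converge absolutely.\<close>

definition free_prop :: "real \<Rightarrow> (real^'n::finite \<Rightarrow> complex) \<Rightarrow> real^'n \<Rightarrow> complex" where
  "free_prop \<sigma> f x =
     (LINT \<xi>|lborel. exp (\<i> * of_real (x \<bullet> \<xi>)) *
        (exp (- \<i> * of_real (\<sigma> * (norm \<xi>)\<^sup>2)) * fourier f \<xi>)) / of_real ((2 * pi) ^ CARD('n))"

definition dm_nonlin :: "nat \<Rightarrow> (real^'n::finite \<Rightarrow> complex) \<Rightarrow> real^'n \<Rightarrow> complex" where
  "dm_nonlin p f x =
     (LBINT \<sigma>:{0..1}. free_prop (- \<sigma>)
        (\<lambda>y. of_real (norm (free_prop \<sigma> f y) ^ p) * free_prop \<sigma> f y) x)"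

text \<open>Solutions are Schwartz-valued: \<open>u\<close> belongs to \<open>C(I; S)\<close>, with the topology of \<open>S\<close> given by the
  seminorms, and the equation holds pointwise in \<open>t\<close> and \<open>x\<close>.  The parameter \<open>\<gamma>\<close> is the average
  dispersion (the coefficient of the Laplacian).\<close>

definition dm_solution ::
    "real \<Rightarrow> nat \<Rightarrow> (real^'n::finite \<Rightarrow> complex) \<Rightarrow> real set \<Rightarrow> (real \<Rightarrow> real^'n \<Rightarrow> complex) \<Rightarrow> bool"
  where
  "dm_solution \<gamma> p u0 I u \<longleftrightarrow>
     open I \<and> is_interval I \<and> 0 \<in> I \<and> u 0 = u0 \<and>
     (\<forall>t\<in>I. schwartz (u t)) \<and>
     (\<forall>t\<in>I. \<forall>k js. ((\<lambda>s. schwartz_seminorm k js (\<lambda>x. u s x - u t x)) \<longlongrightarrow> 0) (at t)) \<and>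
     (\<forall>t\<in>I. \<forall>x. (\<lambda>s. u s x) differentiable (at t) \<and>
        \<i> * vector_derivative (\<lambda>s. u s x) (at t)
          + \<gamma> *\<^sub>R laplacian (u t) x + dm_nonlin p (u t) x = 0)"

definition dm_maximal_solution ::
    "real \<Rightarrow> nat \<Rightarrow> (real^'n::finite \<Rightarrow> complex) \<Rightarrow> real set \<Rightarrow> (real \<Rightarrow> real^'n \<Rightarrow> complex) \<Rightarrow> bool"
  where
  "dm_maximal_solution \<gamma> p u0 I u \<longleftrightarrow>
     dm_solution \<gamma> p u0 I u \<and>
     (\<forall>J w. dm_solution \<gamma> p u0 J w \<and> I \<subseteq> J \<and> (\<forall>t\<in>I. w t = u t) \<longrightarrow> J = I)"

definition dm_energy :: "real \<Rightarrow> nat \<Rightarrow> (real^'n::finite \<Rightarrow> complex) \<Rightarrow> real" where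
  "dm_energy \<gamma> p f =
     - (\<gamma> / 2) * (LINT x|lborel. (norm (grad f x))\<^sup>2)
     + 1 / (real p + 2) * (LINT x|lborel. (LBINT \<sigma>:{0..1}. norm (free_prop \<sigma> f x) ^ (p + 2)))"

definition variance :: "(real \<Rightarrow> real^'n::finite \<Rightarrow> complex) \<Rightarrow> real \<Rightarrow> real" where
  "variance u t = (LINT x|lborel. (norm x)\<^sup>2 * (norm (u t x))\<^sup>2)"

definition variance_dot1 :: "(real \<Rightarrow> real^'n::finite \<Rightarrow> complex) \<Rightarrow> real \<Rightarrow> real" where
  "variance_dot1 u t = 4 * Im (LINT x|lborel. cnj (u t x) * x_dot_grad (u t) x)"

end

theory Submission
  imports Defs "HOL-Probability.Sinc_Integral" "HOL-Probability.Characteristic_Functions"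
begin

text \<open>Write \<open>w\<^sub>\<sigma> = e\<^sup>i\<^sup>\<sigma>\<^sup>\<Delta> u\<close>, \<open>F(\<sigma>) = \<integral> |w\<^sub>\<sigma>|\<^sup>p\<^sup>+\<^sup>2 dx\<close> and \<open>q = p + 2\<close>.  Since \<open>e\<^sup>i\<^sup>\<sigma>\<^sup>\<Delta> x = (x + 2 i \<sigma> \<nabla>) e\<^sup>i\<^sup>\<sigma>\<^sup>\<Delta>\<close>,
  pairing the nonlinearity with \<open>|x|\<^sup>2 u\<close> and with the generator of dilations produces only \<open>F\<close> and
  \<open>F'(\<sigma>) = - q Im \<integral> cnj (|w\<^sub>\<sigma>|\<^sup>p w\<^sub>\<sigma>) \<Delta> w\<^sub>\<sigma> dx\<close>; integrating by parts in \<open>\<sigma>\<close> gives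

  \<open>v' = \<gamma> v\<^sub>1 + (4 d p - 16)/q \<integral> \<sigma> F d\<sigma> + 8/q F(1)\<close>,
  \<open>v\<^sub>1' = - 16 E - (4 d p - 32)/q \<integral> F d\<sigma> - 16/q F(1)\<close>,

  where \<open>v\<^sub>1\<close> is \<^const>\<open>variance_dot1\<close>.  All brackets are nonnegative as \<open>d p \<ge> 8\<close>, so (c) and (b) follow
  by integration.  In the defocusing case \<open>F(1)\<close> is not controlled by the energy, but it enters
  \<open>v' + (\<tau> - t) v\<^sub>1'\<close> with the coefficient \<open>(8 - 16 (\<tau> - t))/q\<close>, which is nonnegative for \<open>\<tau> - t \<le> 1/2\<close>.

  Fourier inversion is never used: adjointness of \<open>e\<^sup>i\<^sup>\<sigma>\<^sup>\<Delta>\<close> and \<open>e\<^sup>-\<^sup>i\<^sup>\<sigma>\<^sup>\<Delta>\<close>, the commutation relations and the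
  derivative in \<open>\<sigma>\<close> can all be read off from the defining integrals.\<close>

section \<open>Uniformly Schwartz families\<close>

text \<open>The obstacle is analytic: u is differentiable in time only pointwise in x, while every
  quantity is an integral in x, and often also in \<sigma>, of propagated functions. Each
  interchange of limit and integral needs one integrable majorant valid for a whole range of times
  and propagation parameters; hence families of functions with common seminorm bounds, rather than
  single functions, are the basic objects. Since E is taken at an arbitrary time of existence,
  conservation of energy has to be derived too; it comes from the same difference-quotient device as
  the two variance laws. The weight \<tau> - t of the defocusing case is dictated by \<gamma> = -1:
  differentiating (\<tau> - t) times \<open>variance_dot1\<close> releases a copy of
  \<open>variance_dot1\<close> that cancels the one in the derivative of the variance. The constant
  is C = 2 d p - 8: adding C E times the square of \<tau> - t turns the energy terms of the
  derivative into (\<tau> - t) (4 d p - 32) (E - P) with P the potential energy, and P \<le> E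
  because for \<gamma> = -1 the gradient part of the energy is nonnegative.\<close>

lemma pd_eq: "(f has_derivative f') (at x) \<Longrightarrow> pd j f x = f' (axis j 1)"
  unfolding pd_def using frechet_derivative_at by metis

lemma has_derivative_frechet:
  "f differentiable (at x) \<Longrightarrow> (f has_derivative frechet_derivative f (at x)) (at x)"
  using frechet_derivative_works by blast

lemma pd_add:
  assumes "f differentiable (at x)" "g differentiable (at x)"
  shows "pd j (\<lambda>x. f x + g x) x = pd j f x + pd j g x"
  using pd_eq[OF has_derivative_add[OF assms[THEN has_derivative_frechet]]] by (simp add: pd_def)

lemma pd_mult:
  assumes "f differentiable (at x)" "g differentiable (at x)"
  shows "pd j (\<lambda>x. f x * g x) x = f x * pd j g x + pd j f x * g x"
  using pd_eq[OF has_derivative_mult[OF assms[THEN has_derivative_frechet]]] by (simp add: pd_def)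

lemma pd_cnj:
  assumes "f differentiable (at x)"
  shows "pd j (\<lambda>x. cnj (f x)) x = cnj (pd j f x)"
  using pd_eq[OF has_derivative_cnj[OF assms[THEN has_derivative_frechet]]] by (simp add: pd_def)

lemma pd_const [simp]: "pd j (\<lambda>x. c) x = 0"
  by (rule pd_eq[OF has_derivative_const])

lemma pd_cmult:
  assumes "f differentiable (at x)"
  shows "pd j (\<lambda>x. c * f x) x = c * pd j f x"
  using pd_mult[of "\<lambda>_. c" x f j] assms by simp

lemma pd_diff:
  assumes "f differentiable (at x)" "g differentiable (at x)"
  shows "pd j (\<lambda>x. f x - g x) x = pd j f x - pd j g x"
  using pd_eq[OF has_derivative_diff[OF assms[THEN has_derivative_frechet]]] by (simp add: pd_def)

lemma pd_sum:
  assumes "finite S" "\<And>i. i \<in> S \<Longrightarrow> f i differentiable (at x)"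
  shows "pd j (\<lambda>x. \<Sum>i\<in>S. f i x) x = (\<Sum>i\<in>S. pd j (f i) x)"
proof -
  have "((\<lambda>x. \<Sum>i\<in>S. f i x) has_derivative (\<lambda>h. \<Sum>i\<in>S. frechet_derivative (f i) (at x) h)) (at x)"
    by (intro has_derivative_sum has_derivative_frechet assms)
  from pd_eq[OF this] show ?thesis by (simp add: pd_def)
qed

lemma coord_has_derivative:
  "((\<lambda>x::real^'n. complex_of_real (x $ i)) has_derivative (\<lambda>h. of_real (h $ i))) (at x)"
  by (intro bounded_linear.has_derivative[OF bounded_linear_of_real]
      bounded_linear.has_derivative[OF bounded_linear_vec_nth] has_derivative_ident)

lemma pd_coord_mult:
  assumes "f differentiable (at x)"
  shows "pd j (\<lambda>x. of_real (x $ i) * f x) x = of_real (x $ i) * pd j f x + (if i = j then f x else 0)"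
proof -
  have 1: "pd j (\<lambda>x. complex_of_real (x $ i)) x = (if i = j then 1 else 0)"
    by (subst pd_eq[OF coord_has_derivative]) (auto simp: axis_def)
  have 2: "(\<lambda>x::real^'a. complex_of_real (x $ i)) differentiable (at x)"
    using coord_has_derivative differentiable_def by blast
  show ?thesis by (subst pd_mult[OF 2 assms]) (simp add: 1)
qed

lemma coord_mult_differentiable:
  assumes "f differentiable (at x)"
  shows "(\<lambda>x. complex_of_real (x $ i) * f x) differentiable (at x)"
proof -
  have 2: "(\<lambda>x::real^'a. complex_of_real (x $ i)) differentiable (at x)"
    using coord_has_derivative differentiable_def by blast
  show ?thesis by (intro differentiable_mult 2 assms)
qed

lemma pd_reflect:
  assumes "f differentiable (at (- x))"
  shows "pd j (\<lambda>x. f (- x)) x = - pd j f (- x)"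
proof -
  from has_derivative_compose[OF has_derivative_minus[OF has_derivative_ident] has_derivative_frechet[OF assms]]
  have "((\<lambda>x. f (- x)) has_derivative (\<lambda>v. frechet_derivative f (at (- x)) (- v))) (at x)" .
  from pd_eq[OF this] show ?thesis
    using linear_frechet_derivative[OF assms] by (simp add: pd_def linear_neg)
qed

lemma differentiable_cnj:
  "f differentiable (at x) \<Longrightarrow> (\<lambda>x. cnj (f x)) differentiable (at x)"
  using has_derivative_cnj differentiable_def by metis

section \<open>Uniform seminorm bounds and their closure properties\<close>

lemma iter_pd_snoc: "iter_pd (js @ [j]) f = iter_pd js (pd j f)"
  by (induction js) auto

text \<open>The bound C may depend on k and js but not on the parameter. The index sets that occur
  are singletons, ranges of \<sigma>, time intervals, and products of a time interval with
  [0,1].\<close>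

definition uschwartz :: "'a set \<Rightarrow> ('a \<Rightarrow> real^'n::finite \<Rightarrow> complex) \<Rightarrow> bool" where
  "uschwartz A f \<longleftrightarrow>
     (\<forall>a\<in>A. \<forall>js x. iter_pd js (f a) differentiable (at x)) \<and>
     (\<forall>k js. \<exists>C. \<forall>a\<in>A. \<forall>x. norm x ^ k * norm (iter_pd js (f a) x) \<le> C)"

lemma schwartz_iff_uschwartz: "schwartz f \<longleftrightarrow> uschwartz {a} (\<lambda>_. f)"
  unfolding schwartz_def uschwartz_def bounded_iff by auto

lemma uschwartzD_schwartz: "uschwartz A f \<Longrightarrow> a \<in> A \<Longrightarrow> schwartz (f a)"
  unfolding schwartz_iff_uschwartz[of _ a] by (auto simp: uschwartz_def) blast

lemma uschwartz_differentiable: "uschwartz A f \<Longrightarrow> a \<in> A \<Longrightarrow> f a differentiable (at x)"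
  unfolding uschwartz_def by (metis iter_pd.simps(1))

lemma uschwartz_poly_decay:
  assumes "uschwartz A f"
  shows "\<exists>C. \<forall>a\<in>A. \<forall>x. norm x ^ k * norm (f a x) \<le> C"
  using assms unfolding uschwartz_def by (metis iter_pd.simps(1))

lemma uschwartz_pd: "uschwartz A f \<Longrightarrow> uschwartz A (\<lambda>a. pd j (f a))"
  unfolding uschwartz_def by (metis iter_pd_snoc)

lemma uschwartz_reindex: "uschwartz A f \<Longrightarrow> (\<And>b. b \<in> B \<Longrightarrow> s b \<in> A) \<Longrightarrow> uschwartz B (\<lambda>b. f (s b))"
  unfolding uschwartz_def by meson

text \<open>If a class R of families is stable under partial derivatives, iterated derivatives never
  leave it, so differentiability and weighted sup bounds for members of R control every seminorm.
  Derivatives have to agree only for parameters in A, since a family is arbitrary outside its index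
  set.\<close>

lemma uschwartz_coinduct:
  assumes "R f"
    and diff: "\<And>g a x. R g \<Longrightarrow> a \<in> A \<Longrightarrow> g a differentiable (at x)"
    and bd: "\<And>g k. R g \<Longrightarrow> \<exists>C. \<forall>a\<in>A. \<forall>x. norm x ^ k * norm (g a x) \<le> C"
    and step: "\<And>g j. R g \<Longrightarrow> \<exists>h. R h \<and> (\<forall>a\<in>A. pd j (g a) = h a)"
  shows "uschwartz A f"
proof -
  have "\<exists>h. R h \<and> (\<forall>a\<in>A. iter_pd js (f a) = h a)" for js
  proof (induction js)
    case Nil
    then show ?case using assms(1) by auto
  next
    case (Cons j js)
    then obtain h where h: "R h" "\<forall>a\<in>A. iter_pd js (f a) = h a" by blast
    from step[OF h(1), of j] obtain h' where "R h'" "\<forall>a\<in>A. pd j (h a) = h' a" by blast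
    with h show ?case by auto
  qed
  then show ?thesis unfolding uschwartz_def using diff bd by metis
qed

text \<open>As |x| is at most the sum of the |x_j|, each power of the weight can be traded for
  multiplications by coordinates. This suits Fourier transforms, where such a multiplication is a
  derivative of the original function and stays in the class.\<close>

lemma decay_from_coords:
  fixes R :: "('a \<Rightarrow> real^'n::finite \<Rightarrow> complex) \<Rightarrow> bool"
  assumes "R f"
    and bd: "\<And>g. R g \<Longrightarrow> \<exists>C. \<forall>a\<in>A. \<forall>x. norm (g a x) \<le> C"
    and step: "\<And>g j. R g \<Longrightarrow> \<exists>h. R h \<and> (\<forall>a\<in>A. \<forall>x. of_real (x $ j) * g a x = h a x)"
  shows "\<exists>C. \<forall>a\<in>A. \<forall>x. norm x ^ k * norm (f a x) \<le> C"
  using assms(1)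
proof (induction k arbitrary: f)
  case 0
  then show ?case using bd by simp
next
  case (Suc k)
  have "\<exists>C. \<forall>a\<in>A. \<forall>x. norm x ^ k * norm (of_real (x $ j) * f a x) \<le> C" for j
  proof -
    from step[OF Suc.prems, of j] obtain h where h: "R h" "\<forall>a\<in>A. \<forall>x. of_real (x $ j) * f a x = h a x"
      by blast
    from Suc.IH[OF h(1)] h(2) show ?thesis by auto
  qed
  then obtain C where C: "\<And>j a x. a \<in> A \<Longrightarrow> norm x ^ k * norm (of_real (x $ j) * f a x) \<le> C j"
    by metis
  have "norm x ^ Suc k * norm (f a x) \<le> (\<Sum>j\<in>UNIV. C j)" if "a \<in> A" for a x
  proof -
    have "norm x ^ Suc k * norm (f a x) = norm x * (norm x ^ k * norm (f a x))" by simp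
    also have "\<dots> \<le> (\<Sum>j\<in>UNIV. \<bar>x $ j\<bar>) * (norm x ^ k * norm (f a x))"
      by (intro mult_right_mono norm_le_l1_cart) auto
    also have "\<dots> = (\<Sum>j\<in>UNIV. norm x ^ k * norm (of_real (x $ j) * f a x))"
      by (simp add: sum_distrib_left sum_distrib_right norm_mult ac_simps)
    also have "\<dots> \<le> (\<Sum>j\<in>UNIV. C j)" by (intro sum_mono C that)
    finally show ?thesis .
  qed
  then show ?case by blast
qed

text \<open>The pointwise operations under which uniform Schwartz families are closed.  Multiplication by a
  coordinate is a generator, although \<open>x\<^sub>j\<close> itself is not Schwartz.\<close>

inductive schwartz_alg :: "'a set \<Rightarrow> ('a \<Rightarrow> real^'n::finite \<Rightarrow> complex) \<Rightarrow> bool" for A where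
  base: "uschwartz A f \<Longrightarrow> schwartz_alg A f"
| conj: "schwartz_alg A f \<Longrightarrow> schwartz_alg A (\<lambda>a x. cnj (f a x))"
| add: "schwartz_alg A f \<Longrightarrow> schwartz_alg A g \<Longrightarrow> schwartz_alg A (\<lambda>a x. f a x + g a x)"
| mult: "schwartz_alg A f \<Longrightarrow> schwartz_alg A g \<Longrightarrow> schwartz_alg A (\<lambda>a x. f a x * g a x)"
| coord: "schwartz_alg A f \<Longrightarrow> schwartz_alg A (\<lambda>a x. of_real (x $ j) * f a x)"
| scale: "schwartz_alg A f \<Longrightarrow> \<forall>a\<in>A. norm (c a) \<le> C \<Longrightarrow> schwartz_alg A (\<lambda>a x. c a * f a x)"

lemma schwartz_alg_differentiable: "schwartz_alg A f \<Longrightarrow> a \<in> A \<Longrightarrow> f a differentiable (at x)"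
  by (induction arbitrary: x rule: schwartz_alg.induct)
     (auto intro!: differentiable_mult differentiable_add differentiable_cnj coord_mult_differentiable
       intro: uschwartz_differentiable)

lemma schwartz_alg_decay:
  "schwartz_alg A f \<Longrightarrow> \<exists>C. \<forall>a\<in>A. \<forall>x. norm x ^ k * norm (f a x) \<le> C"
proof (induction arbitrary: k rule: schwartz_alg.induct)
  case (base f)
  then show ?case by (rule uschwartz_poly_decay)
next
  case (conj f)
  then show ?case by simp
next
  case (add f g)
  from add.IH obtain C D where
    "\<forall>a\<in>A. \<forall>x. norm x ^ k * norm (f a x) \<le> C" "\<forall>a\<in>A. \<forall>x. norm x ^ k * norm (g a x) \<le> D"
    by meson
  moreover have "norm x ^ k * norm (f a x + g a x) \<le> norm x ^ k * norm (f a x) + norm x ^ k * norm (g a x)"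
    for a x using norm_triangle_ineq[of "f a x" "g a x"]
    by (metis distrib_left mult_left_mono norm_ge_zero zero_le_power)
  ultimately have "\<forall>a\<in>A. \<forall>x. norm x ^ k * norm (f a x + g a x) \<le> C + D" by (meson add_mono order_trans)
  then show ?case by blast
next
  case (mult f g)
  from mult.IH(1)[of k] mult.IH(2)[of 0] obtain C D where
    CD: "\<forall>a\<in>A. \<forall>x. norm x ^ k * norm (f a x) \<le> C" "\<forall>a\<in>A. \<forall>x. norm (g a x) \<le> D"
    by auto
  have "norm x ^ k * norm (f a x * g a x) \<le> C * D" if "a \<in> A" for a x
  proof -
    have "norm x ^ k * norm (f a x * g a x) = (norm x ^ k * norm (f a x)) * norm (g a x)"
      by (simp add: norm_mult)
    also have "\<dots> \<le> C * D" using CD that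
      by (meson mult_mono norm_ge_zero order_trans zero_le_mult_iff zero_le_power mult_nonneg_nonneg)
    finally show ?thesis .
  qed
  then show ?case by blast
next
  case (coord f j)
  from coord.IH[of "Suc k"] obtain C where C: "\<forall>a\<in>A. \<forall>x. norm x ^ Suc k * norm (f a x) \<le> C" by blast
  have "norm x ^ k * norm (of_real (x $ j) * f a x) \<le> C" if "a \<in> A" for a x
  proof -
    have "norm x ^ k * norm (of_real (x $ j) * f a x) = \<bar>x $ j\<bar> * (norm x ^ k * norm (f a x))"
      by (simp add: norm_mult)
    also have "\<dots> \<le> norm x * (norm x ^ k * norm (f a x))"
      by (intro mult_right_mono component_le_norm_cart) auto
    also have "\<dots> \<le> C" using C that by (simp add: mult.assoc)
    finally show ?thesis .
  qed
  then show ?case by blast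
next
  case (scale f c C)
  from scale.IH obtain D where D: "\<forall>a\<in>A. \<forall>x. norm x ^ k * norm (f a x) \<le> D" by blast
  have "norm x ^ k * norm (c a * f a x) \<le> C * D" if "a \<in> A" for a x
  proof -
    have "norm x ^ k * norm (c a * f a x) = norm (c a) * (norm x ^ k * norm (f a x))"
      by (simp add: norm_mult)
    also have "\<dots> \<le> C * D" using D scale.hyps(2) that
      by (meson mult_mono norm_ge_zero order_trans zero_le_power mult_nonneg_nonneg)
    finally show ?thesis .
  qed
  then show ?case by blast
qed

text \<open>For the coinduction to run, the derivative must again be built from the generators. The
  Kronecker delta from differentiating a coordinate is absorbed by \<open>scale\<close> with the
  constant factor 0 or 1.\<close>

lemma schwartz_alg_pd:
  "schwartz_alg A f \<Longrightarrow> \<exists>h. schwartz_alg A h \<and> (\<forall>a\<in>A. pd j (f a) = h a)"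
proof (induction rule: schwartz_alg.induct)
  case (base f)
  then show ?case using uschwartz_pd schwartz_alg.base by blast
next
  case (conj f)
  then obtain h where h: "schwartz_alg A h" "\<forall>a\<in>A. pd j (f a) = h a" by blast
  have "pd j (\<lambda>x. cnj (f a x)) = (\<lambda>x. cnj (h a x))" if "a \<in> A" for a
    using that h(2) schwartz_alg_differentiable[OF conj.hyps that] by (auto simp: pd_cnj)
  then show ?case using schwartz_alg.conj[OF h(1)] by blast
next
  case (add f g)
  then obtain h k where h: "schwartz_alg A h" "\<forall>a\<in>A. pd j (f a) = h a"
    and k: "schwartz_alg A k" "\<forall>a\<in>A. pd j (g a) = k a" by blast
  have "pd j (\<lambda>x. f a x + g a x) = (\<lambda>x. h a x + k a x)" if "a \<in> A" for a
    using that h(2) k(2) schwartz_alg_differentiable[OF add.hyps(1) that]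
       schwartz_alg_differentiable[OF add.hyps(2) that] by (auto simp: pd_add)
  then show ?case using schwartz_alg.add[OF h(1) k(1)] by blast
next
  case (mult f g)
  then obtain h k where h: "schwartz_alg A h" "\<forall>a\<in>A. pd j (f a) = h a"
    and k: "schwartz_alg A k" "\<forall>a\<in>A. pd j (g a) = k a" by blast
  have "pd j (\<lambda>x. f a x * g a x) = (\<lambda>x. f a x * k a x + h a x * g a x)" if "a \<in> A" for a
    using that h(2) k(2) schwartz_alg_differentiable[OF mult.hyps(1) that]
       schwartz_alg_differentiable[OF mult.hyps(2) that] by (auto simp: pd_mult)
  then show ?case
    using schwartz_alg.add[OF schwartz_alg.mult[OF mult.hyps(1) k(1)] schwartz_alg.mult[OF h(1) mult.hyps(2)]]
    by blast
next
  case (coord f i)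
  then obtain h where h: "schwartz_alg A h" "\<forall>a\<in>A. pd j (f a) = h a" by blast
  have "pd j (\<lambda>x. of_real (x $ i) * f a x) =
      (\<lambda>x. of_real (x $ i) * h a x + (if i = j then 1 else 0) * f a x)" if "a \<in> A" for a
    using that h(2) schwartz_alg_differentiable[OF coord.hyps that] by (auto simp: pd_coord_mult)
  moreover have "schwartz_alg A (\<lambda>a x. of_real (x $ i) * h a x + (if i = j then 1 else 0) * f a x)"
    by (intro schwartz_alg.add schwartz_alg.coord[OF h(1)] schwartz_alg.scale[OF coord.hyps, where C=1]) auto
  ultimately show ?case by blast
next
  case (scale f c C)
  then obtain h where h: "schwartz_alg A h" "\<forall>a\<in>A. pd j (f a) = h a" by blast
  have "pd j (\<lambda>x. c a * f a x) = (\<lambda>x. c a * h a x)" if "a \<in> A" for a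
    using that h(2) schwartz_alg_differentiable[OF scale.hyps(1) that] by (auto simp: pd_cmult)
  then show ?case using schwartz_alg.scale[OF h(1) scale.hyps(2)] by blast
qed

lemma schwartz_alg_uschwartz: "schwartz_alg A f \<Longrightarrow> uschwartz A f"
  by (rule uschwartz_coinduct[where R = "schwartz_alg A"])
     (auto intro: schwartz_alg_differentiable schwartz_alg_decay schwartz_alg_pd)

lemmas uschwartz_cnj = schwartz_alg_uschwartz[OF schwartz_alg.conj[OF schwartz_alg.base]]
lemmas uschwartz_add =
  schwartz_alg_uschwartz[OF schwartz_alg.add[OF schwartz_alg.base schwartz_alg.base]]
lemmas uschwartz_mult =
  schwartz_alg_uschwartz[OF schwartz_alg.mult[OF schwartz_alg.base schwartz_alg.base]]
lemmas uschwartz_coord = schwartz_alg_uschwartz[OF schwartz_alg.coord[OF schwartz_alg.base]]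
lemmas uschwartz_scale = schwartz_alg_uschwartz[OF schwartz_alg.scale[OF schwartz_alg.base]]

lemma uschwartz_cmult: "uschwartz A f \<Longrightarrow> uschwartz A (\<lambda>a x. c * f a x)"
  by (rule uschwartz_scale[where C = "norm c"]) auto

lemma uschwartz_diff: "uschwartz A f \<Longrightarrow> uschwartz A g \<Longrightarrow> uschwartz A (\<lambda>a x. f a x - g a x)"
  using uschwartz_add[of A f "\<lambda>a x. (-1) * g a x"] uschwartz_cmult[of A g "-1"] by simp

lemma uschwartz_0: "uschwartz A (\<lambda>a x. 0)"
  by (rule uschwartz_coinduct[where R = "\<lambda>g. \<forall>a. g a = (\<lambda>x. 0)"])
     (auto intro!: exI[of _ "\<lambda>a x. 0"])

lemma uschwartz_sum:
  "finite S \<Longrightarrow> (\<And>i. i \<in> S \<Longrightarrow> uschwartz A (f i)) \<Longrightarrow> uschwartz A (\<lambda>a x. \<Sum>i\<in>S. f i a x)"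
  by (induction S rule: finite_induct) (auto intro: uschwartz_0 uschwartz_add)

lemma norm_power2_sum: "complex_of_real ((norm (x::real^'n))\<^sup>2) = (\<Sum>j\<in>UNIV. of_real (x $ j) * of_real (x $ j))"
  by (simp add: norm_vec_def L2_set_def sum_nonneg power2_eq_square)

lemma uschwartz_norm2: 
  assumes "uschwartz A f" shows "uschwartz A (\<lambda>a x. of_real ((norm x)\<^sup>2) * f a x)"
proof -
  have "uschwartz A (\<lambda>a x. \<Sum>j\<in>UNIV. of_real (x $ j) * (of_real (x $ j) * f a x))"
    by (intro uschwartz_sum uschwartz_coord assms) auto
  then show ?thesis unfolding norm_power2_sum sum_distrib_right mult.assoc .
qed

lemma uschwartz_reflect:
  assumes "uschwartz A f" shows "uschwartz A (\<lambda>a x. f a (- x))"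
proof (rule uschwartz_coinduct[where R = "\<lambda>g. \<exists>h. uschwartz A h \<and> (\<forall>a\<in>A. g a = (\<lambda>x. h a (- x)))"])
  fix g :: "'a \<Rightarrow> real^'b \<Rightarrow> complex" and a x
  assume "\<exists>h. uschwartz A h \<and> (\<forall>a\<in>A. g a = (\<lambda>x. h a (- x)))" "a \<in> A"
  then obtain h where h: "uschwartz A h" "g a = (\<lambda>x. h a (- x))" by blast
  show "g a differentiable (at x)" unfolding h(2)
    by (rule differentiable_compose[of "h a" uminus])
      (auto intro!: uschwartz_differentiable[OF h(1) \<open>a \<in> A\<close>] derivative_intros)
next
  fix g :: "'a \<Rightarrow> real^'b \<Rightarrow> complex" and k
  assume "\<exists>h. uschwartz A h \<and> (\<forall>a\<in>A. g a = (\<lambda>x. h a (- x)))"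
  then obtain h where h: "uschwartz A h" "\<forall>a\<in>A. g a = (\<lambda>x. h a (- x))" by blast
  from uschwartz_poly_decay[OF h(1), of k] h(2)
  show "\<exists>C. \<forall>a\<in>A. \<forall>x. norm x ^ k * norm (g a x) \<le> C" by (metis norm_minus_cancel)
next
  fix g :: "'a \<Rightarrow> real^'b \<Rightarrow> complex" and j
  assume "\<exists>h. uschwartz A h \<and> (\<forall>a\<in>A. g a = (\<lambda>x. h a (- x)))"
  then obtain h where h: "uschwartz A h" "\<forall>a\<in>A. g a = (\<lambda>x. h a (- x))" by blast
  have "pd j (\<lambda>x. h a (- x)) x = (- 1) * pd j (h a) (- x)" if "a \<in> A" for a x
    by (simp add: pd_reflect uschwartz_differentiable[OF h(1) that])
  then have "\<forall>a\<in>A. pd j (g a) = (\<lambda>x. (- 1) * pd j (h a) (- x))" using h(2) by auto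
  moreover have "uschwartz A (\<lambda>a x. (- 1) * pd j (h a) x)"
    by (intro uschwartz_cmult uschwartz_pd h)
  ultimately show "\<exists>ha. (\<exists>h. uschwartz A h \<and> (\<forall>a\<in>A. ha a = (\<lambda>x. h a (- x)))) \<and> (\<forall>a\<in>A. pd j (g a) = ha a)"
    by (intro exI[of _ "\<lambda>a x. (- 1) * pd j (h a) (- x)"] conjI exI[of _ "\<lambda>a x. (- 1) * pd j (h a) x"]) auto
qed (use assms in blast)

section \<open>Linear and quadratic phases\<close>

lemma phase_has_derivative:
  "((\<lambda>x::real^'n. exp (\<i> * of_real (x \<bullet> \<eta> + s * (norm x)\<^sup>2))) has_derivative
     (\<lambda>v. \<i> * of_real (v \<bullet> \<eta> + 2 * s * (x \<bullet> v)) * exp (\<i> * of_real (x \<bullet> \<eta> + s * (norm x)\<^sup>2)))) (at x)"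
proof -
  have "((\<lambda>x::real^'n. x \<bullet> \<eta> + s * (x \<bullet> x)) has_derivative (\<lambda>v. v \<bullet> \<eta> + 2 * s * (x \<bullet> v))) (at x)"
    by (auto intro!: derivative_eq_intros simp: inner_commute algebra_simps)
  then have "((\<lambda>x::real^'n. \<i> * of_real (x \<bullet> \<eta> + s * (x \<bullet> x))) has_derivative (\<lambda>v. \<i> * complex_of_real (v \<bullet> \<eta> + 2 * s * (x \<bullet> v)))) (at x)"
    by (intro has_derivative_mult_right bounded_linear.has_derivative[OF bounded_linear_of_real])
  from has_derivative_compose[OF this has_field_derivative_imp_has_derivative[OF DERIV_exp]]
  show ?thesis by (simp add: power2_norm_eq_inner mult.commute)
qed

lemma pd_phase_mult:
  fixes f :: "real^'n \<Rightarrow> complex"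
  assumes "f differentiable (at x)"
  shows "pd j (\<lambda>x. exp (\<i> * of_real (x \<bullet> \<eta> + s * (norm x)\<^sup>2)) * f x) x =
    exp (\<i> * of_real (x \<bullet> \<eta> + s * (norm x)\<^sup>2)) * (pd j f x + \<i> * of_real (\<eta> $ j + 2 * s * x $ j) * f x)"
proof -
  have d: "(\<lambda>x::real^'n. exp (\<i> * of_real (x \<bullet> \<eta> + s * (norm x)\<^sup>2))) differentiable (at x)"
    using phase_has_derivative differentiable_def by blast
  show ?thesis
    by (subst pd_mult[OF d assms], subst pd_eq[OF phase_has_derivative])
      (simp add: inner_axis inner_axis' algebra_simps)
qed

text \<open>A derivative reproduces the phase with an additional factor affine in x, so derivatives
  keep the form phase times uniform family; the common bound B on \<open>\<eta>\<close> and
  \<open>s\<close> keeps the coefficients uniform. The case s = 0 is the Fourier kernel, the case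
  \<eta> = 0 the multiplier of the propagator.\<close>

lemma uschwartz_phase:
  assumes "uschwartz A f" "\<forall>a\<in>A. norm (\<eta> a) \<le> B" "\<forall>a\<in>A. \<bar>s a\<bar> \<le> B"
  shows "uschwartz A (\<lambda>a x. exp (\<i> * of_real (x \<bullet> \<eta> a + s a * (norm x)\<^sup>2)) * f a x)"
proof (rule uschwartz_coinduct[where R = "\<lambda>g. \<exists>h. uschwartz A h \<and>
    (\<forall>a\<in>A. g a = (\<lambda>x. exp (\<i> * of_real (x \<bullet> \<eta> a + s a * (norm x)\<^sup>2)) * h a x))"])
  fix g :: "'a \<Rightarrow> real^'b \<Rightarrow> complex" and a x
  assume "\<exists>h. uschwartz A h \<and> (\<forall>a\<in>A. g a = (\<lambda>x. exp (\<i> * of_real (x \<bullet> \<eta> a + s a * (norm x)\<^sup>2)) * h a x))" "a \<in> A"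
  then obtain h where h: "uschwartz A h" "g a = (\<lambda>x. exp (\<i> * of_real (x \<bullet> \<eta> a + s a * (norm x)\<^sup>2)) * h a x)" by blast
  have "(\<lambda>x::real^'b. exp (\<i> * of_real (x \<bullet> \<eta> a + s a * (norm x)\<^sup>2))) differentiable (at x)"
    using phase_has_derivative differentiable_def by blast
  then show "g a differentiable (at x)" unfolding h(2)
    by (rule differentiable_mult[OF _ uschwartz_differentiable[OF h(1) \<open>a \<in> A\<close>]])
next
  fix g :: "'a \<Rightarrow> real^'b \<Rightarrow> complex" and k
  assume "\<exists>h. uschwartz A h \<and> (\<forall>a\<in>A. g a = (\<lambda>x. exp (\<i> * of_real (x \<bullet> \<eta> a + s a * (norm x)\<^sup>2)) * h a x))"
  then obtain h where h: "uschwartz A h" "\<forall>a\<in>A. g a = (\<lambda>x. exp (\<i> * of_real (x \<bullet> \<eta> a + s a * (norm x)\<^sup>2)) * h a x)" by blast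
  from uschwartz_poly_decay[OF h(1), of k] h(2)
  show "\<exists>C. \<forall>a\<in>A. \<forall>x. norm x ^ k * norm (g a x) \<le> C" 
    by (simp add: norm_mult)
next
  fix g :: "'a \<Rightarrow> real^'b \<Rightarrow> complex" and j
  assume "\<exists>h. uschwartz A h \<and> (\<forall>a\<in>A. g a = (\<lambda>x. exp (\<i> * of_real (x \<bullet> \<eta> a + s a * (norm x)\<^sup>2)) * h a x))"
  then obtain h where h: "uschwartz A h" "\<forall>a\<in>A. g a = (\<lambda>x. exp (\<i> * of_real (x \<bullet> \<eta> a + s a * (norm x)\<^sup>2)) * h a x)" by blast
  let ?k = "\<lambda>a x. pd j (h a) x + ((\<i> * of_real (\<eta> a $ j)) * h a x + (\<i> * of_real (2 * s a)) * (of_real (x $ j) * h a x))"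
  have b: "\<bar>\<eta> a $ j\<bar> \<le> B" if "a \<in> A" for a
    using assms(2) that component_le_norm_cart[of "\<eta> a" j] by fastforce
  have "uschwartz A ?k" using assms(3) b
    by (intro uschwartz_add uschwartz_pd h uschwartz_coord uschwartz_scale[where C = "2 * B"] uschwartz_scale[where C = "B"])
       (auto simp: norm_mult)
  moreover have "\<forall>a\<in>A. pd j (g a) = (\<lambda>x. exp (\<i> * of_real (x \<bullet> \<eta> a + s a * (norm x)\<^sup>2)) * ?k a x)"
  proof (intro ballI ext)
    fix a x assume "a \<in> A"
    then show "pd j (g a) x = exp (\<i> * of_real (x \<bullet> \<eta> a + s a * (norm x)\<^sup>2)) * ?k a x"
      unfolding h(2)[rule_format, OF \<open>a \<in> A\<close>]
        pd_phase_mult[OF uschwartz_differentiable[OF h(1) \<open>a \<in> A\<close>]]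
      by (simp add: algebra_simps)
  qed
  ultimately show "\<exists>ha. (\<exists>h. uschwartz A h \<and> (\<forall>a\<in>A. ha a = (\<lambda>x. exp (\<i> * of_real (x \<bullet> \<eta> a + s a * (norm x)\<^sup>2)) * h a x))) \<and> (\<forall>a\<in>A. pd j (g a) = ha a)"
    by (intro exI[of _ "\<lambda>a x. exp (\<i> * of_real (x \<bullet> \<eta> a + s a * (norm x)\<^sup>2)) * ?k a x"] conjI exI[of _ ?k]) auto
qed (use assms in blast)

section \<open>Integration of rapidly decaying functions\<close>

lemma vector_mvt_bound:
  fixes f :: "real \<Rightarrow> 'b::real_normed_vector"
  assumes "\<And>t. t \<in> {a<..<b} \<Longrightarrow> (f has_vector_derivative f' t) (at t)"
    and "\<And>t. t \<in> {a<..<b} \<Longrightarrow> norm (f' t) \<le> B" and "s \<in> {a<..<b}" "t \<in> {a<..<b}"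
  shows "norm (f s - f t) \<le> B * \<bar>s - t\<bar>"
proof -
  have "norm (f s - f t) \<le> B * norm (s - t)"
  proof (rule differentiable_bound[where S = "{a<..<b}" and f' = "\<lambda>t h. h *\<^sub>R f' t"])
    show "onorm (\<lambda>h. h *\<^sub>R f' x) \<le> B" if "x \<in> {a<..<b}" for x
      using assms(2)[OF that]
      by (intro onorm_le) (simp add: mult.commute[of B] mult_left_mono)
  qed (use assms in \<open>auto simp: has_vector_derivative_def has_derivative_at_withinI\<close>)
  then show ?thesis by simp
qed

lemma has_vector_derivative_iff_quotient:
  fixes f :: "real \<Rightarrow> 'b::real_normed_vector"
  shows "(f has_vector_derivative D) (at t) \<longleftrightarrow> ((\<lambda>s. (f s - f t) /\<^sub>R (s - t)) \<longlongrightarrow> D) (at t)"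
proof -
  have "(f has_vector_derivative D) (at t) \<longleftrightarrow>
      ((\<lambda>y. norm ((f y - f t) - (y - t) *\<^sub>R D) / norm (y - t)) \<longlongrightarrow> 0) (at t)"
    unfolding has_vector_derivative_def has_derivative_iff_norm
    using bounded_linear_scaleR_left[of D] by simp
  also have "\<dots> \<longleftrightarrow> ((\<lambda>s. norm ((f s - f t) /\<^sub>R (s - t) - D)) \<longlongrightarrow> 0) (at t)"
  proof (rule filterlim_cong[OF refl refl], unfold eventually_at_filter, intro always_eventually allI impI)
    fix y assume "y \<noteq> t"
    then have "(f y - f t) /\<^sub>R (y - t) - D = ((f y - f t) - (y - t) *\<^sub>R D) /\<^sub>R (y - t)"
      by (simp add: scaleR_right_diff_distrib)
    then show "norm ((f y - f t) - (y - t) *\<^sub>R D) / norm (y - t) = norm ((f y - f t) /\<^sub>R (y - t) - D)"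
      by (simp add: divide_inverse ac_simps)
  qed
  also have "\<dots> \<longleftrightarrow> ((\<lambda>s. (f s - f t) /\<^sub>R (s - t)) \<longlongrightarrow> D) (at t)"
    unfolding tendsto_norm_zero_iff by (rule LIM_zero_iff)
  finally show ?thesis .
qed

text \<open>Dominated convergence for a real parameter is reduced to sequences approaching t. The
  majorant is assumed only near t, so an initial segment of each sequence is discarded
  first.\<close>

lemma tendsto_integral_at:
  fixes h :: "real \<Rightarrow> 'a \<Rightarrow> 'b::{banach, second_countable_topology}"
  assumes lim: "\<And>x. ((\<lambda>s. h s x) \<longlongrightarrow> l x) (at t within S)"
    and ev: "eventually (\<lambda>s. h s \<in> borel_measurable M \<and> (\<forall>x. norm (h s x) \<le> g x)) (at t within S)"
    and g: "integrable M g"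
  shows "((\<lambda>s. LINT x|M. h s x) \<longlongrightarrow> (LINT x|M. l x)) (at t within S)"
  unfolding tendsto_at_iff_sequentially comp_def
proof (intro allI impI)
  fix X :: "nat \<Rightarrow> real" assume X: "\<forall>i. X i \<in> S - {t}" "X \<longlonglongrightarrow> t"
  then have "filterlim X (at t within S) sequentially"
    unfolding filterlim_at by (auto intro!: always_eventually)
  with ev have "eventually (\<lambda>i. h (X i) \<in> borel_measurable M \<and> (\<forall>x. norm (h (X i) x) \<le> g x)) sequentially"
    unfolding filterlim_iff by blast
  then obtain N where N: "\<And>i. i \<ge> N \<Longrightarrow> h (X i) \<in> borel_measurable M \<and> (\<forall>x. norm (h (X i) x) \<le> g x)"
    unfolding eventually_sequentially by blast
  have l: "(\<lambda>i. h (X (i + N)) x) \<longlonglongrightarrow> l x" for x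
    using lim[of x] X unfolding tendsto_at_iff_sequentially comp_def by (metis LIMSEQ_ignore_initial_segment)
  have "(\<lambda>i. LINT x|M. h (X (i + N)) x) \<longlonglongrightarrow> (LINT x|M. l x)"
  proof (rule integral_dominated_convergence[where w = g])
    show "l \<in> borel_measurable M"
      by (rule borel_measurable_LIMSEQ_metric[of "\<lambda>i. h (X (i + N))"]) (use N l in auto)
  qed (use N l g in auto)
  then show "(\<lambda>i. LINT x|M. h (X i) x) \<longlonglongrightarrow> (LINT x|M. l x)" by (rule LIMSEQ_offset)
qed

text \<open>By the mean value inequality the same g that bounds the derivative bounds all difference
  quotients, so differentiation under the integral is dominated convergence of these
  quotients.\<close>

lemma has_vector_derivative_integral:
  fixes f :: "real \<Rightarrow> 'a \<Rightarrow> 'b::{banach, second_countable_topology}"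
  assumes t0: "t0 \<in> {a<..<b}"
    and deriv: "\<And>t x. t \<in> {a<..<b} \<Longrightarrow> ((\<lambda>t. f t x) has_vector_derivative f' t x) (at t)"
    and int: "\<And>t. t \<in> {a<..<b} \<Longrightarrow> integrable M (f t)"
    and bound: "\<And>t x. t \<in> {a<..<b} \<Longrightarrow> norm (f' t x) \<le> g x"
    and g: "integrable M g"
  shows "((\<lambda>t. LINT x|M. f t x) has_vector_derivative (LINT x|M. f' t0 x)) (at t0)"
proof -
  have ev: "eventually (\<lambda>s. s \<in> {a<..<b}) (at t0)"
    using t0 by (intro eventually_at_in_open') auto
  have "((\<lambda>s. LINT x|M. (f s x - f t0 x) /\<^sub>R (s - t0)) \<longlongrightarrow> (LINT x|M. f' t0 x)) (at t0)"
  proof (rule tendsto_integral_at[OF _ _ g])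
    show "((\<lambda>s. (f s x - f t0 x) /\<^sub>R (s - t0)) \<longlongrightarrow> f' t0 x) (at t0)" for x
      using deriv[OF t0] unfolding has_vector_derivative_iff_quotient .
    show "\<forall>\<^sub>F s in at t0. (\<lambda>x. (f s x - f t0 x) /\<^sub>R (s - t0)) \<in> borel_measurable M \<and>
        (\<forall>x. norm ((f s x - f t0 x) /\<^sub>R (s - t0)) \<le> g x)"
      using ev eventually_neq_at_within[of t0 t0 UNIV]
    proof eventually_elim
      case (elim s)
      have "norm ((f s x - f t0 x) /\<^sub>R (s - t0)) \<le> g x" for x
      proof -
        have "norm (f s x - f t0 x) \<le> g x * \<bar>s - t0\<bar>"
          by (rule vector_mvt_bound[OF deriv bound]) (use elim t0 in auto)
        with elim show ?thesis by (simp add: divide_simps)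
      qed
      moreover have "(\<lambda>x. (f s x - f t0 x) /\<^sub>R (s - t0)) \<in> borel_measurable M"
        using borel_measurable_integrable[OF int[OF elim(1)]] borel_measurable_integrable[OF int[OF t0]]
        by measurable
      ultimately show ?case by blast
    qed
  qed
  moreover have "eventually (\<lambda>s. (LINT x|M. (f s x - f t0 x) /\<^sub>R (s - t0)) =
      ((LINT x|M. f s x) - (LINT x|M. f t0 x)) /\<^sub>R (s - t0)) (at t0)"
    using ev by eventually_elim (use int t0 in simp)
  ultimately show ?thesis unfolding has_vector_derivative_iff_quotient
    by (rule Lim_transform_eventually)
qed

text \<open>The common majorant of the whole development. Its product form gives integrability in
  every dimension by reduction to the line, without an exponent that depends on the
  dimension.\<close>

definition decay :: "real^'n \<Rightarrow> real" where
  "decay x = (\<Prod>j\<in>UNIV. inverse (1 + (x $ j)\<^sup>2))"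

lemma decay_pos: "decay x > 0"
  unfolding decay_def by (intro prod_pos) (auto intro: add_pos_nonneg)

lemma integrable_inverse_1_plus_sq: "integrable lborel (\<lambda>x::real. inverse (1 + x\<^sup>2))"
  using integrable_inverse_1_plus_square by (simp add: set_integrable_def)

text \<open>Lebesgue measure on the space is the image of the product of one-dimensional Lebesgue
  measures indexed by the basis vectors, and under this map the weight becomes a product of
  functions of one variable.\<close>

lemma integrable_decay: "integrable lborel (decay :: real^'n \<Rightarrow> real)"
proof -
  interpret product_sigma_finite "\<lambda>_::real^'n. lborel :: real measure" ..
  have bas: "(Basis :: (real^'n) set) = (\<lambda>j. axis j 1) ` UNIV"
    by (auto simp: Basis_vec_def)
  have inj: "inj (\<lambda>j::'n. axis j (1::real))" by (auto simp: inj_on_def axis_eq_axis)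
  have decay_eq: "decay x = (\<Prod>b\<in>Basis. inverse (1 + (x \<bullet> b)\<^sup>2))" for x :: "real^'n"
    unfolding bas decay_def by (subst prod.reindex[OF inj]) (simp add: inner_axis)
  have meas: "(decay :: real^'n \<Rightarrow> real) \<in> borel_measurable borel"
    unfolding decay_def[abs_def] by (intro borel_measurable_continuous_onI continuous_intros)
       (auto simp: add_nonneg_eq_0_iff)
  have "integrable (\<Pi>\<^sub>M b\<in>(Basis :: (real^'n) set). lborel) (\<lambda>f. \<Prod>b\<in>Basis. inverse (1 + (f b :: real)\<^sup>2))"
    by (rule product_integrable_prod[where f = "\<lambda>_ y. inverse (1 + y\<^sup>2)"])
      (auto intro: integrable_inverse_1_plus_sq)
  then have "integrable (\<Pi>\<^sub>M b\<in>(Basis :: (real^'n) set). lborel) (\<lambda>f. decay (\<Sum>b\<in>Basis. f b *\<^sub>R b))"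
    unfolding decay_eq by (simp add: inner_sum_left inner_Basis if_distrib cong: prod.cong if_cong)
  then show ?thesis
    by (subst lborel_eq, subst integrable_distr_eq) (use meas in auto)
qed

text \<open>Only the factor in direction i changes. For it, y^2 \<le> 2 (s + y)^2 + 2 s^2 and |s|
  \<le> 1 give 1 + y^2 \<le> 3 (1 + (s + y)^2), whence the constant 3.\<close>

lemma decay_translate:
  assumes "\<bar>s\<bar> \<le> 1" shows "decay (s *\<^sub>R axis i 1 + x) \<le> 3 * decay x"
proof -
  have sq: "inverse (1 + (s + y)\<^sup>2) \<le> 3 * inverse (1 + y\<^sup>2)" for y :: real
  proof -
    have "y\<^sup>2 \<le> 2 * (s + y)\<^sup>2 + 2 * s\<^sup>2"
      using zero_le_power2[of "2 * s + y"] by (simp add: power2_eq_square algebra_simps)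
    moreover have "s\<^sup>2 \<le> 1" using assms by (simp add: abs_square_le_1)
    moreover have "1 + w \<le> 3 * (1 + z)" if "w \<le> 2 * z + 2 * v" "v \<le> 1" "0 \<le> z" for z v w :: real
      using that by argo
    ultimately have "1 + y\<^sup>2 \<le> 3 * (1 + (s + y)\<^sup>2)" by (meson zero_le_power2)
    then show ?thesis by (simp add: divide_simps add_pos_nonneg add_nonneg_eq_0_iff)
  qed
  have "decay (s *\<^sub>R axis i 1 + x) = inverse (1 + (s + x $ i)\<^sup>2) * (\<Prod>j\<in>UNIV - {i}. inverse (1 + (x $ j)\<^sup>2))"
    unfolding decay_def by (subst prod.remove[of UNIV i]) (auto simp: axis_def)
  also have "\<dots> \<le> (3 * inverse (1 + (x $ i)\<^sup>2)) * (\<Prod>j\<in>UNIV - {i}. inverse (1 + (x $ j)\<^sup>2))"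
    by (intro mult_right_mono sq prod_nonneg) auto
  also have "\<dots> = 3 * decay x"
    unfolding decay_def by (subst prod.remove[of UNIV i]) auto
  finally show ?thesis .
qed

text \<open>Multiplying by 1 + x_j^2, one coordinate after another, preserves uniform families;
  hence f divided by the weight is bounded uniformly in the parameter.\<close>

lemma uschwartz_decay:
  assumes "uschwartz A f"
  obtains C where "C \<ge> 0" "\<And>a x. a \<in> A \<Longrightarrow> norm (f a x) \<le> C * decay x"
proof -
  have "uschwartz A (\<lambda>a x. of_real (\<Prod>j\<in>S. 1 + (x $ j)\<^sup>2) * f a x)" if "finite S" for S
    using that
  proof (induction S rule: finite_induct)
    case empty
    then show ?case using assms by simp
  next
    case (insert j S)
    let ?g = "\<lambda>a x. of_real (\<Prod>j\<in>S. 1 + (x $ j)\<^sup>2) * f a x"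
    have "uschwartz A (\<lambda>a x. ?g a x + of_real (x $ j) * (of_real (x $ j) * ?g a x))"
      by (intro uschwartz_add uschwartz_coord insert)
    also have "(\<lambda>a x. ?g a x + of_real (x $ j) * (of_real (x $ j) * ?g a x)) =
      (\<lambda>a x. of_real (\<Prod>j\<in>insert j S. 1 + (x $ j)\<^sup>2) * f a x)"
      using insert by (auto simp: fun_eq_iff algebra_simps power2_eq_square)
    finally show ?case .
  qed
  from uschwartz_poly_decay[OF this[of UNIV], of 0] obtain C where
    C: "\<And>a x. a \<in> A \<Longrightarrow> norm (of_real (\<Prod>j\<in>UNIV. 1 + (x $ j)\<^sup>2) * f a x) \<le> C" by auto
  have "norm (f a x) \<le> \<bar>C\<bar> * decay x" if "a \<in> A" for a x
  proof -
    have "decay x * (\<Prod>j\<in>UNIV. 1 + (x $ j)\<^sup>2) = 1"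
      unfolding decay_def prod.distrib[symmetric]
      by (intro prod.neutral) (auto simp: add_nonneg_eq_0_iff)
    moreover have "(\<Prod>j\<in>UNIV. 1 + (x $ j)\<^sup>2) \<ge> 0" by (intro prod_nonneg) auto
    ultimately have "norm (f a x) = decay x * norm (of_real (\<Prod>j\<in>UNIV. 1 + (x $ j)\<^sup>2) * f a x)"
      unfolding norm_mult norm_of_real by (metis abs_of_nonneg mult.assoc mult_1)
    also have "\<dots> \<le> decay x * \<bar>C\<bar>"
      using order_trans[OF C[OF that] abs_ge_self] decay_pos[of x] by (intro mult_left_mono) auto
    finally show ?thesis by (simp add: mult.commute)
  qed
  then show ?thesis using that[of "\<bar>C\<bar>"] by auto
qed

section \<open>Single Schwartz functions and integration by parts\<close>

lemmas schwartz_unit = schwartz_iff_uschwartz[of _ "()"]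

lemma schwartz_differentiable: "schwartz f \<Longrightarrow> f differentiable (at x)"
  unfolding schwartz_unit by (drule uschwartz_differentiable) auto

lemma schwartz_continuous: "schwartz f \<Longrightarrow> continuous_on S f"
  using schwartz_differentiable differentiable_imp_continuous_within
  by (metis continuous_at_imp_continuous_on)

lemma schwartz_measurable [measurable (raw)]: "schwartz f \<Longrightarrow> f \<in> borel_measurable borel"
  by (intro borel_measurable_continuous_onI schwartz_continuous)

lemma schwartz_pd: "schwartz f \<Longrightarrow> schwartz (pd j f)"
  and schwartz_cnj: "schwartz f \<Longrightarrow> schwartz (\<lambda>x. cnj (f x))"
  and schwartz_add: "schwartz f \<Longrightarrow> schwartz g \<Longrightarrow> schwartz (\<lambda>x. f x + g x)"
  and schwartz_diff: "schwartz f \<Longrightarrow> schwartz g \<Longrightarrow> schwartz (\<lambda>x. f x - g x)"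
  and schwartz_mult: "schwartz f \<Longrightarrow> schwartz g \<Longrightarrow> schwartz (\<lambda>x. f x * g x)"
  and schwartz_coord: "schwartz f \<Longrightarrow> schwartz (\<lambda>x. of_real (x $ j) * f x)"
  and schwartz_cmult: "schwartz f \<Longrightarrow> schwartz (\<lambda>x. c * f x)"
  and schwartz_norm2: "schwartz f \<Longrightarrow> schwartz (\<lambda>x. of_real ((norm x)\<^sup>2) * f x)"
  unfolding schwartz_unit
  by (fact uschwartz_pd uschwartz_cnj uschwartz_add uschwartz_diff uschwartz_mult uschwartz_coord
      uschwartz_cmult uschwartz_norm2)+

lemma schwartz_sum:
  "finite S \<Longrightarrow> (\<And>i. i \<in> S \<Longrightarrow> schwartz (f i)) \<Longrightarrow> schwartz (\<lambda>x. \<Sum>i\<in>S. f i x)"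
  unfolding schwartz_unit by (rule uschwartz_sum)

lemma schwartz_decay:
  assumes "schwartz f"
  obtains C where "C \<ge> 0" "\<And>x. norm (f x) \<le> C * decay x"
  using uschwartz_decay[OF assms[unfolded schwartz_unit]] by (metis insertI1)

lemma integrable_decay_bound:
  assumes "f \<in> borel_measurable borel" "\<And>x. norm (f x :: complex) \<le> C * decay x"
  shows "integrable lborel f"
  by (rule Bochner_Integration.integrable_bound[of lborel "\<lambda>x. C * decay x"])
     (use assms order_trans[OF norm_ge_zero assms(2)] in \<open>auto intro!: integrable_decay\<close>)

lemma schwartz_integrable: 
  assumes "schwartz f" shows "integrable lborel f"
proof -
  obtain C where "C \<ge> 0" "\<And>x. norm (f x) \<le> C * decay x" using schwartz_decay[OF assms] by blast
  then show ?thesis using integrable_decay_bound[OF schwartz_measurable[OF assms]] by blast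
qed

lemma curve_has_vector_derivative:
  assumes "f differentiable (at (t *\<^sub>R axis j 1 + x))"
  shows "((\<lambda>t. f (t *\<^sub>R axis j 1 + x)) has_vector_derivative pd j f (t *\<^sub>R axis j 1 + x)) (at t)"
proof -
  let ?D = "frechet_derivative f (at (t *\<^sub>R axis j 1 + x))"
  have "((\<lambda>t. t *\<^sub>R axis j 1 + x) has_derivative (\<lambda>h. h *\<^sub>R axis j 1)) (at t)"
    by (auto intro!: derivative_eq_intros)
  from has_derivative_compose[OF this has_derivative_frechet[OF assms]]
  have "((\<lambda>t. f (t *\<^sub>R axis j 1 + x)) has_derivative (\<lambda>h. ?D (h *\<^sub>R axis j 1))) (at t)" .
  also have "(\<lambda>h. ?D (h *\<^sub>R axis j 1)) = (\<lambda>h. h *\<^sub>R pd j f (t *\<^sub>R axis j 1 + x))"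
    unfolding pd_def using linear_frechet_derivative[OF assms] by (simp add: linear_scale)
  finally show ?thesis unfolding has_vector_derivative_def .
qed

lemma lborel_integral_translation:
  fixes f :: "'a::euclidean_space \<Rightarrow> 'b::{banach, second_countable_topology}"
  assumes "f \<in> borel_measurable borel"
  shows "(LINT x|lborel. f (c + x)) = (LINT x|lborel. f x)"
  by (subst (2) lborel_distr_plus[symmetric, of c], subst integral_distr) (use assms in auto)

text \<open>The integral of a translate of f along the j-th axis is independent of the translation,
  so its derivative at 0 vanishes; differentiating under the integral identifies that derivative
  with the integral of \<open>pd j f\<close>. No iterated integrals and no boundary terms at
  infinity enter.\<close>

lemma integral_pd_eq_0:
  assumes "schwartz f" shows "(LINT x|lborel. pd j f x) = 0"
proof -
  let ?f = "\<lambda>t x. f (t *\<^sub>R axis j 1 + x)"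
  obtain C where C: "C \<ge> 0" "\<And>x. norm (f x) \<le> C * decay x" using schwartz_decay[OF assms] by blast
  obtain B where B: "B \<ge> 0" "\<And>x. norm (pd j f x) \<le> B * decay x" using schwartz_decay[OF schwartz_pd[OF assms]] by blast
  have bd: "K * decay (t *\<^sub>R axis j 1 + x) \<le> (3 * K) * decay x" if "t \<in> {-1<..<1}" "K \<ge> 0" for t x K
    using mult_left_mono[OF decay_translate[of t j x], of K] that by (auto simp: ac_simps)
  have m: "(\<lambda>x. f (t *\<^sub>R axis j 1 + x)) \<in> borel_measurable borel" for t
    using schwartz_measurable[OF assms] by measurable
  have "((\<lambda>t. LINT x|lborel. ?f t x) has_vector_derivative (LINT x|lborel. pd j f (0 *\<^sub>R axis j 1 + x))) (at 0)"
  proof (rule has_vector_derivative_integral[where a = "-1" and b = 1 and g = "\<lambda>x. (3 * B) * decay x"])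
    show "integrable lborel (?f t)" if "t \<in> {-1<..<1}" for t
      using order_trans[OF C(2) bd[OF that C(1)]] by (intro integrable_decay_bound m)
    show "norm (pd j f (t *\<^sub>R axis j 1 + x)) \<le> (3 * B) * decay x" if "t \<in> {-1<..<1}" for t x
      using order_trans[OF B(2) bd[OF that B(1)]] .
  qed (auto intro!: curve_has_vector_derivative schwartz_differentiable assms integrable_decay)
  also have "(\<lambda>t. LINT x|lborel. ?f t x) = (\<lambda>t. LINT x|lborel. f x)"
    using lborel_integral_translation[OF schwartz_measurable[OF assms]] by auto
  finally have "((\<lambda>t::real. LINT x|lborel. f x) has_vector_derivative (LINT x|lborel. pd j f x)) (at 0)"
    by simp
  from vector_derivative_unique_at[OF this has_vector_derivative_const] show ?thesis .
qed

lemma integration_by_parts: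
  assumes "schwartz f" "schwartz g"
  shows "(LINT x|lborel. pd j f x * g x) = - (LINT x|lborel. f x * pd j g x)"
proof -
  have "0 = (LINT x|lborel. pd j (\<lambda>x. f x * g x) x)"
    using integral_pd_eq_0[OF schwartz_mult[OF assms]] by simp
  also have "\<dots> = (LINT x|lborel. f x * pd j g x + pd j f x * g x)"
    using assms by (simp add: pd_mult schwartz_differentiable)
  also have "\<dots> = (LINT x|lborel. f x * pd j g x) + (LINT x|lborel. pd j f x * g x)"
    by (intro Bochner_Integration.integral_add schwartz_integrable schwartz_mult schwartz_pd assms)
  finally show ?thesis by (simp add: eq_neg_iff_add_eq_0 add.commute)
qed

section \<open>The Fourier transform and the free propagator\<close>

text \<open>Allowing f and the frequency to depend on a common parameter makes the lemma applicable
  twice in a row, which gives joint measurability of the propagator in \<sigma> and x, an input of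
  Fubini.\<close>

lemma measurable_fourier [measurable]:
  fixes f :: "'a \<Rightarrow> real^'n \<Rightarrow> complex"
  assumes f: "(\<lambda>(z, x). f z x) \<in> borel_measurable (M \<Otimes>\<^sub>M borel)" and \<xi>: "\<xi> \<in> borel_measurable M"
  shows "(\<lambda>z. fourier (f z) (\<xi> z)) \<in> borel_measurable M"
proof -
  have f': "(\<lambda>w. f (fst w) (snd w)) \<in> borel_measurable (M \<Otimes>\<^sub>M borel)"
    using f by (simp add: case_prod_beta)
  have "(\<lambda>w. exp (- \<i> * complex_of_real (snd w \<bullet> \<xi> (fst w))) * f (fst w) (snd w)) \<in> borel_measurable (M \<Otimes>\<^sub>M borel)"
    using \<xi> f' by measurable
  then have "(\<lambda>(z, x). exp (- \<i> * complex_of_real (x \<bullet> \<xi> z)) * f z x) \<in> borel_measurable (M \<Otimes>\<^sub>M lborel)"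
    by (simp add: case_prod_beta cong: measurable_cong_sets)
  from lborel.borel_measurable_lebesgue_integral[OF this] show ?thesis
    unfolding fourier_def by simp
qed

lemma integrable_fourier_kernel:
  assumes "integrable lborel f"
  shows "integrable lborel (\<lambda>x::real^'n. exp (- \<i> * of_real (x \<bullet> \<xi>)) * (f x :: complex))"
proof (rule Bochner_Integration.integrable_bound[OF assms])
  have "(\<lambda>x::real^'n. exp (- \<i> * complex_of_real (x \<bullet> \<xi>))) \<in> borel_measurable lborel"
    by simp
  with borel_measurable_integrable[OF assms] 
  show "(\<lambda>x. exp (- \<i> * of_real (x \<bullet> \<xi>)) * f x) \<in> borel_measurable lborel"
    by measurable
qed (simp add: norm_mult)

lemma norm_fourier_le: "norm (fourier f \<xi>) \<le> (LINT x|lborel. norm (f x))"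
  unfolding fourier_def
  by (rule order_trans[OF integral_norm_bound]) (simp add: norm_mult)

lemma fourier_add:
  "integrable lborel f \<Longrightarrow> integrable lborel g \<Longrightarrow>
    fourier (\<lambda>x. f x + g x) \<xi> = fourier f \<xi> + fourier g \<xi>"
  unfolding fourier_def distrib_left
  by (intro Bochner_Integration.integral_add integrable_fourier_kernel)

lemma fourier_cmult: "fourier (\<lambda>x. c * f x) \<xi> = c * fourier f \<xi>"
  unfolding fourier_def by (simp add: mult.left_commute)

lemma fourier_sum:
  "(\<And>i. i \<in> S \<Longrightarrow> integrable lborel (f i)) \<Longrightarrow>
    fourier (\<lambda>x. \<Sum>i\<in>S. f i x) \<xi> = (\<Sum>i\<in>S. fourier (f i) \<xi>)"
  unfolding fourier_def sum_distrib_left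
  by (intro Bochner_Integration.integral_sum integrable_fourier_kernel)

lemma fourier_cnj: "fourier (\<lambda>x. cnj (f x)) \<xi> = cnj (fourier f (- \<xi>))"
  unfolding fourier_def by (subst Bochner_Integration.integral_cnj[symmetric]) (simp add: exp_cnj)

lemma uschwartz_fourier_bounded:
  assumes "uschwartz A f"
  shows "\<exists>C. \<forall>a\<in>A. \<forall>\<xi>. norm (fourier (f a) \<xi>) \<le> C"
proof -
  obtain C where C: "C \<ge> 0" "\<And>a x. a \<in> A \<Longrightarrow> norm (f a x) \<le> C * decay x"
    using uschwartz_decay[OF assms] by blast
  have "norm (fourier (f a) \<xi>) \<le> (LINT x|lborel. C * decay (x::real^'b))" if "a \<in> A" for a \<xi>
    using that C(2)
    by (intro order_trans[OF norm_fourier_le] integral_mono integrable_norm schwartz_integrable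
        uschwartzD_schwartz[OF assms] integrable_mult_right integrable_decay) auto
  then show ?thesis by blast
qed

text \<open>A full Frechet derivative is required because \<open>pd\<close> is defined through it.
  The first-order Taylor remainder of the kernel is at most |x|^2 |h|^2, and |x|^2 f is
  integrable.\<close>

lemma fourier_has_derivative:
  assumes "schwartz f"
  shows "(fourier f has_derivative
    (\<lambda>h. \<Sum>j\<in>UNIV. of_real (h $ j) * fourier (\<lambda>x. - \<i> * (of_real (x $ j) * f x)) \<xi>)) (at \<xi>)"
    (is "(_ has_derivative ?D) _")
  unfolding has_derivative_iff_norm
proof
  show "bounded_linear ?D"
    by (intro bounded_linear_sum bounded_linear_mult_const bounded_linear_compose[OF bounded_linear_of_real]
        bounded_linear_vec_nth)
  define K where "K = (LINT x|lborel. norm (of_real ((norm x)\<^sup>2) * f x))"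
  have est: "norm (fourier f y - fourier f \<xi> - ?D (y - \<xi>)) \<le> (norm (y - \<xi>))\<^sup>2 * K" for y
  proof -
    let ?h = "y - \<xi>"
    have int0: "integrable lborel (\<lambda>x. - \<i> * (of_real (x $ j) * f x))" for j
      by (intro schwartz_integrable schwartz_cmult schwartz_coord assms)
    have D: "?D ?h = fourier (\<lambda>x. - \<i> * of_real (x \<bullet> ?h) * f x) \<xi>"
    proof -
      have "?D ?h = (\<Sum>j\<in>UNIV. fourier (\<lambda>x. of_real (?h $ j) * (- \<i> * (of_real (x $ j) * f x))) \<xi>)"
        by (simp only: fourier_cmult)
      also have "\<dots> = fourier (\<lambda>x. \<Sum>j\<in>UNIV. of_real (?h $ j) * (- \<i> * (of_real (x $ j) * f x))) \<xi>"
        by (intro fourier_sum[symmetric] integrable_mult_right int0)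
      also have "\<dots> = fourier (\<lambda>x. - \<i> * of_real (x \<bullet> ?h) * f x) \<xi>"
        by (simp add: inner_vec_def sum_distrib_left sum_distrib_right ac_simps)
      finally show ?thesis .
    qed
    have int1: "integrable lborel (\<lambda>x. exp (- \<i> * of_real (x \<bullet> \<xi>)) * (- \<i> * of_real (x \<bullet> ?h) * f x))"
    proof (rule integrable_fourier_kernel)
      have "integrable lborel (\<lambda>x. \<Sum>j\<in>UNIV. of_real (?h $ j) * (- \<i> * (of_real (x $ j) * f x)))"
        by (intro Bochner_Integration.integrable_sum integrable_mult_right int0)
      then show "integrable lborel (\<lambda>x. - \<i> * of_real (x \<bullet> ?h) * f x)"
        by (simp add: inner_vec_def sum_distrib_left sum_distrib_right ac_simps)
    qed
    note int2 = integrable_fourier_kernel[OF schwartz_integrable[OF assms]]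
    have "fourier f y - fourier f \<xi> - ?D ?h = 
        (LINT x|lborel. exp (- \<i> * of_real (x \<bullet> y)) * f x - exp (- \<i> * of_real (x \<bullet> \<xi>)) * f x
          - exp (- \<i> * of_real (x \<bullet> \<xi>)) * (- \<i> * of_real (x \<bullet> ?h) * f x))"
      unfolding D unfolding fourier_def using int1 int2 by simp
    also have "norm \<dots> \<le> (LINT x|lborel. (norm ?h)\<^sup>2 * norm (of_real ((norm x)\<^sup>2) * f x))"
    proof (rule order_trans[OF integral_norm_bound integral_mono], rule integrable_norm)
      show "integrable lborel (\<lambda>x. exp (- \<i> * of_real (x \<bullet> y)) * f x - exp (- \<i> * of_real (x \<bullet> \<xi>)) * f x
          - exp (- \<i> * of_real (x \<bullet> \<xi>)) * (- \<i> * of_real (x \<bullet> ?h) * f x))"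
        by (intro Bochner_Integration.integrable_diff int1 int2)
      show "integrable lborel (\<lambda>x. (norm ?h)\<^sup>2 * norm (of_real ((norm x)\<^sup>2) * f x))"
        by (intro integrable_mult_right integrable_norm schwartz_integrable schwartz_norm2 assms)
      fix x
      let ?e = "exp (- \<i> * complex_of_real (x \<bullet> \<xi>))" and ?t = "- (x \<bullet> ?h)"
      have "exp (- \<i> * of_real (x \<bullet> y)) = ?e * exp (\<i> * complex_of_real ?t)"
        by (simp add: exp_add[symmetric] inner_diff_right algebra_simps)
      then have "exp (- \<i> * of_real (x \<bullet> y)) * f x - ?e * f x - ?e * (- \<i> * of_real (x \<bullet> ?h) * f x)
          = ?e * (exp (\<i> * of_real ?t) - (1 + \<i> * of_real ?t)) * f x"
        by (simp add: algebra_simps)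
      also have "norm \<dots> = norm (exp (\<i> * complex_of_real ?t) - (1 + \<i> * of_real ?t)) * norm (f x)"
        by (simp add: norm_mult)
      also have "\<dots> \<le> ((norm x)\<^sup>2 * (norm ?h)\<^sup>2) * norm (f x)"
      proof (rule mult_right_mono)
        have "norm (exp (\<i> * complex_of_real ?t) - (1 + \<i> * of_real ?t)) \<le> \<bar>?t\<bar>\<^sup>2 / 2"
          using iexp_approx1[of ?t 1] by (simp add: numeral_2_eq_2 lessThan_Suc atMost_Suc)
        also have "\<dots> \<le> \<bar>x \<bullet> ?h\<bar>\<^sup>2" by simp
        also have "\<dots> \<le> (norm x * norm ?h)\<^sup>2"
          by (intro power_mono Cauchy_Schwarz_ineq2) simp
        finally show "norm (exp (\<i> * complex_of_real ?t) - (1 + \<i> * of_real ?t)) \<le> (norm x)\<^sup>2 * (norm ?h)\<^sup>2"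
          by (simp add: power_mult_distrib)
      qed simp
      finally show "norm (exp (- \<i> * of_real (x \<bullet> y)) * f x - ?e * f x - ?e * (- \<i> * of_real (x \<bullet> ?h) * f x))
          \<le> (norm ?h)\<^sup>2 * norm (of_real ((norm x)\<^sup>2) * f x)"
        by (simp only: norm_mult norm_of_real abs_power2 ac_simps)
    qed
    also have "\<dots> = (norm ?h)\<^sup>2 * K" unfolding K_def by simp
    finally show ?thesis .
  qed
  show "((\<lambda>y. norm (fourier f y - fourier f \<xi> - ?D (y - \<xi>)) / norm (y - \<xi>)) \<longlongrightarrow> 0) (at \<xi>)"
  proof (rule tendsto_sandwich[where f = "\<lambda>_. 0" and h = "\<lambda>y. norm (y - \<xi>) * K"])
    show "\<forall>\<^sub>F y in at \<xi>. norm (fourier f y - fourier f \<xi> - ?D (y - \<xi>)) / norm (y - \<xi>) \<le> norm (y - \<xi>) * K"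
      unfolding eventually_at_filter
    proof (intro always_eventually allI impI)
      fix y assume "y \<noteq> \<xi>"
      with est[of y] show "norm (fourier f y - fourier f \<xi> - ?D (y - \<xi>)) / norm (y - \<xi>) \<le> norm (y - \<xi>) * K"
        by (simp add: divide_le_eq power2_eq_square ac_simps)
    qed
    have "((\<lambda>y. norm (y - \<xi>) * K) \<longlongrightarrow> norm (\<xi> - \<xi>) * K) (at \<xi>)" by (intro tendsto_intros)
    then show "((\<lambda>y. norm (y - \<xi>) * K) \<longlongrightarrow> 0) (at \<xi>)" by simp
  qed (auto intro: always_eventually)
qed

lemma pd_fourier:
  assumes "schwartz f"
  shows "pd j (fourier f) = fourier (\<lambda>x. - \<i> * (of_real (x $ j) * f x))"
proof
  fix \<xi>
  have "complex_of_real (axis j 1 $ k) * z = (if k = j then z else 0)" for k z by (simp add: axis_def)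
  then show "pd j (fourier f) \<xi> = fourier (\<lambda>x. - \<i> * (of_real (x $ j) * f x)) \<xi>"
    by (simp add: pd_eq[OF fourier_has_derivative[OF assms]])
qed

text \<open>The partial derivative of kernel times f integrates to zero, and differentiating the
  kernel contributes the factor - i times \<open>\<xi> $ j\<close>.\<close>

lemma fourier_pd:
  assumes "schwartz f"
  shows "fourier (pd j f) \<xi> = \<i> * of_real (\<xi> $ j) * fourier f \<xi>"
proof -
  let ?e = "\<lambda>x. exp (\<i> * complex_of_real (x \<bullet> (- \<xi>) + 0 * (norm x)\<^sup>2))"
  have e: "?e x = exp (- \<i> * of_real (x \<bullet> \<xi>))" for x by simp
  have "uschwartz {()} (\<lambda>_ x. ?e x * f x)"
    using assms unfolding schwartz_unit by (rule uschwartz_phase[where B = "norm \<xi>"]) auto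
  then have "schwartz (\<lambda>x. ?e x * f x)" unfolding schwartz_unit .
  from integral_pd_eq_0[OF this, of j]
  have "0 = (LINT x|lborel. ?e x * (pd j f x + \<i> * of_real ((- \<xi>) $ j + 2 * 0 * x $ j) * f x))"
    by (simp only: pd_phase_mult[OF schwartz_differentiable[OF assms]])
  also have "\<dots> = fourier (\<lambda>x. pd j f x + (- \<i> * of_real (\<xi> $ j)) * f x) \<xi>"
    unfolding e fourier_def by simp
  also have "\<dots> = fourier (pd j f) \<xi> + fourier (\<lambda>x. (- \<i> * of_real (\<xi> $ j)) * f x) \<xi>"
    by (rule fourier_add; intro schwartz_integrable schwartz_pd schwartz_cmult assms)
  also have "\<dots> = fourier (pd j f) \<xi> + (- \<i> * of_real (\<xi> $ j)) * fourier f \<xi>"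
    unfolding fourier_cmult ..
  finally show ?thesis by simp
qed

text \<open>Fourier transforms of uniform families form a class stable under derivatives, which
  become coordinate multiplications of the preimage, and under coordinate multiplications, which
  become derivatives of it. All that remains is the sup bound by the integral of the norm.\<close>

lemma uschwartz_fourier:
  fixes f :: "'a \<Rightarrow> real^'n \<Rightarrow> complex"
  assumes "uschwartz A f" shows "uschwartz A (\<lambda>a. fourier (f a))"
proof -
  define R where "R g \<longleftrightarrow> (\<exists>h. uschwartz A h \<and> (\<forall>a\<in>A. g a = fourier (h a)))"
    for g :: "'a \<Rightarrow> real^'n \<Rightarrow> complex"
  have RI: "R (\<lambda>a. fourier (h a))" if "uschwartz A h" for h
    unfolding R_def using that by blast
  show ?thesis
  proof (rule uschwartz_coinduct[where R = R, OF RI[OF assms]])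
    fix g a x assume "R g" "a \<in> A"
    then obtain h where h: "uschwartz A h" "g a = fourier (h a)" unfolding R_def by blast
    show "g a differentiable (at x)"
      unfolding h(2) using fourier_has_derivative[OF uschwartzD_schwartz[OF h(1) \<open>a \<in> A\<close>]]
      by (rule differentiableI)
  next
    fix g k assume R: "R g"
    show "\<exists>C. \<forall>a\<in>A. \<forall>x. norm x ^ k * norm (g a x) \<le> C"
    proof (rule decay_from_coords[where R = R, OF R])
      show "\<exists>C. \<forall>a\<in>A. \<forall>x. norm (g a x) \<le> C" if R: "R g" for g
      proof -
        obtain h where h: "uschwartz A h" "\<forall>a\<in>A. g a = fourier (h a)" using R unfolding R_def by blast
        show ?thesis using uschwartz_fourier_bounded[OF h(1)] h(2) by simp
      qed
      show "\<exists>h. R h \<and> (\<forall>a\<in>A. \<forall>x. of_real (x $ j) * g a x = h a x)" if R: "R g" for g j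
      proof -
        obtain h where h: "uschwartz A h" "\<forall>a\<in>A. g a = fourier (h a)" using R unfolding R_def by blast
        have "of_real (x $ j) * g a x = fourier (\<lambda>x. - \<i> * pd j (h a) x) x" if "a \<in> A" for a x
          unfolding fourier_cmult fourier_pd[OF uschwartzD_schwartz[OF h(1) that]] using h(2) that by (simp flip: mult.assoc)
        moreover have "uschwartz A (\<lambda>a x. - \<i> * pd j (h a) x)"
          by (intro uschwartz_cmult uschwartz_pd h)
        ultimately show ?thesis using RI by blast
      qed
    qed
  next
    fix g j assume "R g"
    then obtain h where h: "uschwartz A h" "\<forall>a\<in>A. g a = fourier (h a)" unfolding R_def by blast
    have "pd j (g a) = fourier (\<lambda>x. - \<i> * (of_real (x $ j) * h a x))" if "a \<in> A" for a
      unfolding h(2)[rule_format, OF that] by (rule pd_fourier[OF uschwartzD_schwartz[OF h(1) that]])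
    moreover have "uschwartz A (\<lambda>a x. - \<i> * (of_real (x $ j) * h a x))"
      by (intro uschwartz_cmult uschwartz_coord h)
    ultimately show "\<exists>k. R k \<and> (\<forall>a\<in>A. pd j (g a) = k a)" using RI by blast
  qed
qed

lemma schwartz_fourier: "schwartz f \<Longrightarrow> schwartz (fourier f)"
  unfolding schwartz_unit by (rule uschwartz_fourier)

text \<open>Fubini for a symmetric kernel of modulus one. The scale s covers with one statement the
  transform (s = 1) and its reflection (s = -1), both of which occur in the adjointness of the
  propagator.\<close>

lemma fourier_multiplication:
  fixes f g :: "real^'n \<Rightarrow> complex"
  assumes f: "integrable lborel f" and g: "integrable lborel g"
  shows "(LINT x|lborel. fourier f (s *\<^sub>R x) * g x) = (LINT x|lborel. f x * fourier g (s *\<^sub>R x))"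
proof -
  let ?k = "\<lambda>(x::real^'n) y. exp (- \<i> * complex_of_real (s * (x \<bullet> y))) * (f x * g y)"
  note [measurable] = borel_measurable_integrable[OF f] borel_measurable_integrable[OF g]
  have meas: "(\<lambda>(x, y). ?k x y) \<in> borel_measurable (lborel \<Otimes>\<^sub>M lborel)"
    by measurable
  have nk: "norm (?k x y) = norm (f x) * norm (g y)" for x y
    by (simp only: norm_mult) (simp add: norm_exp_eq_Re)
  have int: "integrable (lborel \<Otimes>\<^sub>M lborel) (\<lambda>(x, y). ?k x y)"
  proof (rule lborel_pair.Fubini_integrable[OF meas])
    show "integrable lborel (\<lambda>x. LINT y|lborel. norm (case (x, y) of (x, y) \<Rightarrow> ?k x y))"
      using f by (simp only: prod.case nk) auto
    show "AE x in lborel. integrable lborel (\<lambda>y. case (x, y) of (x, y) \<Rightarrow> ?k x y)"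
    proof (intro AE_I2)
      fix x
      have "integrable lborel (\<lambda>y. norm (f x) * norm (g y))" using g by auto
      then show "integrable lborel (\<lambda>y. case (x, y) of (x, y) \<Rightarrow> ?k x y)"
        by (rule Bochner_Integration.integrable_bound) (simp_all only: prod.case nk, measurable)
    qed
  qed
  have "(LINT y|lborel. fourier f (s *\<^sub>R y) * g y) = (LINT y|lborel. LINT x|lborel. ?k x y)"
    unfolding fourier_def
    by (intro Bochner_Integration.integral_cong refl, subst integral_mult_left_zero[symmetric]) (simp add: mult.assoc)
  also have "\<dots> = (LINT x|lborel. LINT y|lborel. ?k x y)"
    by (rule lborel_pair.Fubini_integral[OF int])
  also have "\<dots> = (LINT x|lborel. f x * fourier g (s *\<^sub>R x))"
    unfolding fourier_def
    by (intro Bochner_Integration.integral_cong refl, subst integral_mult_right_zero[symmetric]) (simp add: inner_commute ac_simps)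
  finally show ?thesis .
qed

lemma tendsto_fourier:
  fixes f :: "real \<Rightarrow> real^'n \<Rightarrow> complex"
  assumes "uschwartz A f" "eventually (\<lambda>s. s \<in> A) (at t within S)"
    and "\<And>x. ((\<lambda>s. f s x) \<longlongrightarrow> l x) (at t within S)"
  shows "((\<lambda>s. fourier (f s) \<xi>) \<longlongrightarrow> fourier l \<xi>) (at t within S)"
proof -
  obtain C where C: "C \<ge> 0" "\<And>a x. a \<in> A \<Longrightarrow> norm (f a x) \<le> C * decay x"
    using uschwartz_decay[OF assms(1)] by blast
  show ?thesis unfolding fourier_def
  proof (rule tendsto_integral_at[where g = "\<lambda>x. C * decay x"])
    show "((\<lambda>s. exp (- \<i> * of_real (x \<bullet> \<xi>)) * f s x) \<longlongrightarrow> exp (- \<i> * of_real (x \<bullet> \<xi>)) * l x) (at t within S)" for x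
      by (intro tendsto_intros assms)
    show "\<forall>\<^sub>F s in at t within S. (\<lambda>x. exp (- \<i> * of_real (x \<bullet> \<xi>)) * f s x) \<in> borel_measurable lborel \<and>
        (\<forall>x. norm (exp (- \<i> * of_real (x \<bullet> \<xi>)) * f s x) \<le> C * decay x)"
      using assms(2)
    proof eventually_elim
      case (elim s)
      have "(\<lambda>x. exp (- \<i> * of_real (x \<bullet> \<xi>)) * f s x) \<in> borel_measurable lborel"
        by (intro borel_measurable_integrable integrable_fourier_kernel schwartz_integrable
            uschwartzD_schwartz[OF assms(1) elim])
      with C(2)[OF elim] show ?case by (simp add: norm_mult)
    qed
  qed (auto intro: integrable_decay)
qed

section \<open>The free propagator as two Fourier transforms with a quadratic phase in
  between\<close>

definition chirp :: "real \<Rightarrow> (real^'n \<Rightarrow> complex) \<Rightarrow> real^'n \<Rightarrow> complex" where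
  "chirp \<sigma> f x = exp (- \<i> * of_real (\<sigma> * (norm x)\<^sup>2)) * f x"

lemma chirp_phase: "chirp \<sigma> f = (\<lambda>x. exp (\<i> * of_real (x \<bullet> 0 + (- \<sigma>) * (norm x)\<^sup>2)) * f x)"
  by (simp add: chirp_def fun_eq_iff)

text \<open>Derivatives of the quadratic phase bring out factors of its parameter, so uniformity
  holds only for bounded ranges of it; this is why later statements work on [0,1] or on short
  intervals.\<close>

lemma uschwartz_chirp:
  assumes "uschwartz A f" "\<And>a. a \<in> A \<Longrightarrow> \<bar>s a\<bar> \<le> B"
  shows "uschwartz A (\<lambda>a. chirp (s a) (f a))"
proof (cases "A = {}")
  case False
  then have "B \<ge> 0" using assms(2) by fastforce
  then show ?thesis unfolding chirp_phase
    by (intro uschwartz_phase[where B = B] assms(1)) (use assms(2) in auto)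
qed (simp add: uschwartz_def)

lemma schwartz_chirp: "schwartz f \<Longrightarrow> schwartz (chirp \<sigma> f)"
  unfolding schwartz_unit by (rule uschwartz_chirp[where B = "\<bar>\<sigma>\<bar>"]) auto

lemma norm_chirp [simp]: "norm (chirp \<sigma> f x) = norm (f x)"
  unfolding chirp_def by (simp add: norm_mult)

lemma pd_chirp:
  assumes "f differentiable (at x)"
  shows "pd j (chirp \<sigma> f) x = chirp \<sigma> (pd j f) x - 2 * \<i> * of_real \<sigma> * (of_real (x $ j) * chirp \<sigma> f x)"
  unfolding chirp_phase pd_phase_mult[OF assms] by (simp add: algebra_simps)

lemma cnj_chirp: "cnj (chirp \<sigma> f x) = chirp (- \<sigma>) (\<lambda>x. cnj (f x)) x"
  unfolding chirp_def by (simp add: exp_cnj)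

text \<open>The dimension is visible only in the type, hence the type argument. The normalisation is
  carried along as an unevaluated scalar; adjointness uses that it is real.\<close>

definition fourier_const :: "'n itself \<Rightarrow> complex" where
  "fourier_const _ = inverse (of_real ((2 * pi) ^ CARD('n)))"

text \<open>The inverse transform is written as a reflected forward transform, so that properties of
  the propagator follow from those of \<open>fourier\<close> alone.\<close>

lemma free_prop_fourier:
  fixes f :: "real^'n \<Rightarrow> complex"
  shows "free_prop \<sigma> f x = fourier_const TYPE('n) * fourier (chirp \<sigma> (fourier f)) (- x)"
  unfolding free_prop_def fourier_def[of _ "- x"] chirp_def fourier_const_def
  by (simp add: inner_commute divide_inverse mult.commute)

lemma measurable_free_prop [measurable]:
  fixes f :: "'a \<Rightarrow> real^'n \<Rightarrow> complex"
  assumes f: "(\<lambda>(z, x). f z x) \<in> borel_measurable (M \<Otimes>\<^sub>M borel)"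
    and \<sigma>: "\<sigma> \<in> borel_measurable M" and X: "X \<in> borel_measurable M"
  shows "(\<lambda>z. free_prop (\<sigma> z) (f z) (X z)) \<in> borel_measurable M"
proof -
  have f': "(\<lambda>w. f (fst w) (snd w)) \<in> borel_measurable (M \<Otimes>\<^sub>M borel)"
    using f by (simp add: case_prod_beta)
  have "(\<lambda>w. fourier (f (fst w)) (snd w)) \<in> borel_measurable (M \<Otimes>\<^sub>M borel)"
    using measurable_compose[of "\<lambda>x. (fst (fst x), snd x)" "(M \<Otimes>\<^sub>M borel) \<Otimes>\<^sub>M borel" "M \<Otimes>\<^sub>M borel", OF _ f']
    by (intro measurable_fourier) (simp_all add: case_prod_unfold)
  then have "(\<lambda>w. chirp (\<sigma> (fst w)) (fourier (f (fst w))) (snd w)) \<in> borel_measurable (M \<Otimes>\<^sub>M borel)"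
    unfolding chirp_def using \<sigma> by measurable
  then have "(\<lambda>z. fourier (chirp (\<sigma> z) (fourier (f z))) (- X z)) \<in> borel_measurable M"
    using X by (intro measurable_fourier) (simp_all add: case_prod_beta)
  then show ?thesis unfolding free_prop_fourier by measurable
qed

lemma uschwartz_free_prop:
  assumes "uschwartz A f" "\<And>a. a \<in> A \<Longrightarrow> \<bar>s a\<bar> \<le> B"
  shows "uschwartz A (\<lambda>a. free_prop (s a) (f a))"
  unfolding free_prop_fourier
  by (intro uschwartz_cmult uschwartz_reflect uschwartz_fourier uschwartz_chirp[OF uschwartz_fourier, where B = B] assms)

lemma schwartz_free_prop: "schwartz f \<Longrightarrow> schwartz (free_prop \<sigma> f)"
  unfolding schwartz_unit by (rule uschwartz_free_prop[where B = "\<bar>\<sigma>\<bar>"]) auto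

lemma tendsto_free_prop:
  fixes f :: "real \<Rightarrow> real^'n \<Rightarrow> complex"
  assumes f: "uschwartz A f" "eventually (\<lambda>s. s \<in> A) (at t within S)"
    and lim: "\<And>x. ((\<lambda>s. f s x) \<longlongrightarrow> l x) (at t within S)"
    and \<sigma>: "\<And>s. s \<in> A \<Longrightarrow> \<bar>\<sigma> s\<bar> \<le> B" "(\<sigma> \<longlongrightarrow> \<sigma>0) (at t within S)"
  shows "((\<lambda>s. free_prop (\<sigma> s) (f s) x) \<longlongrightarrow> free_prop \<sigma>0 l x) (at t within S)"
proof -
  have "((\<lambda>s. chirp (\<sigma> s) (fourier (f s)) \<xi>) \<longlongrightarrow> chirp \<sigma>0 (fourier l) \<xi>) (at t within S)" for \<xi>
    unfolding chirp_def by (intro tendsto_intros tendsto_fourier[OF f lim] \<sigma>)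
  then show ?thesis unfolding free_prop_fourier
    by (intro tendsto_intros tendsto_fourier[OF uschwartz_chirp[OF uschwartz_fourier[OF f(1)] \<sigma>(1)] f(2)])
qed

lemma free_prop_cmult: "free_prop \<sigma> (\<lambda>x. c * f x) x = c * free_prop \<sigma> f x"
proof -
  have "chirp \<sigma> (fourier (\<lambda>x. c * f x)) = (\<lambda>\<xi>. c * chirp \<sigma> (fourier f) \<xi>)"
    by (simp add: fun_eq_iff chirp_def fourier_cmult)
  then show ?thesis by (simp add: free_prop_fourier fourier_cmult)
qed

lemma free_prop_sum:
  assumes "finite S" "\<And>i. i \<in> S \<Longrightarrow> schwartz (f i)"
  shows "free_prop \<sigma> (\<lambda>x. \<Sum>i\<in>S. f i x) x = (\<Sum>i\<in>S. free_prop \<sigma> (f i) x)"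
proof -
  have "chirp \<sigma> (fourier (\<lambda>x. \<Sum>i\<in>S. f i x)) = (\<lambda>\<xi>. \<Sum>i\<in>S. chirp \<sigma> (fourier (f i)) \<xi>)"
    using assms by (simp add: fun_eq_iff chirp_def fourier_sum schwartz_integrable sum_distrib_left)
  then show ?thesis
    using assms by (simp add: free_prop_fourier sum_distrib_left
      fourier_sum[OF schwartz_integrable[OF schwartz_chirp[OF schwartz_fourier]]])
qed

lemma free_prop_add:
  assumes "schwartz f" "schwartz g"
  shows "free_prop \<sigma> (\<lambda>x. f x + g x) x = free_prop \<sigma> f x + free_prop \<sigma> g x"
  using free_prop_sum[of "UNIV :: bool set" "\<lambda>b. if b then f else g" \<sigma> x] assms
  by (simp add: UNIV_bool add.commute)

lemma free_prop_diff:
  assumes "schwartz f" "schwartz g"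
  shows "free_prop \<sigma> (\<lambda>x. f x - g x) x = free_prop \<sigma> f x - free_prop \<sigma> g x"
  using free_prop_add[OF assms(1) schwartz_cmult[OF assms(2), of "-1"], of \<sigma> x]
    free_prop_cmult[of \<sigma> "-1" g x] by simp

lemma pd_fourier_reflect:
  assumes "schwartz f"
  shows "pd j (\<lambda>x. c * fourier f (- x)) x = c * fourier (\<lambda>\<xi>. \<i> * (of_real (\<xi> $ j) * f \<xi>)) (- x)"
proof -
  have d: "fourier f differentiable (at y)" for y
    by (intro schwartz_differentiable schwartz_fourier assms)
  have "(\<lambda>x. fourier f (- x)) differentiable (at x)"
    by (rule differentiable_compose[of "fourier f" uminus, OF d]) (auto intro!: derivative_intros)
  then have "pd j (\<lambda>x. c * fourier f (- x)) x = c * (- pd j (fourier f) (- x))"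
    by (simp add: pd_cmult pd_reflect[OF d])
  also have "\<dots> = c * fourier (\<lambda>\<xi>. \<i> * (of_real (\<xi> $ j) * f \<xi>)) (- x)"
    unfolding pd_fourier[OF assms] fourier_cmult by simp
  finally show ?thesis .
qed

lemma pd_free_prop:
  fixes f :: "real^'n \<Rightarrow> complex"
  assumes "schwartz f"
  shows "pd j (free_prop \<sigma> f) = free_prop \<sigma> (pd j f)"
proof
  fix x
  have "pd j (free_prop \<sigma> f) x =
      fourier_const TYPE('n) * fourier (\<lambda>\<xi>. \<i> * (of_real (\<xi> $ j) * chirp \<sigma> (fourier f) \<xi>)) (- x)"
    unfolding free_prop_fourier[abs_def]
    by (rule pd_fourier_reflect[OF schwartz_chirp[OF schwartz_fourier[OF assms]]])
  also have "(\<lambda>\<xi>. \<i> * (of_real (\<xi> $ j) * chirp \<sigma> (fourier f) \<xi>)) = chirp \<sigma> (fourier (pd j f))"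
    by (simp add: fun_eq_iff chirp_def fourier_pd[OF assms])
  finally show "pd j (free_prop \<sigma> f) x = free_prop \<sigma> (pd j f) x" unfolding free_prop_fourier .
qed

text \<open>On the Fourier side, multiplication by a coordinate is i times a derivative. Commuting
  it with the chirp leaves a multiple of \<sigma> times the frequency, which the outer transform
  converts into a spatial derivative.\<close>

lemma free_prop_coord:
  fixes f :: "real^'n \<Rightarrow> complex"
  assumes "schwartz f"
  shows "free_prop \<sigma> (\<lambda>x. of_real (x $ j) * f x) x =
    of_real (x $ j) * free_prop \<sigma> f x + 2 * \<i> * of_real \<sigma> * pd j (free_prop \<sigma> f) x"
proof -
  let ?G = "chirp \<sigma> (fourier f)"
  have sG: "schwartz ?G" by (intro schwartz_chirp schwartz_fourier assms)
  have "fourier (\<lambda>x. of_real (x $ j) * f x) = (\<lambda>\<xi>. \<i> * pd j (fourier f) \<xi>)"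
    unfolding pd_fourier[OF assms] fourier_cmult by (simp add: fun_eq_iff flip: mult.assoc)
  then have "chirp \<sigma> (fourier (\<lambda>x. of_real (x $ j) * f x)) = (\<lambda>\<xi>. \<i> * chirp \<sigma> (pd j (fourier f)) \<xi>)"
    by (simp add: chirp_def fun_eq_iff)
  also have "\<dots> = (\<lambda>\<xi>. \<i> * pd j ?G \<xi> + (2 * \<i> * of_real \<sigma>) * (\<i> * (of_real (\<xi> $ j) * ?G \<xi>)))"
    by (subst pd_chirp) (auto intro!: schwartz_differentiable schwartz_fourier assms simp: algebra_simps)
  finally have "free_prop \<sigma> (\<lambda>x. of_real (x $ j) * f x) x = fourier_const TYPE('n) *
      fourier (\<lambda>\<xi>. \<i> * pd j ?G \<xi> + (2 * \<i> * of_real \<sigma>) * (\<i> * (of_real (\<xi> $ j) * ?G \<xi>))) (- x)"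
    unfolding free_prop_fourier by simp
  also have "\<dots> = fourier_const TYPE('n) * (\<i> * fourier (pd j ?G) (- x) +
      (2 * \<i> * of_real \<sigma>) * fourier (\<lambda>\<xi>. \<i> * (of_real (\<xi> $ j) * ?G \<xi>)) (- x))"
    by (subst fourier_add; (intro schwartz_integrable schwartz_cmult schwartz_coord schwartz_pd sG)?)
       (simp only: fourier_cmult)
  also have "\<dots> = of_real (x $ j) * (fourier_const TYPE('n) * fourier ?G (- x)) + (2 * \<i> * of_real \<sigma>) *
      (fourier_const TYPE('n) * fourier (\<lambda>\<xi>. \<i> * (of_real (\<xi> $ j) * ?G \<xi>)) (- x))"
    unfolding fourier_pd[OF sG] by (simp add: algebra_simps)
  also have "fourier_const TYPE('n) * fourier (\<lambda>\<xi>. \<i> * (of_real (\<xi> $ j) * ?G \<xi>)) (- x) = pd j (free_prop \<sigma> f) x"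
    unfolding free_prop_fourier[abs_def] by (rule pd_fourier_reflect[OF sG, symmetric])
  finally show ?thesis unfolding free_prop_fourier[of \<sigma> f] .
qed

lemma laplacian_free_prop:
  assumes "schwartz f"
  shows "laplacian (free_prop \<sigma> f) x = free_prop \<sigma> (laplacian f) x"
  unfolding laplacian_def[abs_def]
  by (simp add: pd_free_prop assms schwartz_pd free_prop_sum)

lemma schwartz_laplacian: "schwartz f \<Longrightarrow> schwartz (laplacian f)"
  unfolding laplacian_def[abs_def] by (intro schwartz_sum schwartz_pd) auto

lemma fourier_laplacian:
  assumes "schwartz f"
  shows "fourier (laplacian f) \<xi> = - of_real ((norm \<xi>)\<^sup>2) * fourier f \<xi>"
proof -
  have "fourier (laplacian f) \<xi> = (\<Sum>j\<in>UNIV. fourier (pd j (pd j f)) \<xi>)"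
    unfolding laplacian_def[abs_def] by (intro fourier_sum schwartz_integrable schwartz_pd assms)
  also have "\<dots> = (\<Sum>j\<in>UNIV. - (of_real (\<xi> $ j) * of_real (\<xi> $ j)) * fourier f \<xi>)"
  proof (intro sum.cong refl)
    fix j
    have "\<i> * a * (\<i> * a * z) = (\<i> * \<i>) * (a * a * z)" for a z :: complex by (simp only: ac_simps)
    then show "fourier (pd j (pd j f)) \<xi> = - (of_real (\<xi> $ j) * of_real (\<xi> $ j)) * fourier f \<xi>"
      by (simp add: fourier_pd schwartz_pd assms)
  qed
  finally show ?thesis unfolding norm_power2_sum by (simp add: sum_distrib_right sum_negf)
qed

text \<open>The chirp has modulus one, so for all \<sigma> at once the \<sigma>-derivative of the
  integrand is bounded by the Fourier transform of the Laplacian of f, which is rapidly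
  decreasing.\<close>

lemma free_prop_has_vector_derivative:
  assumes "schwartz f"
  shows "((\<lambda>\<sigma>. free_prop \<sigma> f x) has_vector_derivative \<i> * laplacian (free_prop \<sigma> f) x) (at \<sigma>)"
proof -
  let ?g = "\<lambda>\<sigma> \<xi>. exp (- \<i> * of_real (\<xi> \<bullet> (- x))) * chirp \<sigma> (fourier f) \<xi>"
  let ?g' = "\<lambda>\<sigma> \<xi>. exp (- \<i> * of_real (\<xi> \<bullet> (- x))) * chirp \<sigma> (\<lambda>\<xi>. \<i> * fourier (laplacian f) \<xi>) \<xi>"
  obtain C where C: "\<And>\<xi>. norm (fourier (laplacian f) \<xi>) \<le> C * decay \<xi>"
    using schwartz_decay[OF schwartz_fourier[OF schwartz_laplacian[OF assms]]] by blast
  have d: "((\<lambda>\<sigma>. ?g \<sigma> \<xi>) has_vector_derivative ?g' \<sigma> \<xi>) (at \<sigma>)" for \<sigma> \<xi>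
  proof -
    let ?z = "- \<i> * of_real ((norm \<xi>)\<^sup>2)"
    have "((\<lambda>\<sigma>. exp (\<sigma> *\<^sub>R ?z)) has_vector_derivative exp (\<sigma> *\<^sub>R ?z) * ?z) (at \<sigma>)"
      by (rule exp_scaleR_has_vector_derivative_right)
    then have "((\<lambda>\<sigma>. exp (- \<i> * of_real (\<xi> \<bullet> (- x))) * (exp (\<sigma> *\<^sub>R ?z) * fourier f \<xi>)) has_vector_derivative
        exp (- \<i> * of_real (\<xi> \<bullet> (- x))) * ((exp (\<sigma> *\<^sub>R ?z) * ?z) * fourier f \<xi>)) (at \<sigma>)"
      by (intro has_vector_derivative_mult_right has_vector_derivative_mult_left)
    moreover have "\<sigma> *\<^sub>R ?z = - \<i> * of_real (\<sigma> * (norm \<xi>)\<^sup>2)" for \<sigma> by (simp add: scaleR_conv_of_real)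
    ultimately show ?thesis
      unfolding chirp_def fourier_laplacian[OF assms] by (simp only: ac_simps mult_minus_left mult_minus_right)
  qed
  have "((\<lambda>\<sigma>. fourier (chirp \<sigma> (fourier f)) (- x)) has_vector_derivative
      fourier (chirp \<sigma> (\<lambda>\<xi>. \<i> * fourier (laplacian f) \<xi>)) (- x)) (at \<sigma>)"
    unfolding fourier_def[of _ "- x"]
  proof (rule has_vector_derivative_integral[where a = "\<sigma> - 1" and b = "\<sigma> + 1" and g = "\<lambda>\<xi>. C * decay \<xi>"])
    show "norm (?g' t \<xi>) \<le> C * decay \<xi>" for t \<xi>
      unfolding norm_mult norm_chirp using C[of \<xi>] by simp
    show "integrable lborel (?g t)" for t
      by (intro integrable_fourier_kernel schwartz_integrable schwartz_chirp schwartz_fourier assms)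
  qed (use d in \<open>auto intro: integrable_decay\<close>)
  then have "((\<lambda>\<sigma>. free_prop \<sigma> f x) has_vector_derivative free_prop \<sigma> (\<lambda>x. \<i> * laplacian f x) x) (at \<sigma>)"
    unfolding free_prop_fourier fourier_cmult[abs_def] by (rule has_vector_derivative_mult_right)
  then show ?thesis unfolding free_prop_cmult laplacian_free_prop[OF assms] .
qed

text \<open>The multiplication formula is used twice, once for each transform inside the propagator.
  In between, the chirp passes to the other factor, and the conjugation there reverses the sign of
  \<sigma>.\<close>

lemma free_prop_adjoint:
  fixes f g :: "real^'n \<Rightarrow> complex"
  assumes f: "schwartz f" and g: "schwartz g"
  shows "(LINT x|lborel. free_prop \<sigma> f x * cnj (g x)) = (LINT x|lborel. f x * cnj (free_prop (- \<sigma>) g x))"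
proof -
  let ?c = "fourier_const TYPE('n)"
  let ?F = "chirp \<sigma> (fourier f)" and ?G = "chirp (- \<sigma>) (fourier g)"
  have c: "cnj ?c = ?c" by (simp add: fourier_const_def)
  have 1: "(LINT x|lborel. fourier ?F ((-1) *\<^sub>R x) * cnj (g x)) =
      (LINT x|lborel. ?F x * fourier (\<lambda>x. cnj (g x)) ((-1) *\<^sub>R x))"
    by (intro fourier_multiplication schwartz_integrable schwartz_chirp schwartz_fourier schwartz_cnj f g)
  have 2: "(LINT x|lborel. fourier f (1 *\<^sub>R x) * cnj (?G x)) =
      (LINT x|lborel. f x * fourier (\<lambda>x. cnj (?G x)) (1 *\<^sub>R x))"
    by (intro fourier_multiplication schwartz_integrable schwartz_cnj schwartz_chirp schwartz_fourier f g)
  have m: "?F x * cnj (fourier g x) = fourier f x * cnj (?G x)" for x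
    unfolding cnj_chirp unfolding chirp_def by (simp add: mult.left_commute)
  have "(LINT x|lborel. free_prop \<sigma> f x * cnj (g x)) =
      ?c * (LINT x|lborel. fourier ?F ((-1) *\<^sub>R x) * cnj (g x))"
    unfolding free_prop_fourier mult.assoc by simp
  also have "\<dots> = ?c * (LINT x|lborel. ?F x * cnj (fourier g x))"
    unfolding 1 fourier_cnj by simp
  also have "\<dots> = ?c * (LINT x|lborel. f x * cnj (fourier ?G (- x)))"
    using 2 unfolding m fourier_cnj by simp
  also have "\<dots> = (LINT x|lborel. f x * cnj (free_prop (- \<sigma>) g x))"
    unfolding free_prop_fourier complex_cnj_mult c mult.left_commute[of _ ?c] by simp
  finally show ?thesis .
qed

section \<open>Power nonlinearity and dilations\<close>

lemma uschwartz_laplacian: "uschwartz A f \<Longrightarrow> uschwartz A (\<lambda>a. laplacian (f a))"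
  unfolding laplacian_def[abs_def] by (intro uschwartz_sum uschwartz_pd) auto

lemma x_dot_grad_eq: "x_dot_grad f x = (\<Sum>j\<in>UNIV. of_real (x $ j) * pd j f x)"
  unfolding x_dot_grad_def grad_def by (simp add: scaleR_conv_of_real)

section \<open>Symmetry of mixed partial derivatives\<close>

lemma mixed_difference_bound:
  fixes f :: "real^'n \<Rightarrow> complex"
  assumes f: "schwartz f" and h: "h > 0"
    and c: "\<And>s t. \<bar>s\<bar> < 2 * h \<Longrightarrow> \<bar>t\<bar> < 2 * h \<Longrightarrow>
      norm (pd k (pd j f) (t *\<^sub>R axis k 1 + (s *\<^sub>R axis j 1 + x)) - c) \<le> e"
  shows "norm (f (h *\<^sub>R axis j 1 + (h *\<^sub>R axis k 1 + x)) - f (h *\<^sub>R axis j 1 + x) -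
    (f (h *\<^sub>R axis k 1 + x) - f x) - (h * h) *\<^sub>R c) \<le> e * h * h"
proof -
  let ?a = "axis j 1 :: real^'n" and ?b = "axis k 1 :: real^'n"
  have inner: "norm (pd j f (s *\<^sub>R ?a + (h *\<^sub>R ?b + x)) - pd j f (s *\<^sub>R ?a + x) - h *\<^sub>R c) \<le> e * h"
    if s: "s \<in> {- (2 * h)<..<2 * h}" for s
  proof -
    let ?y = "s *\<^sub>R ?a + x"
    have "norm ((pd j f (h *\<^sub>R ?b + ?y) - h *\<^sub>R c) - (pd j f (0 *\<^sub>R ?b + ?y) - 0 *\<^sub>R c)) \<le> e * \<bar>h - 0\<bar>"
    proof (rule vector_mvt_bound[where a = "- (2 * h)" and b = "2 * h"
        and f = "\<lambda>t. pd j f (t *\<^sub>R ?b + ?y) - t *\<^sub>R c"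
        and f' = "\<lambda>t. pd k (pd j f) (t *\<^sub>R ?b + ?y) - 1 *\<^sub>R c"])
      show "((\<lambda>t. pd j f (t *\<^sub>R ?b + ?y) - t *\<^sub>R c) has_vector_derivative
          pd k (pd j f) (t *\<^sub>R ?b + ?y) - 1 *\<^sub>R c) (at t)" for t
        by (intro has_vector_derivative_diff curve_has_vector_derivative schwartz_differentiable schwartz_pd f)
           (auto intro!: derivative_eq_intros)
      show "norm (pd k (pd j f) (t *\<^sub>R ?b + ?y) - 1 *\<^sub>R c) \<le> e" if "t \<in> {- (2 * h)<..<2 * h}" for t
        using c[of s t] s that by (simp add: abs_less_iff)
    qed (use h in auto)
    then show ?thesis using h by (simp add: ac_simps algebra_simps)
  qed
  have "norm ((f (h *\<^sub>R ?a + (h *\<^sub>R ?b + x)) - f (h *\<^sub>R ?a + x) - h *\<^sub>R (h *\<^sub>R c)) -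
      (f (0 *\<^sub>R ?a + (h *\<^sub>R ?b + x)) - f (0 *\<^sub>R ?a + x) - 0 *\<^sub>R (h *\<^sub>R c))) \<le> (e * h) * \<bar>h - 0\<bar>"
  proof (rule vector_mvt_bound[where a = "- (2 * h)" and b = "2 * h"
      and f = "\<lambda>s. f (s *\<^sub>R ?a + (h *\<^sub>R ?b + x)) - f (s *\<^sub>R ?a + x) - s *\<^sub>R (h *\<^sub>R c)"
      and f' = "\<lambda>s. pd j f (s *\<^sub>R ?a + (h *\<^sub>R ?b + x)) - pd j f (s *\<^sub>R ?a + x) - 1 *\<^sub>R (h *\<^sub>R c)"])
    show "((\<lambda>s. f (s *\<^sub>R ?a + (h *\<^sub>R ?b + x)) - f (s *\<^sub>R ?a + x) - s *\<^sub>R (h *\<^sub>R c)) has_vector_derivative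
        pd j f (s *\<^sub>R ?a + (h *\<^sub>R ?b + x)) - pd j f (s *\<^sub>R ?a + x) - 1 *\<^sub>R (h *\<^sub>R c)) (at s)" for s
      by (intro has_vector_derivative_diff curve_has_vector_derivative schwartz_differentiable f)
         (auto intro!: derivative_eq_intros)
  qed (use inner h in auto)
  then show ?thesis using h by (simp add: algebra_simps)
qed

text \<open>The second difference with steps h along both axes is symmetric in the axes, and divided
  by h^2 it is close to either mixed derivative. The symmetry is wanted for the commutator of
  \<open>pd\<close> with \<open>dilation\<close>.\<close>

lemma pd_commute:
  fixes f :: "real^'n \<Rightarrow> complex"
  assumes f: "schwartz f"
  shows "pd j (pd k f) x = pd k (pd j f) x"
proof (rule ccontr)
  assume ne: "pd j (pd k f) x \<noteq> pd k (pd j f) x"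
  \<comment> \<open>With a quarter of the discrepancy as tolerance, the two approximations leave
    room for a difference of at most 2 e, against the actual 4 e.\<close>
  define e where "e = norm (pd j (pd k f) x - pd k (pd j f) x) / 4"
  have e: "e > 0" using ne by (simp add: e_def)
  have cont: "isCont (pd a (pd b f)) x" for a b
    using f by (intro differentiable_imp_continuous_within schwartz_differentiable schwartz_pd)
  obtain d1 where d1: "d1 > 0" "\<And>y. dist y x < d1 \<Longrightarrow> dist (pd j (pd k f) y) (pd j (pd k f) x) < e"
    using cont[of j k] e unfolding continuous_at_eps_delta by blast
  obtain d2 where d2: "d2 > 0" "\<And>y. dist y x < d2 \<Longrightarrow> dist (pd k (pd j f) y) (pd k (pd j f) x) < e"
    using cont[of k j] e unfolding continuous_at_eps_delta by blast
  define d where "d = min d1 d2"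
  have d: "d > 0"
    "\<And>y. dist y x < d \<Longrightarrow> norm (pd j (pd k f) y - pd j (pd k f) x) < e"
    "\<And>y. dist y x < d \<Longrightarrow> norm (pd k (pd j f) y - pd k (pd j f) x) < e"
    using d1 d2 by (auto simp: d_def dist_norm)
  define h where "h = d / 8"
  have h: "h > 0" using d by (simp add: h_def)
  have dist: "dist (t *\<^sub>R axis a 1 + (s *\<^sub>R axis b 1 + x)) x < d"
    if "\<bar>s\<bar> < 2 * h" "\<bar>t\<bar> < 2 * h" for s t and a b :: 'n
  proof -
    have "dist (t *\<^sub>R axis a 1 + (s *\<^sub>R axis b 1 + x)) x = norm (t *\<^sub>R axis a 1 + s *\<^sub>R axis b (1::real))"
      by (simp add: dist_norm)
    also have "\<dots> \<le> norm (t *\<^sub>R axis a (1::real)) + norm (s *\<^sub>R axis b (1::real))"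
      by (rule norm_triangle_ineq)
    also have "\<dots> = \<bar>t\<bar> + \<bar>s\<bar>" by simp
    also have "\<dots> < d" using that d(1) by (simp add: h_def)
    finally show ?thesis .
  qed
  let ?D = "f (h *\<^sub>R axis j 1 + (h *\<^sub>R axis k 1 + x)) - f (h *\<^sub>R axis j 1 + x) - (f (h *\<^sub>R axis k 1 + x) - f x)"
  have 1: "norm (?D - (h * h) *\<^sub>R pd k (pd j f) x) \<le> e * h * h"
    by (rule mixed_difference_bound[OF f h]) (use d(3) dist less_imp_le in blast)
  have "norm (f (h *\<^sub>R axis k 1 + (h *\<^sub>R axis j 1 + x)) - f (h *\<^sub>R axis k 1 + x) -
      (f (h *\<^sub>R axis j 1 + x) - f x) - (h * h) *\<^sub>R pd j (pd k f) x) \<le> e * h * h"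
    by (rule mixed_difference_bound[OF f h]) (use d(2) dist less_imp_le in blast)
  then have 2: "norm (?D - (h * h) *\<^sub>R pd j (pd k f) x) \<le> e * h * h"
    by (simp add: algebra_simps)
  have "(h * h) * norm (pd j (pd k f) x - pd k (pd j f) x) =
      norm ((?D - (h * h) *\<^sub>R pd k (pd j f) x) - (?D - (h * h) *\<^sub>R pd j (pd k f) x))"
    by (simp flip: scaleR_diff_right)
  also have "\<dots> \<le> e * h * h + e * h * h" using norm_triangle_ineq4 1 2 by (meson add_mono order_trans)
  finally have "(h * h) * (4 * e) \<le> (h * h) * (2 * e)" by (simp add: e_def algebra_simps)
  then have "4 * e \<le> 2 * e" using h by (simp add: mult_le_cancel_left_pos)
  then show False using e by simp
qed

section \<open>The power nonlinearity and the generator of dilations\<close>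

definition power_nl :: "nat \<Rightarrow> complex \<Rightarrow> complex" where
  "power_nl p z = of_real (norm z ^ p) * z"

lemma cnj_power_nl_mult: "cnj (power_nl p z) * z = of_real (norm z ^ (p + 2))"
proof -
  have "cnj (power_nl p z) * z = of_real (norm z ^ p) * (z * cnj z)" by (simp add: power_nl_def)
  also have "\<dots> = of_real (norm z ^ (p + 2))"
    unfolding complex_norm_square[symmetric] power_add by simp
  finally show ?thesis .
qed

text \<open>Evenness of p makes |w|^p a power of w times its conjugate, a polynomial expression that
  stays smooth where w vanishes.\<close>

lemma uschwartz_power_nl:
  assumes "uschwartz A w" "even p"
  shows "uschwartz A (\<lambda>a x. power_nl p (w a x))"
proof -
  obtain m where m: "p = 2 * m" using assms(2) by blast
  have "uschwartz A (\<lambda>a x. (w a x * cnj (w a x)) ^ m * w a x)"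
  proof (induction m)
    case (Suc m)
    have "uschwartz A (\<lambda>a x. (w a x * cnj (w a x)) * ((w a x * cnj (w a x)) ^ m * w a x))"
      by (rule uschwartz_mult[OF uschwartz_mult[OF assms(1) uschwartz_cnj[OF assms(1)]] Suc])
    then show ?case by (simp add: mult.assoc)
  qed (use assms in simp)
  also have "(\<lambda>a x. (w a x * cnj (w a x)) ^ m * w a x) = (\<lambda>a x. power_nl p (w a x))"
    by (simp add: m power_nl_def power_mult fun_eq_iff complex_norm_square[symmetric])
  finally show ?thesis .
qed

lemma schwartz_power_nl: "schwartz w \<Longrightarrow> even p \<Longrightarrow> schwartz (\<lambda>x. power_nl p (w x))"
  unfolding schwartz_unit by (rule uschwartz_power_nl)

lemma norm_power_has_derivative:
  assumes z: "(z has_derivative z') (at x)" and "even p"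
  shows "((\<lambda>x. norm (z x :: complex) ^ (p + 2)) has_derivative
    (\<lambda>h. (real p + 2) * Re (cnj (power_nl p (z x)) * z' h))) (at x)"
proof -
  obtain m where m: "p = 2 * m" using assms(2) by blast
  have eq: "norm v ^ (2 * k) = (v \<bullet> v) ^ k" for v :: complex and k
    by (simp add: power_mult power2_norm_eq_inner)
  have "((\<lambda>x. (z x \<bullet> z x) ^ Suc m) has_derivative
      (\<lambda>h. of_nat (Suc m) * (z x \<bullet> z' h + z' h \<bullet> z x) * (z x \<bullet> z x) ^ (Suc m - 1))) (at x)"
    by (intro has_derivative_power has_derivative_inner z)
  moreover have "norm (z x) ^ (p + 2) = (z x \<bullet> z x) ^ Suc m" for x
    using eq[of "z x" "Suc m"] by (simp add: m)
  moreover have "of_nat (Suc m) * (z x \<bullet> z' h + z' h \<bullet> z x) * (z x \<bullet> z x) ^ (Suc m - 1) =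
      (real p + 2) * Re (cnj (power_nl p (z x)) * z' h)" for h
  proof -
    have arith: "real (Suc m) * (a + a) * q = (real p + 2) * (q * a)" for a q :: real
      by (simp add: m algebra_simps)
    have "Re (cnj (power_nl p (z x)) * z' h) = norm (z x) ^ p * (z x \<bullet> z' h)"
      by (simp add: power_nl_def inner_complex_def algebra_simps)
    also have "norm (z x) ^ p = (z x \<bullet> z x) ^ (Suc m - 1)" by (simp add: m eq)
    finally show ?thesis unfolding inner_commute[of "z' h"] by (simp only: arith)
  qed
  ultimately show ?thesis by simp
qed

lemma schwartz_norm_power:
  assumes "schwartz w" "even p"
  shows "schwartz (\<lambda>x. of_real (norm (w x) ^ (p + 2)))"
  using schwartz_mult[OF schwartz_cnj[OF schwartz_power_nl[OF assms]] assms(1)] by (simp only: cnj_power_nl_mult)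

lemma integrable_of_realD:
  "integrable M (\<lambda>x. complex_of_real (f x)) \<Longrightarrow> integrable M f"
  using integrable_Re[of M "\<lambda>x. complex_of_real (f x)"] by simp

lemma integrable_norm_power:
  "schwartz w \<Longrightarrow> even p \<Longrightarrow> integrable lborel (\<lambda>x. norm (w x) ^ (p + 2))"
  by (rule integrable_of_realD) (rule schwartz_integrable[OF schwartz_norm_power])

text \<open>The skew-adjoint operator 2 x.grad + d. The term d f is spread over the coordinates so
  that each summand is skew-adjoint by itself and can be integrated by parts separately.\<close>

definition dilation :: "(real^'n \<Rightarrow> complex) \<Rightarrow> real^'n \<Rightarrow> complex" where
  "dilation f x = (\<Sum>j\<in>UNIV. 2 * (of_real (x $ j) * pd j f x) + f x)"

lemma dilation_eq:
  fixes f :: "real^'n \<Rightarrow> complex"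
  shows "dilation f x = 2 * x_dot_grad f x + of_nat CARD('n) * f x"
  by (simp add: dilation_def x_dot_grad_eq sum.distrib sum_distrib_left)

lemma uschwartz_dilation: "uschwartz A f \<Longrightarrow> uschwartz A (\<lambda>a. dilation (f a))"
  unfolding dilation_def[abs_def] by (intro uschwartz_sum uschwartz_add uschwartz_cmult uschwartz_coord uschwartz_pd) auto

lemma schwartz_dilation: "schwartz f \<Longrightarrow> schwartz (dilation f)"
  unfolding schwartz_unit by (rule uschwartz_dilation)

text \<open>The real part of the first-order term is 2 / (p + 2) times x_j times the j-th derivative
  of |w|^(p+2). Integration by parts turns it into -2 / (p + 2) times the integral of |w|^(p+2), and
  the zeroth-order term adds that integral once.\<close>

lemma power_nl_dilation_coord:
  assumes w: "schwartz w" and p: "even p"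
  shows "Re (LINT x|lborel. cnj (power_nl p (w x)) * (2 * (of_real (x $ j) * pd j w x) + w x)) =
    real p / (real p + 2) * (LINT x|lborel. norm (w x) ^ (p + 2))"
proof -
  let ?W = "\<lambda>x. complex_of_real (norm (w x) ^ (p + 2))"
  let ?a = "\<lambda>x. cnj (power_nl p (w x)) * (of_real (x $ j) * pd j w x)"
  let ?I = "LINT x|lborel. norm (w x) ^ (p + 2)"
  have W: "schwartz ?W" by (rule schwartz_norm_power[OF w p])
  have a: "integrable lborel ?a"
    by (intro schwartz_integrable schwartz_mult schwartz_cnj schwartz_power_nl schwartz_coord schwartz_pd w p)
  have pdW: "pd j ?W x = of_real ((real p + 2) * Re (cnj (power_nl p (w x)) * pd j w x))" for x
  proof -
    have "(?W has_derivative (\<lambda>h. of_real ((real p + 2) * Re (cnj (power_nl p (w x)) * frechet_derivative w (at x) h)))) (at x)"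
      by (intro bounded_linear.has_derivative[OF bounded_linear_of_real] norm_power_has_derivative
          has_derivative_frechet schwartz_differentiable w p)
    from pd_eq[OF this] show ?thesis by (simp add: pd_def)
  qed
  have "0 = (LINT x|lborel. pd j (\<lambda>x. of_real (x $ j) * ?W x) x)"
    using integral_pd_eq_0[OF schwartz_coord[OF W]] by simp
  also have "\<dots> = (LINT x|lborel. of_real (x $ j) * pd j ?W x + ?W x)"
    by (subst pd_coord_mult[OF schwartz_differentiable[OF W]]) simp
  also have "\<dots> = (LINT x|lborel. of_real (x $ j) * pd j ?W x) + (LINT x|lborel. ?W x)"
    by (intro Bochner_Integration.integral_add schwartz_integrable schwartz_coord schwartz_pd W)
  also have "(LINT x|lborel. of_real (x $ j) * pd j ?W x) = (LINT x|lborel. of_real ((real p + 2) * Re (?a x)))"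
    unfolding pdW by (intro Bochner_Integration.integral_cong refl) (simp add: algebra_simps)
  also have "\<dots> = of_real ((real p + 2) * Re (LINT x|lborel. ?a x))"
    using integral_Re[OF a] by (simp del: of_real_mult of_real_add)
  also have "(LINT x|lborel. ?W x) = of_real ?I" by (rule integral_complex_of_real)
  finally have "0 = complex_of_real ((real p + 2) * Re (LINT x|lborel. ?a x) + ?I)"
    by (simp only: of_real_add)
  then have "(real p + 2) * Re (LINT x|lborel. ?a x) + ?I = 0"
    by (rule of_real_eq_0_iff[THEN iffD1, OF sym])
  then have *: "(real p + 2) * Re (LINT x|lborel. ?a x) = - ?I" by linarith
  have "(LINT x|lborel. cnj (power_nl p (w x)) * (2 * (of_real (x $ j) * pd j w x) + w x)) =
      (LINT x|lborel. 2 * ?a x + ?W x)"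
    unfolding cnj_power_nl_mult[symmetric] by (intro Bochner_Integration.integral_cong refl) (simp add: algebra_simps)
  also have "\<dots> = 2 * (LINT x|lborel. ?a x) + (LINT x|lborel. ?W x)"
    using a schwartz_integrable[OF W] by simp
  also have "(LINT x|lborel. ?W x) = of_real ?I" by (rule integral_complex_of_real)
  finally have "Re (LINT x|lborel. cnj (power_nl p (w x)) * (2 * (of_real (x $ j) * pd j w x) + w x)) =
      2 * Re (LINT x|lborel. ?a x) + ?I" by simp
  also have "Re (LINT x|lborel. ?a x) = - ?I / (real p + 2)"
    by (subst *[symmetric]) simp
  also have "2 * (- ?I / (real p + 2)) + ?I = real p / (real p + 2) * ?I"
    by (simp add: field_simps)
  finally show ?thesis .
qed

lemma power_nl_dilation:
  fixes w :: "real^'n \<Rightarrow> complex"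
  assumes w: "schwartz w" and p: "even p"
  shows "Re (LINT x|lborel. cnj (power_nl p (w x)) * dilation w x) =
    real CARD('n) * real p / (real p + 2) * (LINT x|lborel. norm (w x) ^ (p + 2))"
proof -
  have "(LINT x|lborel. cnj (power_nl p (w x)) * dilation w x) =
      (\<Sum>j\<in>UNIV. LINT x|lborel. cnj (power_nl p (w x)) * (2 * (of_real (x $ j) * pd j w x) + w x))"
    unfolding dilation_def sum_distrib_left
    by (intro Bochner_Integration.integral_sum schwartz_integrable schwartz_mult schwartz_cnj schwartz_power_nl
        schwartz_add schwartz_cmult schwartz_coord schwartz_pd w p)
  then show ?thesis by (simp only: Re_sum power_nl_dilation_coord[OF w p]) simp
qed

lemma uschwartz_const: "schwartz f \<Longrightarrow> uschwartz A (\<lambda>_. f)"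
  using uschwartz_reindex[of "{()}" "\<lambda>_. f" A "\<lambda>_. ()"] unfolding schwartz_unit by simp

section \<open>The power integral along the free evolution\<close>

definition lp_mass :: "nat \<Rightarrow> (real^'n \<Rightarrow> complex) \<Rightarrow> real \<Rightarrow> real" where
  "lp_mass p f \<sigma> = (LINT x|lborel. norm (free_prop \<sigma> f x) ^ (p + 2))"

lemma lp_mass_nonneg: "lp_mass p f \<sigma> \<ge> 0"
  unfolding lp_mass_def by (intro Bochner_Integration.integral_nonneg) auto

definition lp_mass' :: "nat \<Rightarrow> (real^'n \<Rightarrow> complex) \<Rightarrow> real \<Rightarrow> real" where
  "lp_mass' p f \<sigma> = - (real p + 2) *
     Im (LINT x|lborel. cnj (power_nl p (free_prop \<sigma> f x)) * laplacian (free_prop \<sigma> f) x)"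

text \<open>Restricting \<sigma> to an interval of length 2 makes the propagated functions a uniform
  family and so supplies the majorant. Their \<sigma>-derivative is i times the Laplacian, which
  converts the real part in the derivative of the power into minus an imaginary part.\<close>

lemma lp_mass_has_derivative:
  assumes f: "schwartz f" and p: "even p"
  shows "(lp_mass p f has_real_derivative lp_mass' p f \<sigma>) (at \<sigma>)"
proof -
  let ?w = "\<lambda>\<sigma>. free_prop \<sigma> f"
  let ?D = "\<lambda>\<sigma> x. (real p + 2) * Re (cnj (power_nl p (?w \<sigma> x)) * (\<i> * laplacian (?w \<sigma>) x))"
  let ?A = "{\<sigma> - 1<..<\<sigma> + 1}"
  have u: "uschwartz ?A ?w"
    by (rule uschwartz_free_prop[where f = "\<lambda>_. f" and s = "\<lambda>s. s" and B = "\<bar>\<sigma>\<bar> + 1"])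
       (use uschwartz_const[OF f] in auto)
  have uD: "uschwartz ?A (\<lambda>\<sigma> x. cnj (power_nl p (?w \<sigma> x)) * (\<i> * laplacian (?w \<sigma>) x))"
    by (intro uschwartz_mult uschwartz_cnj uschwartz_power_nl uschwartz_cmult uschwartz_laplacian u p)
  have sD: "schwartz (\<lambda>x. cnj (power_nl p (?w \<sigma> x)) * (\<i> * laplacian (?w \<sigma>) x))"
    by (rule uschwartzD_schwartz[OF uD]) simp
  obtain C where C: "\<And>s x. s \<in> ?A \<Longrightarrow> norm (cnj (power_nl p (?w s x)) * (\<i> * laplacian (?w s) x)) \<le> C * decay x"
    using uschwartz_decay[OF uD] by blast
  have "(lp_mass p f has_vector_derivative (LINT x|lborel. ?D \<sigma> x)) (at \<sigma>)"
    unfolding lp_mass_def[abs_def]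
  proof (rule has_vector_derivative_integral[where a = "\<sigma> - 1" and b = "\<sigma> + 1" and g = "\<lambda>x. (real p + 2) * (C * decay x)"])
    show "((\<lambda>\<sigma>. norm (?w \<sigma> x) ^ (p + 2)) has_vector_derivative ?D t x) (at t)" for t x
      using norm_power_has_derivative[OF free_prop_has_vector_derivative[OF f, of x t, unfolded has_vector_derivative_def] p]
      unfolding has_vector_derivative_def by (simp add: scaleR_conv_of_real algebra_simps)
    show "norm (?D t x) \<le> (real p + 2) * (C * decay x)" if "t \<in> ?A" for t x
    proof -
      have "norm (?D t x) = (real p + 2) * \<bar>Re (cnj (power_nl p (?w t x)) * (\<i> * laplacian (?w t) x))\<bar>"
        by (simp add: abs_mult)
      also have "\<dots> \<le> (real p + 2) * (C * decay x)"
        by (intro mult_left_mono order_trans[OF abs_Re_le_cmod C[OF that]]) auto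
      finally show ?thesis .
    qed
    show "integrable lborel (\<lambda>x. norm (?w t x) ^ (p + 2))" for t
      by (rule integrable_norm_power[OF schwartz_free_prop[OF f] p])
  qed (auto intro: integrable_decay)
  also have "(LINT x|lborel. ?D \<sigma> x) = (real p + 2) * Re (LINT x|lborel. cnj (power_nl p (?w \<sigma> x)) * (\<i> * laplacian (?w \<sigma>) x))"
    by (subst integral_mult_right_zero, subst integral_Re; (rule schwartz_integrable[OF sD] refl)?)
  also have "\<dots> = lp_mass' p f \<sigma>"
    unfolding lp_mass'_def mult.left_commute[of _ \<i>] by (simp add: algebra_simps)
  finally show ?thesis by (simp add: has_real_derivative_iff_has_vector_derivative)
qed

section \<open>Pairings with the nonlinearity and the Laplacian\<close>

text \<open>For each j the coordinate rule is applied twice. The terms linear in \<sigma>, including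
  the one from differentiating x_j, combine into the dilation operator, and the product of the two
  factors 2 i \<sigma> gives -4 \<sigma>^2 in front of the Laplacian.\<close>

lemma free_prop_norm2:
  assumes f: "schwartz f"
  shows "free_prop \<sigma> (\<lambda>x. of_real ((norm x)\<^sup>2) * f x) x =
    of_real ((norm x)\<^sup>2) * free_prop \<sigma> f x + 2 * \<i> * of_real \<sigma> * dilation (free_prop \<sigma> f) x
      - 4 * of_real (\<sigma>\<^sup>2) * laplacian (free_prop \<sigma> f) x"
proof -
  let ?w = "free_prop \<sigma> f"
  have w: "schwartz ?w" by (rule schwartz_free_prop[OF f])
  have j: "free_prop \<sigma> (\<lambda>x. of_real (x $ j) * (of_real (x $ j) * f x)) x =
      of_real (x $ j) * of_real (x $ j) * ?w x +
      2 * \<i> * of_real \<sigma> * (2 * (of_real (x $ j) * pd j ?w x) + ?w x)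
      - 4 * of_real (\<sigma>\<^sup>2) * pd j (pd j ?w) x" for j
  proof -
    let ?v = "\<lambda>x. of_real (x $ j) * f x"
    have v: "free_prop \<sigma> ?v = (\<lambda>x. of_real (x $ j) * ?w x + 2 * \<i> * of_real \<sigma> * pd j ?w x)"
      by (intro ext free_prop_coord f)
    have pv: "pd j (free_prop \<sigma> ?v) x = of_real (x $ j) * pd j ?w x + ?w x + 2 * \<i> * of_real \<sigma> * pd j (pd j ?w) x"
      unfolding v
      by (subst pd_add, (intro schwartz_differentiable schwartz_coord schwartz_cmult schwartz_pd w)+)
         (subst pd_coord_mult pd_cmult, (intro schwartz_differentiable schwartz_pd w)+, simp)+
    have "\<i> * (\<i> * z) = - z" for z by (simp flip: mult.assoc)
    then show ?thesis
      unfolding free_prop_coord[OF schwartz_coord[OF f]] pv v[THEN fun_cong]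
      by (simp add: algebra_simps power2_eq_square)
  qed
  have "free_prop \<sigma> (\<lambda>x. of_real ((norm x)\<^sup>2) * f x) x =
      free_prop \<sigma> (\<lambda>x. \<Sum>j\<in>UNIV. of_real (x $ j) * (of_real (x $ j) * f x)) x"
    unfolding norm_power2_sum sum_distrib_right mult.assoc ..
  also have "\<dots> = (\<Sum>j\<in>UNIV. free_prop \<sigma> (\<lambda>x. of_real (x $ j) * (of_real (x $ j) * f x)) x)"
    by (intro free_prop_sum schwartz_coord f) auto
  finally show ?thesis
    unfolding j norm_power2_sum dilation_def laplacian_def sum_distrib_right sum_distrib_left
    by (simp add: sum.distrib sum_subtractf sum_distrib_right)
qed

lemma free_prop_dilation:
  assumes f: "schwartz f"
  shows "free_prop \<sigma> (dilation f) x = dilation (free_prop \<sigma> f) x + 4 * \<i> * of_real \<sigma> * laplacian (free_prop \<sigma> f) x"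
proof -
  let ?w = "free_prop \<sigma> f"
  have "free_prop \<sigma> (dilation f) x = (\<Sum>j\<in>UNIV. free_prop \<sigma> (\<lambda>x. 2 * (of_real (x $ j) * pd j f x) + f x) x)"
    unfolding dilation_def[abs_def]
    by (intro free_prop_sum schwartz_add schwartz_cmult schwartz_coord schwartz_pd f) auto
  also have "\<dots> = (\<Sum>j\<in>UNIV. (2 * (of_real (x $ j) * pd j ?w x) + ?w x) + 4 * \<i> * of_real \<sigma> * pd j (pd j ?w) x)"
  proof (intro sum.cong refl)
    fix j
    show "free_prop \<sigma> (\<lambda>x. 2 * (of_real (x $ j) * pd j f x) + f x) x =
        (2 * (of_real (x $ j) * pd j ?w x) + ?w x) + 4 * \<i> * of_real \<sigma> * pd j (pd j ?w) x"
      by (subst free_prop_add, (intro schwartz_cmult schwartz_coord schwartz_pd f)+)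
         (simp only: free_prop_cmult free_prop_coord[OF schwartz_pd[OF f]] pd_free_prop[OF f, symmetric],
          simp add: algebra_simps)
  qed
  finally show ?thesis unfolding dilation_def laplacian_def by (simp add: sum.distrib sum_distrib_left)
qed

lemma Im_pair_laplacian:
  "Im (LINT x|lborel. cnj (power_nl p (free_prop \<sigma> f x)) * laplacian (free_prop \<sigma> f) x) =
    - lp_mass' p f \<sigma> / (real p + 2)"
proof -
  have "X = - (- (real p + 2) * X) / (real p + 2)" for X :: real by (simp add: field_simps)
  then show ?thesis unfolding lp_mass'_def .
qed

text \<open>Of the three terms of the commuted operator, the one with |x|^2 gives a real pairing and
  drops out. The dilation term yields a multiple of \<open>lp_mass\<close>, the Laplacian term a
  multiple of its \<sigma>-derivative.\<close>

lemma power_nl_pair_norm2: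
  fixes f :: "real^'n \<Rightarrow> complex"
  assumes f: "schwartz f" and p: "even p"
  shows "Im (LINT x|lborel. cnj (power_nl p (free_prop \<sigma> f x)) * free_prop \<sigma> (\<lambda>x. of_real ((norm x)\<^sup>2) * f x) x) =
    (2 * \<sigma> * (real CARD('n) * real p) * lp_mass p f \<sigma> + 4 * \<sigma>\<^sup>2 * lp_mass' p f \<sigma>) / (real p + 2)"
proof -
  let ?w = "free_prop \<sigma> f" and ?G = "\<lambda>x. cnj (power_nl p (free_prop \<sigma> f x))"
  have w: "schwartz ?w" by (rule schwartz_free_prop[OF f])
  have G: "schwartz ?G" by (intro schwartz_cnj schwartz_power_nl w p)
  note i = schwartz_integrable[OF schwartz_mult[OF G]]
  have i1: "integrable lborel (\<lambda>x. ?G x * (of_real ((norm x)\<^sup>2) * ?w x))" by (rule i[OF schwartz_norm2[OF w]])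
  have i2: "integrable lborel (\<lambda>x. ?G x * dilation ?w x)" by (rule i[OF schwartz_dilation[OF w]])
  have i3: "integrable lborel (\<lambda>x. ?G x * laplacian ?w x)" by (rule i[OF schwartz_laplacian[OF w]])
  have r: "?G x * (of_real ((norm x)\<^sup>2) * ?w x) = of_real ((norm x)\<^sup>2 * norm (?w x) ^ (p + 2))" for x
  proof -
    have "?G x * (of_real ((norm x)\<^sup>2) * ?w x) = of_real ((norm x)\<^sup>2) * (?G x * ?w x)" by (simp only: ac_simps)
    then show ?thesis unfolding cnj_power_nl_mult by simp
  qed
  have 1: "Im (LINT x|lborel. ?G x * (of_real ((norm x)\<^sup>2) * ?w x)) = 0"
    unfolding r integral_complex_of_real by simp
  have arith: "Im (A + 2 * \<i> * of_real \<sigma> * B - 4 * of_real (\<sigma>\<^sup>2) * C) = 2 * \<sigma> * Re B - 4 * \<sigma>\<^sup>2 * Im C"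
    if "Im A = 0" for A B C using that by (simp add: power2_eq_square)
  have "(LINT x|lborel. ?G x * free_prop \<sigma> (\<lambda>x. of_real ((norm x)\<^sup>2) * f x) x) =
     (LINT x|lborel. ?G x * (of_real ((norm x)\<^sup>2) * ?w x) + 2 * \<i> * of_real \<sigma> * (?G x * dilation ?w x)
       - 4 * of_real (\<sigma>\<^sup>2) * (?G x * laplacian ?w x))"
    unfolding free_prop_norm2[OF f] by (intro Bochner_Integration.integral_cong refl) (simp add: algebra_simps)
  also have "\<dots> = (LINT x|lborel. ?G x * (of_real ((norm x)\<^sup>2) * ?w x)) +
      2 * \<i> * of_real \<sigma> * (LINT x|lborel. ?G x * dilation ?w x)
       - 4 * of_real (\<sigma>\<^sup>2) * (LINT x|lborel. ?G x * laplacian ?w x)"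
    using i1 i2 i3 by (simp del: of_real_power)
  finally have "Im (LINT x|lborel. ?G x * free_prop \<sigma> (\<lambda>x. of_real ((norm x)\<^sup>2) * f x) x) =
      2 * \<sigma> * Re (LINT x|lborel. ?G x * dilation ?w x) - 4 * \<sigma>\<^sup>2 * Im (LINT x|lborel. ?G x * laplacian ?w x)"
    using arith[OF 1] by simp
  also have "Re (LINT x|lborel. ?G x * dilation ?w x) = real CARD('n) * real p / (real p + 2) * lp_mass p f \<sigma>"
    unfolding lp_mass_def by (rule power_nl_dilation[OF w p])
  also have "Im (LINT x|lborel. ?G x * laplacian ?w x) = - lp_mass' p f \<sigma> / (real p + 2)"
    by (rule Im_pair_laplacian)
  finally show ?thesis by (simp add: add_divide_distrib)
qed

lemma power_nl_pair_dilation: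
  fixes f :: "real^'n \<Rightarrow> complex"
  assumes f: "schwartz f" and p: "even p"
  shows "Re (LINT x|lborel. cnj (power_nl p (free_prop \<sigma> f x)) * free_prop \<sigma> (dilation f) x) =
    (real CARD('n) * real p * lp_mass p f \<sigma> + 4 * \<sigma> * lp_mass' p f \<sigma>) / (real p + 2)"
proof -
  let ?w = "free_prop \<sigma> f" and ?G = "\<lambda>x. cnj (power_nl p (free_prop \<sigma> f x))"
  have w: "schwartz ?w" by (rule schwartz_free_prop[OF f])
  have G: "schwartz ?G" by (intro schwartz_cnj schwartz_power_nl w p)
  note i = schwartz_integrable[OF schwartz_mult[OF G]]
  have i2: "integrable lborel (\<lambda>x. ?G x * dilation ?w x)" by (rule i[OF schwartz_dilation[OF w]])
  have i3: "integrable lborel (\<lambda>x. ?G x * laplacian ?w x)" by (rule i[OF schwartz_laplacian[OF w]])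
  have "(LINT x|lborel. ?G x * free_prop \<sigma> (dilation f) x) =
     (LINT x|lborel. ?G x * dilation ?w x + 4 * \<i> * of_real \<sigma> * (?G x * laplacian ?w x))"
    unfolding free_prop_dilation[OF f] by (intro Bochner_Integration.integral_cong refl) (simp add: algebra_simps)
  also have "\<dots> = (LINT x|lborel. ?G x * dilation ?w x) + 4 * \<i> * of_real \<sigma> * (LINT x|lborel. ?G x * laplacian ?w x)"
    using i2 i3 by simp
  finally have "Re (LINT x|lborel. ?G x * free_prop \<sigma> (dilation f) x) =
      Re (LINT x|lborel. ?G x * dilation ?w x) - 4 * \<sigma> * Im (LINT x|lborel. ?G x * laplacian ?w x)"
    by simp
  also have "Re (LINT x|lborel. ?G x * dilation ?w x) = real CARD('n) * real p / (real p + 2) * lp_mass p f \<sigma>"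
    unfolding lp_mass_def by (rule power_nl_dilation[OF w p])
  also have "Im (LINT x|lborel. ?G x * laplacian ?w x) = - lp_mass' p f \<sigma> / (real p + 2)"
    by (rule Im_pair_laplacian)
  finally show ?thesis by (simp add: add_divide_distrib)
qed

section \<open>Pairings with the Laplacian\<close>

lemma pair_swap: "(LINT x|M. cnj (f x) * g x) = cnj (LINT x|M. cnj (g x) * f x)"
  by (subst Bochner_Integration.integral_cnj[symmetric]) (simp add: mult.commute)

lemma laplacian_pair_left:
  assumes f: "schwartz f" and g: "schwartz g"
  shows "(LINT x|lborel. cnj (laplacian f x) * g x) = - (\<Sum>j\<in>UNIV. LINT x|lborel. cnj (pd j f x) * pd j g x)"
proof -
  have j: "(LINT x|lborel. cnj (pd j (pd j f) x) * g x) = - (LINT x|lborel. cnj (pd j f x) * pd j g x)" for j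
    using integration_by_parts[OF schwartz_cnj[OF schwartz_pd[OF f]] g, of j j]
    by (simp add: pd_cnj schwartz_differentiable schwartz_pd f)
  have "(LINT x|lborel. cnj (laplacian f x) * g x) = (\<Sum>j\<in>UNIV. LINT x|lborel. cnj (pd j (pd j f) x) * g x)"
    unfolding laplacian_def cnj_sum sum_distrib_right
    by (intro Bochner_Integration.integral_sum schwartz_integrable schwartz_mult schwartz_cnj schwartz_pd f g)
  then show ?thesis unfolding j by (simp add: sum_negf)
qed

lemma integral_norm_grad_sum:
  assumes f: "schwartz f"
  shows "(LINT x|lborel. (norm (grad f x))\<^sup>2) = (\<Sum>j\<in>UNIV. LINT x|lborel. (norm (pd j f x))\<^sup>2)"
proof -
  have g: "(norm (grad f x))\<^sup>2 = (\<Sum>j\<in>UNIV. (norm (pd j f x))\<^sup>2)" for x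
    by (simp add: norm_vec_def L2_set_def grad_def sum_nonneg)
  have "integrable lborel (\<lambda>x. (norm (pd j f x))\<^sup>2)" for j
    using integrable_norm_power[OF schwartz_pd[OF f], of 0 j] by (simp add: numeral_2_eq_2)
  then show ?thesis unfolding g by simp
qed

text \<open>After integration by parts the contribution of |x|^2 |grad f|^2 is real. What remains
  comes from differentiating the weight, and the sign of the integration by parts cancels against
  the one from conjugation.\<close>

lemma laplacian_pair_norm2:
  assumes f: "schwartz f"
  shows "Im (LINT x|lborel. cnj (laplacian f x) * (of_real ((norm x)\<^sup>2) * f x)) =
    2 * Im (LINT x|lborel. cnj (f x) * x_dot_grad f x)"
proof -
  let ?g = "\<lambda>x. of_real ((norm x)\<^sup>2) * f x"
  have g: "schwartz ?g" by (rule schwartz_norm2[OF f])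
  have pdg: "pd j ?g x = of_real ((norm x)\<^sup>2) * pd j f x + 2 * (of_real (x $ j) * f x)" for j x
  proof -
    have "((\<lambda>x. complex_of_real ((norm x)\<^sup>2)) has_derivative (\<lambda>h. of_real (2 * (x \<bullet> h)))) (at x)"
      unfolding power2_norm_eq_inner
      by (rule bounded_linear.has_derivative[OF bounded_linear_of_real])
         (auto intro!: derivative_eq_intros simp: inner_commute)
    note d = this
    have "(\<lambda>x. complex_of_real ((norm x)\<^sup>2)) differentiable (at x)" using d by (rule differentiableI)
    from pd_mult[OF this schwartz_differentiable[OF f]] show ?thesis
      unfolding pd_eq[OF d] by (simp add: inner_axis algebra_simps)
  qed
  have j: "Im (LINT x|lborel. cnj (pd j f x) * pd j ?g x) = - (2 * Im (LINT x|lborel. cnj (f x) * (of_real (x $ j) * pd j f x)))" for j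
  proof -
    have "(LINT x|lborel. cnj (pd j f x) * pd j ?g x) = (LINT x|lborel. cnj (pd j f x) * (of_real ((norm x)\<^sup>2) * pd j f x) + 2 * (cnj (pd j f x) * (of_real (x $ j) * f x)))"
      unfolding pdg by (simp add: algebra_simps)
    also have "\<dots> = (LINT x|lborel. cnj (pd j f x) * (of_real ((norm x)\<^sup>2) * pd j f x)) +
        (LINT x|lborel. 2 * (cnj (pd j f x) * (of_real (x $ j) * f x)))"
      by (subst Bochner_Integration.integral_add; (intro schwartz_integrable schwartz_mult schwartz_cnj schwartz_cmult schwartz_norm2 schwartz_coord schwartz_pd f)?) (rule refl)
    also have "(\<lambda>x. cnj (pd j f x) * (of_real ((norm x)\<^sup>2) * pd j f x)) = (\<lambda>x. of_real ((norm x)\<^sup>2 * (norm (pd j f x))\<^sup>2))"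
      unfolding of_real_mult complex_norm_square[of "pd j f _"] by (intro ext) (simp only: ac_simps)
    also have "(\<lambda>x. 2 * (cnj (pd j f x) * (of_real (x $ j) * f x))) = (\<lambda>x. 2 * cnj (cnj (f x) * (of_real (x $ j) * pd j f x)))"
      by (intro ext) simp
    also have "(LINT x|lborel. of_real ((norm x)\<^sup>2 * (norm (pd j f x))\<^sup>2)) + (LINT x|lborel. 2 * cnj (cnj (f x) * (of_real (x $ j) * pd j f x))) =
       (of_real (LINT x|lborel. (norm x)\<^sup>2 * (norm (pd j f x))\<^sup>2) + 2 * cnj (LINT x|lborel. cnj (f x) * (of_real (x $ j) * pd j f x)))"
      unfolding integral_complex_of_real integral_mult_right_zero Bochner_Integration.integral_cnj ..
    finally show ?thesis by simp
  qed
  have "Im (LINT x|lborel. cnj (laplacian f x) * ?g x) =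
      (\<Sum>j\<in>UNIV. 2 * Im (LINT x|lborel. cnj (f x) * (of_real (x $ j) * pd j f x)))"
    unfolding laplacian_pair_left[OF f g] uminus_complex.sel Im_sum j sum_negf by simp
  also have "\<dots> = 2 * Im (\<Sum>j\<in>UNIV. LINT x|lborel. cnj (f x) * (of_real (x $ j) * pd j f x))"
    by (simp only: Im_sum sum_distrib_left)
  also have "(\<Sum>j\<in>UNIV. LINT x|lborel. cnj (f x) * (of_real (x $ j) * pd j f x)) = (LINT x|lborel. cnj (f x) * x_dot_grad f x)"
    unfolding x_dot_grad_eq sum_distrib_left
    by (intro Bochner_Integration.integral_sum[symmetric] schwartz_integrable schwartz_mult schwartz_coord schwartz_cnj schwartz_pd f)
  finally show ?thesis .
qed

text \<open>The summand k = j produces the commutator; in all summands the remaining derivative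
  passes through by symmetry of mixed derivatives.\<close>

lemma pd_dilation:
  assumes f: "schwartz f"
  shows "pd j (dilation f) x = dilation (pd j f) x + 2 * pd j f x"
proof -
  have "pd j (dilation f) x = (\<Sum>k\<in>UNIV. pd j (\<lambda>x. 2 * (of_real (x $ k) * pd k f x) + f x) x)"
    unfolding dilation_def[abs_def]
    by (intro pd_sum schwartz_differentiable schwartz_add schwartz_cmult schwartz_coord schwartz_pd f) auto
  also have "\<dots> = (\<Sum>k\<in>UNIV. (2 * (of_real (x $ k) * pd k (pd j f) x) + pd j f x) + (if k = j then 2 * pd j f x else 0))"
  proof (intro sum.cong refl)
    fix k
    have "pd j (\<lambda>x. 2 * (of_real (x $ k) * pd k f x) + f x) x = 2 * pd j (\<lambda>x. of_real (x $ k) * pd k f x) x + pd j f x"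
      by (subst pd_add, (intro schwartz_differentiable schwartz_cmult schwartz_coord schwartz_pd f)+)
        (subst pd_cmult, (intro schwartz_differentiable schwartz_coord schwartz_pd f)+, rule refl)
    also have "pd j (\<lambda>x. of_real (x $ k) * pd k f x) x = of_real (x $ k) * pd j (pd k f) x + (if k = j then pd k f x else 0)"
      by (intro pd_coord_mult schwartz_differentiable schwartz_pd f)
    finally show "pd j (\<lambda>x. 2 * (of_real (x $ k) * pd k f x) + f x) x =
      (2 * (of_real (x $ k) * pd k (pd j f) x) + pd j f x) + (if k = j then 2 * pd j f x else 0)"
      by (simp add: pd_commute[OF f, of j k])
  qed
  finally show ?thesis unfolding dilation_def by (simp add: sum.distrib)
qed

text \<open>Integration by parts and the commutator of \<open>pd j\<close> with
  \<open>dilation\<close> contribute twice |\<open>pd j f\<close>|^2, while the pairing of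
  \<open>pd j f\<close> with its own dilation has no real part by skew-adjointness.\<close>

lemma laplacian_pair_dilation:
  assumes f: "schwartz f"
  shows "Re (LINT x|lborel. cnj (laplacian f x) * dilation f x) = - 2 * (LINT x|lborel. (norm (grad f x))\<^sup>2)"
proof -
  have j: "Re (LINT x|lborel. cnj (pd j f x) * pd j (dilation f) x) = 2 * (LINT x|lborel. (norm (pd j f x))\<^sup>2)" for j
  proof -
    have n: "2 * (cnj (pd j f x) * pd j f x) = of_real (2 * (norm (pd j f x))\<^sup>2)" for x
      unfolding of_real_mult complex_norm_square[of "pd j f _"] by simp
    have "(LINT x|lborel. cnj (pd j f x) * pd j (dilation f) x) =
        (LINT x|lborel. cnj (pd j f x) * dilation (pd j f) x + 2 * (cnj (pd j f x) * pd j f x))"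
      unfolding pd_dilation[OF f] by (simp add: algebra_simps)
    also have "\<dots> = (LINT x|lborel. cnj (pd j f x) * dilation (pd j f) x) + (LINT x|lborel. 2 * (cnj (pd j f x) * pd j f x))"
      by (intro Bochner_Integration.integral_add schwartz_integrable schwartz_mult schwartz_cnj schwartz_cmult schwartz_dilation schwartz_pd f)
    finally have "Re (LINT x|lborel. cnj (pd j f x) * pd j (dilation f) x) =
        Re (LINT x|lborel. cnj (pd j f x) * dilation (pd j f) x) + (LINT x|lborel. 2 * (norm (pd j f x))\<^sup>2)"
      unfolding n integral_complex_of_real by simp
    \<comment> \<open>This is the dilation identity for exponent p = 0, whose factor p / (p + 2)
      vanishes.\<close>
    also have "Re (LINT x|lborel. cnj (pd j f x) * dilation (pd j f) x) = 0"
      using power_nl_dilation[OF schwartz_pd[OF f], of 0 j] by (simp add: power_nl_def)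
    finally show ?thesis by simp
  qed
  show ?thesis
    unfolding laplacian_pair_left[OF f schwartz_dilation[OF f]] uminus_complex.sel Re_sum j integral_norm_grad_sum[OF f]
    by (simp add: sum_distrib_left sum_negf)
qed

section \<open>The Duhamel average\<close>

text \<open>No integrability is assumed: a non-integrable function has integral 0 by convention, and
  0 obeys the bound because C is nonnegative. The unit length of the interval leaves no extra
  factor.\<close>

lemma norm_set_integral_unit_le:
  fixes h :: "real \<Rightarrow> 'b::{banach, second_countable_topology}"
  assumes "\<And>\<sigma>. \<sigma> \<in> {0..1} \<Longrightarrow> norm (h \<sigma>) \<le> C"
  shows "norm (LBINT \<sigma>:{0..1}. h \<sigma>) \<le> C"
proof (cases "set_integrable lborel {0..1} h")
  case True
  have "norm (LBINT \<sigma>:{0..1}. h \<sigma>) \<le> (LINT \<sigma>|lborel. norm (indicator {0..1} \<sigma> *\<^sub>R h \<sigma>))"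
    unfolding set_lebesgue_integral_def by (rule integral_norm_bound)
  also have "\<dots> \<le> (LINT \<sigma>|lborel. indicator {0..1} (\<sigma>::real) * C)"
    using True assms unfolding set_integrable_def
    by (intro integral_mono integrable_norm) (auto split: split_indicator)
  finally show ?thesis by simp
next
  case False
  have "0 \<le> C" by (rule order_trans[OF norm_ge_zero assms[of 0]]) simp
  then show ?thesis using False
    by (simp add: set_lebesgue_integral_def set_integrable_def not_integrable_integral_eq)
qed

text \<open>The indicator of [0,1] in \<sigma> times the weight in x is integrable on the product,
  and this single majorant yields all three conclusions.\<close>

lemma unit_strip_Fubini:
  fixes h :: "real \<Rightarrow> real^'n \<Rightarrow> 'b::{banach, second_countable_topology}"
  assumes meas: "(\<lambda>(\<sigma>, x). h \<sigma> x) \<in> borel_measurable (borel \<Otimes>\<^sub>M borel)"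
    and bound: "\<And>\<sigma> x. \<sigma> \<in> {0..1} \<Longrightarrow> norm (h \<sigma> x) \<le> C * decay x"
  shows "integrable lborel (\<lambda>x. LBINT \<sigma>:{0..1}. h \<sigma> x)"
    and "set_integrable lborel {0..1} (\<lambda>\<sigma>. LINT x|lborel. h \<sigma> x)"
    and "(LINT x|lborel. (LBINT \<sigma>:{0..1}. h \<sigma> x)) = (LBINT \<sigma>:{0..1}. (LINT x|lborel. h \<sigma> x))"
proof -
  let ?k = "\<lambda>\<sigma> x. indicator {0..1} \<sigma> *\<^sub>R h \<sigma> x"
  have C: "0 \<le> C * decay x" for x :: "real^'n" 
    by (rule order_trans[OF norm_ge_zero bound[of 0 x]]) simp
  have C0: "0 \<le> C" using C[of 0] decay_pos[of "0::real^'n"] by (simp add: zero_le_mult_iff)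
  have mh: "(\<lambda>z. h (fst z) (snd z)) \<in> borel_measurable (borel \<Otimes>\<^sub>M borel)"
    using meas by (simp add: case_prod_unfold)
  have md: "(decay :: real^'n \<Rightarrow> real) \<in> borel_measurable borel"
    using borel_measurable_integrable[OF integrable_decay] by simp
  have int: "integrable (lborel \<Otimes>\<^sub>M lborel) (\<lambda>(\<sigma>, x). ?k \<sigma> x)"
  proof (rule Bochner_Integration.integrable_bound[where f = "\<lambda>(\<sigma>::real, x). indicator {0..1} \<sigma> * (C * decay x)"])
    have "(\<lambda>z. indicator {0..1::real} (fst z) * (C * decay (snd z :: real^'n))) \<in> borel_measurable (borel \<Otimes>\<^sub>M borel)"
      using md by measurable
    then have m: "(\<lambda>(\<sigma>::real, x::real^'n). indicator {0..1} \<sigma> * (C * decay x)) \<in> borel_measurable (lborel \<Otimes>\<^sub>M lborel)"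
      by (simp add: case_prod_unfold cong: measurable_cong_sets)
    show "integrable (lborel \<Otimes>\<^sub>M lborel) (\<lambda>(\<sigma>::real, x::real^'n). indicator {0..1} \<sigma> * (C * decay x))"
    proof (rule lborel_pair.Fubini_integrable[OF m])
      have "integrable lborel (\<lambda>\<sigma>::real. indicator {0..1} \<sigma> * (LINT x|lborel. C * decay (x::real^'n)))"
        by (intro integrable_mult_left) simp
      moreover have "(LINT x|lborel. norm (case (\<sigma>, x) of (\<sigma>, x) \<Rightarrow> indicator {0..1} \<sigma> * (C * decay (x::real^'n)))) =
          indicator {0..1} \<sigma> * (LINT x|lborel. C * decay (x::real^'n))" for \<sigma> :: real
        using C0 by (simp add: abs_mult abs_of_pos[OF decay_pos] split: split_indicator)
      ultimately show "integrable lborel (\<lambda>\<sigma>. LINT x|lborel. norm (case (\<sigma>, x) of (\<sigma>, x) \<Rightarrow> indicator {0..1} (\<sigma>::real) * (C * decay (x::real^'n))))"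
        by simp
    qed (auto intro!: integrable_decay)
    have "(\<lambda>z. indicator {0..1} (fst z) *\<^sub>R h (fst z) (snd z)) \<in> borel_measurable (borel \<Otimes>\<^sub>M borel)"
      using mh by measurable
    then show "(\<lambda>(\<sigma>, x). ?k \<sigma> x) \<in> borel_measurable (lborel \<Otimes>\<^sub>M lborel)"
      by (simp add: case_prod_unfold cong: measurable_cong_sets)
    have "norm (?k \<sigma> x) \<le> norm (indicator {0..1} \<sigma> * (C * decay x))" for \<sigma> x
      using bound[of \<sigma> x] C[of x] by (auto split: split_indicator)
    then show "AE z in lborel \<Otimes>\<^sub>M lborel. norm (case z of (\<sigma>, x) \<Rightarrow> ?k \<sigma> x) \<le>
        norm (case z of (\<sigma>::real, x) \<Rightarrow> indicator {0..1} \<sigma> * (C * decay x))"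
      by (auto intro!: AE_I2)
  qed
  show "integrable lborel (\<lambda>x. LBINT \<sigma>:{0..1}. h \<sigma> x)"
    unfolding set_lebesgue_integral_def using lborel_pair.integrable_snd[OF int] .
  have "integrable lborel (\<lambda>\<sigma>. LINT x|lborel. ?k \<sigma> x)"
    using lborel_pair.integrable_fst[OF int] .
  then show "set_integrable lborel {0..1} (\<lambda>\<sigma>. LINT x|lborel. h \<sigma> x)"
    unfolding set_integrable_def by simp
  show "(LINT x|lborel. (LBINT \<sigma>:{0..1}. h \<sigma> x)) = (LBINT \<sigma>:{0..1}. (LINT x|lborel. h \<sigma> x))"
    unfolding set_lebesgue_integral_def using lborel_pair.Fubini_integral[OF int] by simp
qed

lemma measurable_power_nl [measurable]: "power_nl p \<in> borel_measurable borel"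
  unfolding power_nl_def[abs_def] by measurable

text \<open>K is left general because the same average is applied to the power nonlinearity and, for
  the energy, to the kernel that represents a difference of powers.\<close>

definition duhamel :: "(real \<Rightarrow> real^'n \<Rightarrow> complex) \<Rightarrow> real^'n \<Rightarrow> complex" where
  "duhamel K x = (LBINT \<sigma>:{0..1}. free_prop (- \<sigma>) (K \<sigma>) x)"

lemma dm_nonlin_duhamel: "dm_nonlin p f = duhamel (\<lambda>\<sigma> x. power_nl p (free_prop \<sigma> f x))"
  by (simp add: fun_eq_iff dm_nonlin_def duhamel_def power_nl_def)

lemma measurable_strip_free_prop:
  fixes K :: "real \<Rightarrow> real^'n \<Rightarrow> complex"
  assumes "(\<lambda>(\<sigma>, x). K \<sigma> x) \<in> borel_measurable (borel \<Otimes>\<^sub>M borel)" "s \<in> borel_measurable borel"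
  shows "(\<lambda>(\<sigma>, x). free_prop (s \<sigma>) (K \<sigma>) x) \<in> borel_measurable (borel \<Otimes>\<^sub>M borel)"
proof -
  have f': "(\<lambda>w. K (fst w) (snd w)) \<in> borel_measurable (borel \<Otimes>\<^sub>M borel)"
    using assms(1) by (simp add: case_prod_unfold)
  have "(\<lambda>w. free_prop (s (fst w)) (K (fst w)) (snd w)) \<in> borel_measurable (borel \<Otimes>\<^sub>M borel)"
    using measurable_compose[of "\<lambda>x. (fst (fst x), snd x)" "(borel \<Otimes>\<^sub>M borel) \<Otimes>\<^sub>M borel" "borel \<Otimes>\<^sub>M borel", OF _ f']
      assms(2)
    by (intro measurable_free_prop) (simp_all add: case_prod_unfold)
  then show ?thesis by (simp add: case_prod_unfold)
qed

lemma measurable_strip_const: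
  assumes "f \<in> borel_measurable borel"
  shows "(\<lambda>(\<sigma>::real, x). f x) \<in> borel_measurable (borel \<Otimes>\<^sub>M borel)"
  using measurable_compose[OF measurable_snd assms] by (simp add: case_prod_unfold)

lemma measurable_strip_free_prop_const:
  assumes "schwartz f"
  shows "(\<lambda>(\<sigma>, x). free_prop \<sigma> f x) \<in> borel_measurable (borel \<Otimes>\<^sub>M borel)"
  by (intro measurable_strip_free_prop measurable_strip_const schwartz_measurable assms) simp

lemma uschwartz_back_prop:
  assumes "uschwartz {0..1} K" shows "uschwartz {0..1} (\<lambda>\<sigma>. free_prop (- \<sigma>) (K \<sigma>))"
  by (rule uschwartz_free_prop[OF assms, where B = 1]) auto

text \<open>A pointwise bound by the weight, uniform in b, is what the later pairings call for, so
  smoothness of the average in x is not investigated.\<close>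

lemma duhamel_bound:
  assumes "uschwartz (B \<times> {0..1}) (\<lambda>z. K (fst z) (snd z))"
  obtains C where "C \<ge> 0" "\<And>b x. b \<in> B \<Longrightarrow> norm (duhamel (K b) x) \<le> C * decay x"
proof -
  have "uschwartz (B \<times> {0..1}) (\<lambda>z. free_prop (- snd z) (K (fst z) (snd z)))"
    by (rule uschwartz_free_prop[OF assms, where B = 1]) auto
  from uschwartz_decay[OF this] obtain C where C: "C \<ge> 0"
    "\<And>z x. z \<in> B \<times> {0..1} \<Longrightarrow> norm (free_prop (- snd z) (K (fst z) (snd z)) x) \<le> C * decay x" by blast
  have "norm (duhamel (K b) x) \<le> C * decay x" if "b \<in> B" for b x
    unfolding duhamel_def
  proof (rule norm_set_integral_unit_le)
    show "norm (free_prop (- \<sigma>) (K b \<sigma>) x) \<le> C * decay x" if "\<sigma> \<in> {0..1}" for \<sigma>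
      using C(2)[of "(b, \<sigma>)" x] \<open>b \<in> B\<close> that by simp
  qed
  from that[OF C(1) this] show ?thesis .
qed

lemma duhamel_measurable:
  fixes K :: "real \<Rightarrow> real^'n \<Rightarrow> complex"
  assumes "(\<lambda>(\<sigma>, x). K \<sigma> x) \<in> borel_measurable (borel \<Otimes>\<^sub>M borel)"
  shows "duhamel K \<in> borel_measurable borel"
proof -
  have m: "(\<lambda>w. free_prop (- fst w) (K (fst w)) (snd w)) \<in> borel_measurable (borel \<Otimes>\<^sub>M borel)"
    using measurable_strip_free_prop[OF assms, of uminus] by (simp add: case_prod_unfold)
  have "(\<lambda>w. indicator {0..1} (snd w) *\<^sub>R free_prop (- snd w) (K (snd w)) (fst w)) \<in> borel_measurable (borel \<Otimes>\<^sub>M borel)"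
    using measurable_compose[OF _ m, of "\<lambda>w. (snd w, fst w)" "borel \<Otimes>\<^sub>M borel"] by simp
  then have "(\<lambda>(x, \<sigma>). indicator {0..1} \<sigma> *\<^sub>R free_prop (- \<sigma>) (K \<sigma>) x) \<in> borel_measurable (borel \<Otimes>\<^sub>M lborel)"
    by (simp add: case_prod_unfold cong: measurable_cong_sets)
  from lborel.borel_measurable_lebesgue_integral[OF this] show ?thesis
    unfolding duhamel_def[abs_def] set_lebesgue_integral_def by simp
qed

lemma duhamel_cmult: "duhamel (\<lambda>\<sigma> x. c * K \<sigma> x) x = c * duhamel K x"
  unfolding duhamel_def free_prop_cmult set_lebesgue_integral_def by (subst integral_mult_right_zero[symmetric]) simp

text \<open>Fubini brings the \<sigma>-integral outside, and adjointness moves the backward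
  propagator off \<open>K \<sigma>\<close>; the pairing becomes an average of pairings with the
  forward evolution of g.\<close>

lemma
  fixes K :: "real \<Rightarrow> real^'n \<Rightarrow> complex"
  assumes K: "uschwartz {0..1} K"
    and meas: "(\<lambda>(\<sigma>, x). K \<sigma> x) \<in> borel_measurable (borel \<Otimes>\<^sub>M borel)" and g: "schwartz g"
  shows duhamel_pairing: "(LINT x|lborel. cnj (duhamel K x) * g x) =
      (LBINT \<sigma>:{0..1}. (LINT x|lborel. cnj (K \<sigma> x) * free_prop \<sigma> g x))"
    and duhamel_pairing_integrable:
      "set_integrable lborel {0..1} (\<lambda>\<sigma>. LINT x|lborel. cnj (K \<sigma> x) * free_prop \<sigma> g x)"
proof -
  let ?h = "\<lambda>\<sigma> x. cnj (free_prop (- \<sigma>) (K \<sigma>) x) * g x"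
  have u: "uschwartz {0..1} ?h"
    by (intro uschwartz_mult uschwartz_cnj uschwartz_back_prop K uschwartz_const g)
  obtain C where C: "\<And>\<sigma> x. \<sigma> \<in> {0..1} \<Longrightarrow> norm (?h \<sigma> x) \<le> C * decay x"
    using uschwartz_decay[OF u] by blast
  have m: "(\<lambda>w. free_prop (- fst w) (K (fst w)) (snd w)) \<in> borel_measurable (borel \<Otimes>\<^sub>M borel)"
    using measurable_strip_free_prop[OF meas, of uminus] by (simp add: case_prod_unfold)
  have cnj: "cnj \<in> borel_measurable borel"
    by (intro borel_measurable_continuous_onI continuous_on_cnj continuous_on_id)
  have mg: "(\<lambda>w. g (snd w)) \<in> borel_measurable (borel \<Otimes>\<^sub>M borel)"
    using measurable_compose[OF measurable_snd schwartz_measurable[OF g]] .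
  have mh: "(\<lambda>(\<sigma>, x). ?h \<sigma> x) \<in> borel_measurable (borel \<Otimes>\<^sub>M borel)"
    using borel_measurable_times[OF measurable_compose[OF m cnj] mg] by (simp add: case_prod_unfold)
  note F = unit_strip_Fubini[OF mh C]
  have inner: "(LINT x|lborel. ?h \<sigma> x) = (LINT x|lborel. cnj (K \<sigma> x) * free_prop \<sigma> g x)" if "\<sigma> \<in> {0..1}" for \<sigma>
  proof -
    have "(LINT x|lborel. ?h \<sigma> x) = cnj (LINT x|lborel. free_prop (- \<sigma>) (K \<sigma>) x * cnj (g x))"
      by (subst Bochner_Integration.integral_cnj[symmetric]) simp
    also have "\<dots> = cnj (LINT x|lborel. K \<sigma> x * cnj (free_prop (- (- \<sigma>)) g x))"
      by (subst free_prop_adjoint[OF uschwartzD_schwartz[OF K that] g]) (rule refl)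
    also have "\<dots> = (LINT x|lborel. cnj (K \<sigma> x) * free_prop \<sigma> g x)"
      by (subst Bochner_Integration.integral_cnj[symmetric]) simp
    finally show ?thesis .
  qed
  have eq: "cnj (duhamel K x) * g x = (LBINT \<sigma>:{0..1}. ?h \<sigma> x)" for x
    unfolding duhamel_def set_lebesgue_integral_def
    by (subst Bochner_Integration.integral_cnj[symmetric], subst integral_mult_left_zero[symmetric]) simp
  have "(LINT x|lborel. cnj (duhamel K x) * g x) = (LBINT \<sigma>:{0..1}. (LINT x|lborel. ?h \<sigma> x))"
    unfolding eq by (rule F(3))
  also have "\<dots> = (LBINT \<sigma>:{0..1}. (LINT x|lborel. cnj (K \<sigma> x) * free_prop \<sigma> g x))"
    by (intro set_lebesgue_integral_cong) (auto simp: inner)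
  finally show "(LINT x|lborel. cnj (duhamel K x) * g x) =
      (LBINT \<sigma>:{0..1}. (LINT x|lborel. cnj (K \<sigma> x) * free_prop \<sigma> g x))" .
  show "set_integrable lborel {0..1} (\<lambda>\<sigma>. LINT x|lborel. cnj (K \<sigma> x) * free_prop \<sigma> g x)"
    using F(2) by (subst set_integrable_cong[OF refl refl inner[symmetric]]) auto
qed

section \<open>Integration by parts in the propagation parameter\<close>

lemma set_integral_unit_FTC:
  fixes h :: "real \<Rightarrow> real"
  assumes "\<And>\<sigma>. \<sigma> \<in> {0..1} \<Longrightarrow> (h has_real_derivative h' \<sigma>) (at \<sigma>)"
    and "set_integrable lborel {0..1} h'"
  shows "(LBINT \<sigma>:{0..1}. h' \<sigma>) = h 1 - h 0"
proof -
  have "(h' has_integral (h 1 - h 0)) {0..1}"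
    by (rule fundamental_theorem_of_calculus)
      (use assms(1) in \<open>auto simp: has_real_derivative_iff_has_vector_derivative intro: has_vector_derivative_at_within\<close>)
  then show ?thesis using set_borel_integral_eq_integral(2)[OF assms(2)] by (simp add: integral_unique)
qed

lemma lp_mass_set_integrable:
  assumes "schwartz f" "even p"
  shows "set_integrable lborel {0..1} (lp_mass p f)" "set_integrable lborel {0..1} (\<lambda>\<sigma>. \<sigma> * lp_mass p f \<sigma>)"
proof -
  have "continuous_on {0..1} (lp_mass p f)"
    using lp_mass_has_derivative[OF assms] DERIV_continuous_on has_field_derivative_at_within by blast
  then show "set_integrable lborel {0..1} (lp_mass p f)" "set_integrable lborel {0..1} (\<lambda>\<sigma>. \<sigma> * lp_mass p f \<sigma>)"
    by (auto intro!: borel_integrable_atLeastAtMost' continuous_intros)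
qed

lemma uschwartz_power_nl_free_prop:
  assumes "schwartz f" "even p"
  shows "uschwartz {0..1} (\<lambda>\<sigma> x. power_nl p (free_prop \<sigma> f x))"
  by (intro uschwartz_power_nl uschwartz_free_prop[where s = "\<lambda>\<sigma>. \<sigma>" and f = "\<lambda>_. f" and B = 1] uschwartz_const assms) auto

lemma measurable_power_nl_free_prop:
  assumes "schwartz f"
  shows "(\<lambda>(\<sigma>, x). power_nl p (free_prop \<sigma> f x)) \<in> borel_measurable (borel \<Otimes>\<^sub>M borel)"
  using measurable_compose[OF measurable_strip_free_prop_const[OF assms] measurable_power_nl[of p]]
  by (simp add: case_prod_unfold)

lemma nonlin_pair_norm2:
  fixes f :: "real^'n \<Rightarrow> complex"
  assumes f: "schwartz f" and p: "even p"
  shows "2 * Im (LINT x|lborel. cnj (dm_nonlin p f x) * (of_real ((norm x)\<^sup>2) * f x)) =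
    (4 * real CARD('n) * real p - 16) / (real p + 2) * (LBINT \<sigma>:{0..1}. \<sigma> * lp_mass p f \<sigma>)
      + 8 / (real p + 2) * lp_mass p f 1"
proof -
  let ?d = "real CARD('n)" and ?q = "real p + 2"
  let ?J = "\<lambda>\<sigma>. LINT x|lborel. cnj (power_nl p (free_prop \<sigma> f x)) * free_prop \<sigma> (\<lambda>x. of_real ((norm x)\<^sup>2) * f x) x"
  \<comment> \<open>The primitive is chosen so that its derivative contains the term 4 \<sigma>^2
    \<open>lp_mass'\<close> / (p + 2) of the pairing. The product rule also gives 8 \<sigma>
    \<open>lp_mass\<close> / (p + 2), which explains the -8 in the coefficient of
    \<open>?h'\<close>. At \<sigma> = 0 the primitive vanishes, so only the value at \<sigma> = 1
    survives.\<close>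
  let ?h = "\<lambda>\<sigma>. 4 / ?q * (\<sigma>\<^sup>2 * lp_mass p f \<sigma>)"
  let ?h' = "\<lambda>\<sigma>. Im (?J \<sigma>) - (2 * ?d * real p - 8) / ?q * (\<sigma> * lp_mass p f \<sigma>)"
  note pair = duhamel_pairing[OF uschwartz_power_nl_free_prop[OF f p] measurable_power_nl_free_prop[OF f] schwartz_norm2[OF f]]
    duhamel_pairing_integrable[OF uschwartz_power_nl_free_prop[OF f p] measurable_power_nl_free_prop[OF f] schwartz_norm2[OF f]]
  have iJ: "set_integrable lborel {0..1} (\<lambda>\<sigma>. Im (?J \<sigma>))"
    using integrable_Im[OF pair(2)[unfolded set_integrable_def]] by (simp add: set_integrable_def)
  have i1: "set_integrable lborel {0..1} (\<lambda>\<sigma>. (2 * ?d * real p - 8) / ?q * (\<sigma> * lp_mass p f \<sigma>))"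
    by (intro set_integrable_mult_right lp_mass_set_integrable f p)
  have arith: "4 / q * (2 * s * L + s\<^sup>2 * M) =
      (2 * s * (d * r) * L + 4 * s\<^sup>2 * M) / q - (2 * d * r - 8) / q * (s * L)" for q s L M d r :: real
    by (cases "q = 0") (simp_all add: field_simps)
  have "(LBINT \<sigma>:{0..1}. ?h' \<sigma>) = ?h 1 - ?h 0"
  proof (rule set_integral_unit_FTC)
    fix \<sigma>
    have "(?h has_real_derivative 4 / ?q * (2 * \<sigma> * lp_mass p f \<sigma> + \<sigma>\<^sup>2 * lp_mass' p f \<sigma>)) (at \<sigma>)"
      by (intro DERIV_cmult) (auto intro!: derivative_eq_intros lp_mass_has_derivative[OF f p])
    also have "4 / ?q * (2 * \<sigma> * lp_mass p f \<sigma> + \<sigma>\<^sup>2 * lp_mass' p f \<sigma>) = ?h' \<sigma>"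
      unfolding power_nl_pair_norm2[OF f p] by (rule arith)
    finally show "(?h has_real_derivative ?h' \<sigma>) (at \<sigma>)" .
  qed (intro set_integral_diff iJ i1)
  moreover have "(LBINT \<sigma>:{0..1}. ?h' \<sigma>) = (LBINT \<sigma>:{0..1}. Im (?J \<sigma>)) -
      (2 * ?d * real p - 8) / ?q * (LBINT \<sigma>:{0..1}. \<sigma> * lp_mass p f \<sigma>)"
    by (subst set_integral_diff(2)[OF iJ i1]) simp
  moreover have "(LBINT \<sigma>:{0..1}. Im (?J \<sigma>)) = Im (LINT x|lborel. cnj (dm_nonlin p f x) * (of_real ((norm x)\<^sup>2) * f x))"
    unfolding dm_nonlin_duhamel pair(1) using integral_Im[OF pair(2)[unfolded set_integrable_def]]
    by (simp add: set_lebesgue_integral_def)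
  ultimately have "Im (LINT x|lborel. cnj (dm_nonlin p f x) * (of_real ((norm x)\<^sup>2) * f x)) =
      4 / ?q * lp_mass p f 1 + (2 * ?d * real p - 8) / ?q * (LBINT \<sigma>:{0..1}. \<sigma> * lp_mass p f \<sigma>)"
    by simp
  moreover have "(4 * ?d * real p - 16) / ?q = 2 * ((2 * ?d * real p - 8) / ?q)" by simp
  ultimately show ?thesis by (simp only:) simp
qed

lemma nonlin_pair_dilation:
  fixes f :: "real^'n \<Rightarrow> complex"
  assumes f: "schwartz f" and p: "even p"
  shows "Re (LINT x|lborel. cnj (dm_nonlin p f x) * dilation f x) =
    (real CARD('n) * real p - 4) / (real p + 2) * (LBINT \<sigma>:{0..1}. lp_mass p f \<sigma>) + 4 / (real p + 2) * lp_mass p f 1"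
proof -
  let ?d = "real CARD('n)" and ?q = "real p + 2"
  let ?J = "\<lambda>\<sigma>. LINT x|lborel. cnj (power_nl p (free_prop \<sigma> f x)) * free_prop \<sigma> (dilation f) x"
  \<comment> \<open>Here the pairing contains 4 \<sigma> \<open>lp_mass'\<close> / (p + 2), so one
    power of \<sigma> suffices; the product rule leaves 4 \<open>lp_mass\<close> / (p + 2), hence
    the coefficient d p - 4.\<close>
  let ?h = "\<lambda>\<sigma>. 4 / ?q * (\<sigma> * lp_mass p f \<sigma>)"
  let ?h' = "\<lambda>\<sigma>. Re (?J \<sigma>) - (?d * real p - 4) / ?q * lp_mass p f \<sigma>"
  note pair = duhamel_pairing[OF uschwartz_power_nl_free_prop[OF f p] measurable_power_nl_free_prop[OF f] schwartz_dilation[OF f]]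
    duhamel_pairing_integrable[OF uschwartz_power_nl_free_prop[OF f p] measurable_power_nl_free_prop[OF f] schwartz_dilation[OF f]]
  have iJ: "set_integrable lborel {0..1} (\<lambda>\<sigma>. Re (?J \<sigma>))"
    using integrable_Re[OF pair(2)[unfolded set_integrable_def]] by (simp add: set_integrable_def)
  have i1: "set_integrable lborel {0..1} (\<lambda>\<sigma>. (?d * real p - 4) / ?q * lp_mass p f \<sigma>)"
    by (intro set_integrable_mult_right lp_mass_set_integrable f p)
  have arith: "4 / q * (L + s * M) = (d * r * L + 4 * s * M) / q - (d * r - 4) / q * L" for q s L M d r :: real
    by (cases "q = 0") (simp_all add: field_simps)
  have "(LBINT \<sigma>:{0..1}. ?h' \<sigma>) = ?h 1 - ?h 0"
  proof (rule set_integral_unit_FTC)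
    fix \<sigma>
    have "(?h has_real_derivative 4 / ?q * (lp_mass p f \<sigma> + \<sigma> * lp_mass' p f \<sigma>)) (at \<sigma>)"
      by (intro DERIV_cmult) (auto intro!: derivative_eq_intros lp_mass_has_derivative[OF f p])
    also have "4 / ?q * (lp_mass p f \<sigma> + \<sigma> * lp_mass' p f \<sigma>) = ?h' \<sigma>"
      unfolding power_nl_pair_dilation[OF f p] by (rule arith)
    finally show "(?h has_real_derivative ?h' \<sigma>) (at \<sigma>)" .
  qed (intro set_integral_diff iJ i1)
  moreover have "(LBINT \<sigma>:{0..1}. ?h' \<sigma>) = (LBINT \<sigma>:{0..1}. Re (?J \<sigma>)) -
      (?d * real p - 4) / ?q * (LBINT \<sigma>:{0..1}. lp_mass p f \<sigma>)"
    by (subst set_integral_diff(2)[OF iJ i1]) simp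
  moreover have "(LBINT \<sigma>:{0..1}. Re (?J \<sigma>)) = Re (LINT x|lborel. cnj (dm_nonlin p f x) * dilation f x)"
    unfolding dm_nonlin_duhamel pair(1) using integral_Re[OF pair(2)[unfolded set_integrable_def]]
    by (simp add: set_lebesgue_integral_def)
  ultimately show ?thesis by simp
qed

lemma lp_mass_Fubini:
  assumes f: "schwartz f" and p: "even p"
  shows "integrable lborel (\<lambda>x. LBINT \<sigma>:{0..1}. norm (free_prop \<sigma> f x) ^ (p + 2))"
    and "(LINT x|lborel. (LBINT \<sigma>:{0..1}. norm (free_prop \<sigma> f x) ^ (p + 2))) = (LBINT \<sigma>:{0..1}. lp_mass p f \<sigma>)"
proof -
  have u: "uschwartz {0..1} (\<lambda>\<sigma> x. cnj (power_nl p (free_prop \<sigma> f x)) * free_prop \<sigma> f x)"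
    by (intro uschwartz_mult uschwartz_cnj uschwartz_power_nl_free_prop f p
        uschwartz_free_prop[where s = "\<lambda>\<sigma>. \<sigma>" and f = "\<lambda>_. f" and B = 1] uschwartz_const) auto
  obtain C where C: "\<And>\<sigma> x. \<sigma> \<in> {0..1} \<Longrightarrow> norm (norm (free_prop \<sigma> f x) ^ (p + 2)) \<le> C * decay x"
    using uschwartz_decay[OF u] unfolding cnj_power_nl_mult norm_of_real by (metis real_norm_def)
  have "(\<lambda>z. norm ((case z of (\<sigma>, x) \<Rightarrow> free_prop \<sigma> f x)) ^ (p + 2)) \<in> borel_measurable (borel \<Otimes>\<^sub>M borel)"
    using measurable_strip_free_prop_const[OF f] by measurable
  then have m: "(\<lambda>(\<sigma>, x). norm (free_prop \<sigma> f x) ^ (p + 2)) \<in> borel_measurable (borel \<Otimes>\<^sub>M borel)"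
    by (simp add: case_prod_unfold)
  note F = unit_strip_Fubini[OF m C]
  show "integrable lborel (\<lambda>x. LBINT \<sigma>:{0..1}. norm (free_prop \<sigma> f x) ^ (p + 2))" by (rule F(1))
  show "(LINT x|lborel. (LBINT \<sigma>:{0..1}. norm (free_prop \<sigma> f x) ^ (p + 2))) = (LBINT \<sigma>:{0..1}. lp_mass p f \<sigma>)"
    unfolding lp_mass_def by (rule F(3))
qed

section \<open>Differentiation in time\<close>

lemma measurable_cnj [measurable]: "cnj \<in> borel_measurable borel"
  by (intro borel_measurable_continuous_onI continuous_on_cnj continuous_on_id)

lemma decay_le_1: "decay x \<le> 1"
  unfolding decay_def by (intro prod_le_1) (auto simp: field_simps add_pos_nonneg)

text \<open>Meant for Duhamel averages h, about which only measurability and a bound by the weight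
  are available.\<close>

lemma integrable_cnj_mult_schwartz:
  assumes m: "h \<in> borel_measurable borel" and b: "\<And>x. norm (h x) \<le> C * decay x" and g: "schwartz g"
  shows "integrable lborel (\<lambda>x. cnj (h x) * g x)"
proof -
  obtain B where B: "B \<ge> 0" "\<And>x. norm (g x) \<le> B * decay x" using schwartz_decay[OF g] by blast
  show ?thesis
  proof (rule integrable_decay_bound[where C = "C * B"])
    show "(\<lambda>x. cnj (h x) * g x) \<in> borel_measurable borel"
      by (intro borel_measurable_times measurable_compose[OF m measurable_cnj] schwartz_measurable g)
    fix x
    have "norm (g x) \<le> B"
      using B(2)[of x] mult_left_mono[OF decay_le_1 B(1), of x] by simp
    then have "norm (h x) * norm (g x) \<le> (C * decay x) * B"
      by (intro mult_mono b order_trans[OF norm_ge_zero b]) auto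
    then show "norm (cnj (h x) * g x) \<le> C * B * decay x" by (simp add: norm_mult ac_simps)
  qed
qed

text \<open>Used with F and G the values at f and g of one operator. When that operator is symmetric
  the cross terms cancel in the real part, and a difference of two quadratic forms becomes a pairing
  with f - g.\<close>

lemma sesquilinear_diff:
  assumes "schwartz f" "schwartz g" "schwartz F" "schwartz G"
  shows "(LINT x|lborel. cnj (f x - g x) * (F x + G x)) =
    (LINT x|lborel. cnj (f x) * F x) + (LINT x|lborel. cnj (f x) * G x)
    - (LINT x|lborel. cnj (g x) * F x) - (LINT x|lborel. cnj (g x) * G x)"
proof -
  have i: "integrable lborel (\<lambda>x. cnj (f x) * F x)" "integrable lborel (\<lambda>x. cnj (f x) * G x)"
    "integrable lborel (\<lambda>x. cnj (g x) * F x)" "integrable lborel (\<lambda>x. cnj (g x) * G x)"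
    by (intro schwartz_integrable schwartz_mult schwartz_cnj assms)+
  have "(LINT x|lborel. cnj (f x - g x) * (F x + G x)) =
    (LINT x|lborel. cnj (f x) * F x + cnj (f x) * G x - cnj (g x) * F x - cnj (g x) * G x)"
    by (intro Bochner_Integration.integral_cong refl) (simp add: algebra_simps)
  then show ?thesis using i by simp
qed

lemma laplacian_pair:
  assumes f: "schwartz f" and g: "schwartz g"
  shows "(LINT x|lborel. cnj (f x) * laplacian g x) = - (\<Sum>j\<in>UNIV. LINT x|lborel. cnj (pd j f x) * pd j g x)"
  by (subst pair_swap, subst laplacian_pair_left[OF g f], subst pair_swap) simp

lemma laplacian_pair_swap:
  assumes f: "schwartz f" and g: "schwartz g"
  shows "Re (LINT x|lborel. cnj (f x) * laplacian g x) = Re (LINT x|lborel. cnj (g x) * laplacian f x)"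
  unfolding laplacian_pair[OF f g] laplacian_pair[OF g f]
  by (subst pair_swap) simp

lemma integral_norm_grad:
  assumes f: "schwartz f"
  shows "(LINT x|lborel. (norm (grad f x))\<^sup>2) = - Re (LINT x|lborel. cnj (f x) * laplacian f x)"
proof -
  have "cnj (pd j f x) * pd j f x = of_real ((norm (pd j f x))\<^sup>2)" for j x
    unfolding complex_norm_square[of "pd j f _"] by (rule mult.commute)
  then have "(LINT x|lborel. cnj (f x) * laplacian f x) = - (\<Sum>j\<in>UNIV. of_real (LINT x|lborel. (norm (pd j f x))\<^sup>2))"
    unfolding laplacian_pair[OF f f] by (simp only: integral_complex_of_real)
  then show ?thesis unfolding integral_norm_grad_sum[OF f] by simp
qed

text \<open>Twice the derivative of x_j g minus g equals 2 x_j times the derivative of g plus g; in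
  this form integration by parts applies directly.\<close>

lemma dilation_pair_coord:
  assumes f: "schwartz f" and g: "schwartz g"
  shows "(LINT x|lborel. cnj (f x) * (2 * (of_real (x $ j) * pd j g x) + g x)) =
    - (LINT x|lborel. cnj (2 * (of_real (x $ j) * pd j f x) + f x) * g x)"
proof -
  have xg: "schwartz (\<lambda>x. of_real (x $ j) * g x)" by (rule schwartz_coord[OF g])
  have "(LINT x|lborel. pd j (\<lambda>x. cnj (f x)) x * (of_real (x $ j) * g x)) = - (LINT x|lborel. cnj (f x) * pd j (\<lambda>x. of_real (x $ j) * g x) x)"
    by (intro integration_by_parts schwartz_cnj f xg)
  then have *: "(LINT x|lborel. cnj (f x) * (of_real (x $ j) * pd j g x + g x)) = - (LINT x|lborel. cnj (pd j f x) * (of_real (x $ j) * g x))"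
    by (simp add: pd_cnj schwartz_differentiable f g pd_coord_mult)
  have i: "integrable lborel (\<lambda>x. cnj (f x) * (of_real (x $ j) * pd j g x + g x))" "integrable lborel (\<lambda>x. cnj (f x) * g x)"
    "integrable lborel (\<lambda>x. cnj (pd j f x) * (of_real (x $ j) * g x))"
    by (intro schwartz_integrable schwartz_mult schwartz_cnj schwartz_add schwartz_coord schwartz_pd f g)+
  have "(LINT x|lborel. cnj (f x) * (2 * (of_real (x $ j) * pd j g x) + g x)) =
      (LINT x|lborel. 2 * (cnj (f x) * (of_real (x $ j) * pd j g x + g x)) - cnj (f x) * g x)"
    by (intro Bochner_Integration.integral_cong refl) (simp add: algebra_simps)
  also have "\<dots> = 2 * (LINT x|lborel. cnj (f x) * (of_real (x $ j) * pd j g x + g x)) - (LINT x|lborel. cnj (f x) * g x)"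
    using i by simp
  also have "\<dots> = - (2 * (LINT x|lborel. cnj (pd j f x) * (of_real (x $ j) * g x)) + (LINT x|lborel. cnj (f x) * g x))"
    unfolding * by simp
  also have "2 * (LINT x|lborel. cnj (pd j f x) * (of_real (x $ j) * g x)) + (LINT x|lborel. cnj (f x) * g x) =
      (LINT x|lborel. 2 * (cnj (pd j f x) * (of_real (x $ j) * g x)) + cnj (f x) * g x)"
    using i by simp
  also have "\<dots> = (LINT x|lborel. cnj (2 * (of_real (x $ j) * pd j f x) + f x) * g x)"
    by (intro Bochner_Integration.integral_cong refl) (simp add: algebra_simps)
  finally show ?thesis .
qed

text \<open>Skew-adjointness turns the pairing into minus the conjugate of the swapped one, and a
  number and minus its conjugate have the same imaginary part.\<close>

lemma dilation_pair_swap: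
  assumes f: "schwartz f" and g: "schwartz g"
  shows "Im (LINT x|lborel. cnj (f x) * dilation g x) = Im (LINT x|lborel. cnj (g x) * dilation f x)"
proof -
  have "(LINT x|lborel. cnj (f x) * dilation g x) =
      (\<Sum>j\<in>UNIV. LINT x|lborel. cnj (f x) * (2 * (of_real (x $ j) * pd j g x) + g x))"
    unfolding dilation_def sum_distrib_left
    by (intro Bochner_Integration.integral_sum schwartz_integrable schwartz_mult schwartz_cnj schwartz_add
        schwartz_cmult schwartz_coord schwartz_pd f g)
  also have "\<dots> = - (\<Sum>j\<in>UNIV. LINT x|lborel. cnj (2 * (of_real (x $ j) * pd j f x) + f x) * g x)"
    unfolding dilation_pair_coord[OF f g] by (rule sum_negf)
  also have "(\<Sum>j\<in>UNIV. LINT x|lborel. cnj (2 * (of_real (x $ j) * pd j f x) + f x) * g x) = (LINT x|lborel. cnj (dilation f x) * g x)"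
    unfolding dilation_def cnj_sum sum_distrib_right
    by (intro Bochner_Integration.integral_sum[symmetric] schwartz_integrable schwartz_mult schwartz_cnj schwartz_add
        schwartz_cmult schwartz_coord schwartz_pd f g)
  also have "- (LINT x|lborel. cnj (dilation f x) * g x) = - cnj (LINT x|lborel. cnj (g x) * dilation f x)"
    by (subst pair_swap) (rule refl)
  finally show ?thesis by simp
qed

text \<open>The factor accompanying \<open>cnj (a - b)\<close> in \<open>|a|\<^sup>p\<^sup>+\<^sup>2 - |b|\<^sup>p\<^sup>+\<^sup>2\<close>, up to real parts.  Being polynomial in
  \<open>a\<close>, \<open>b\<close> and their conjugates, it preserves Schwartz families.\<close>

definition power_kernel :: "nat \<Rightarrow> complex \<Rightarrow> complex \<Rightarrow> complex" where
  "power_kernel p a b = (\<Sum>i<Suc (p div 2). (b * cnj b) ^ (p div 2 - i) * ((a * cnj a) ^ i * (a + b)))"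

text \<open>With A = |a|^2, B = |b|^2 and p = 2 m, the kernel is a + b times the sum that cofactors
  A - B in A^(m+1) - B^(m+1), and the conjugate of a + b times a - b has real part A - B.\<close>

lemma power_kernel_diff:
  assumes "even p"
  shows "Re (cnj (power_kernel p a b) * (a - b)) = norm a ^ (p + 2) - norm b ^ (p + 2)"
proof -
  obtain m where m: "p = 2 * m" using assms by blast
  let ?A = "(norm a)\<^sup>2" and ?B = "(norm b)\<^sup>2"
  let ?S = "\<Sum>i<Suc m. ?B ^ (m - i) * ?A ^ i"
  have k: "power_kernel p a b = of_real ?S * (a + b)"
    unfolding power_kernel_def m by (simp add: sum_distrib_right complex_norm_square[symmetric] mult.assoc del: sum.lessThan_Suc)
  have "Re (cnj (power_kernel p a b) * (a - b)) = ?S * Re (cnj (a + b) * (a - b))"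
    unfolding k by (simp only: complex_cnj_mult complex_cnj_complex_of_real mult.assoc) simp
  also have "Re (cnj (a + b) * (a - b)) = ?A - ?B"
    unfolding cmod_power2 by (simp add: power2_eq_square algebra_simps)
  also have "?S * (?A - ?B) = ?A ^ Suc m - ?B ^ Suc m"
    unfolding power_diff_sumr2[of ?A "Suc m" ?B] by (simp add: mult.commute)
  also have "\<dots> = norm a ^ (p + 2) - norm b ^ (p + 2)"
    by (simp add: m power_mult power2_eq_square power_mult_distrib)
  finally show ?thesis .
qed

text \<open>On the diagonal all m + 1 summands coincide and each contains a + a, so the total factor
  is 2 (m + 1) = p + 2.\<close>

lemma power_kernel_diag:
  assumes "even p" shows "power_kernel p a a = of_real (real p + 2) * power_nl p a"
proof -
  obtain m where m: "p = 2 * m" using assms by blast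
  have "(a * cnj a) ^ (m - i) * ((a * cnj a) ^ i * (a + a)) = (a * cnj a) ^ m * (2 * a)" if "i < Suc m" for i
    using that by (simp add: mult.assoc[symmetric] power_add[symmetric])
  then have "power_kernel p a a = (\<Sum>i<Suc m. (a * cnj a) ^ m * (2 * a))"
    unfolding power_kernel_def m by (intro sum.cong) auto
  also have "\<dots> = of_nat (Suc m) * ((a * cnj a) ^ m * (2 * a))" by (simp del: sum.lessThan_Suc)
  also have "(a * cnj a) ^ m = of_real (norm a ^ p)"
    unfolding complex_norm_square[symmetric] m power_mult by simp
  finally show ?thesis by (simp add: m power_nl_def algebra_simps)
qed

lemma uschwartz_power_mult:
  assumes "uschwartz A w" "uschwartz A f"
  shows "uschwartz A (\<lambda>a x. (w a x * cnj (w a x)) ^ i * f a x)"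
proof (induction i)
  case (Suc i)
  have "uschwartz A (\<lambda>a x. (w a x * cnj (w a x)) * ((w a x * cnj (w a x)) ^ i * f a x))"
    by (intro uschwartz_mult uschwartz_cnj assms Suc)
  then show ?case by (simp add: mult.assoc)
qed (use assms in simp)

lemma uschwartz_power_kernel:
  assumes "uschwartz A f" "uschwartz A g" shows "uschwartz A (\<lambda>a x. power_kernel p (f a x) (g a x))"
  unfolding power_kernel_def by (intro uschwartz_sum uschwartz_power_mult uschwartz_add assms) auto

lemma measurable_power_kernel:
  assumes [measurable]: "F \<in> borel_measurable M" "G \<in> borel_measurable M"
  shows "(\<lambda>z. power_kernel p (F z) (G z)) \<in> borel_measurable M"
  unfolding power_kernel_def by measurable

lemma measurable_power_kernel_free_prop:
  assumes f: "schwartz f" and g: "schwartz g"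
  shows "(\<lambda>(\<sigma>, x). power_kernel p (free_prop \<sigma> f x) (free_prop \<sigma> g x)) \<in> borel_measurable (borel \<Otimes>\<^sub>M borel)"
  using measurable_power_kernel[OF measurable_strip_free_prop_const[OF f] measurable_strip_free_prop_const[OF g]]
  by (simp add: case_prod_unfold)

lemma lp_mass_diff:
  assumes f: "schwartz f" and g: "schwartz g" and p: "even p"
  shows "lp_mass p f \<sigma> - lp_mass p g \<sigma> = Re (LINT x|lborel. cnj (power_kernel p (free_prop \<sigma> f x) (free_prop \<sigma> g x)) * free_prop \<sigma> (\<lambda>x. f x - g x) x)"
proof -
  let ?v = "free_prop \<sigma> f" and ?w = "free_prop \<sigma> g"
  have v: "schwartz ?v" and w: "schwartz ?w" by (intro schwartz_free_prop f g)+
  have k: "schwartz (\<lambda>x. power_kernel p (?v x) (?w x))"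
    using uschwartz_power_kernel[OF v[unfolded schwartz_unit] w[unfolded schwartz_unit]] unfolding schwartz_unit .
  have i: "integrable lborel (\<lambda>x. cnj (power_kernel p (?v x) (?w x)) * (?v x - ?w x))"
    by (intro schwartz_integrable schwartz_mult schwartz_cnj schwartz_diff k v w)
  have "lp_mass p f \<sigma> - lp_mass p g \<sigma> = (LINT x|lborel. norm (?v x) ^ (p + 2) - norm (?w x) ^ (p + 2))"
    unfolding lp_mass_def by (intro Bochner_Integration.integral_diff[symmetric] integrable_norm_power v w p)
  also have "\<dots> = (LINT x|lborel. Re (cnj (power_kernel p (?v x) (?w x)) * (?v x - ?w x)))"
    by (simp only: power_kernel_diff[OF p])
  also have "\<dots> = Re (LINT x|lborel. cnj (power_kernel p (?v x) (?w x)) * (?v x - ?w x))"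
    by (rule integral_Re[OF i])
  finally show ?thesis by (simp only: free_prop_diff[OF f g])
qed

text \<open>Adjointness transfers the propagator from f - g to the kernel, so the variation of the
  potential energy is expressed through f - g itself, the only object whose time difference
  quotients are controlled.\<close>

lemma lp_mass_integral_diff:
  assumes f: "schwartz f" and g: "schwartz g" and p: "even p"
  shows "(LBINT \<sigma>:{0..1}. lp_mass p f \<sigma>) - (LBINT \<sigma>:{0..1}. lp_mass p g \<sigma>) =
    Re (LINT x|lborel. cnj (f x - g x) * duhamel (\<lambda>\<sigma> x. power_kernel p (free_prop \<sigma> f x) (free_prop \<sigma> g x)) x)"
proof -
  let ?K = "\<lambda>\<sigma> x. power_kernel p (free_prop \<sigma> f x) (free_prop \<sigma> g x)"
  have K: "uschwartz {0..1} ?K"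
    by (intro uschwartz_power_kernel uschwartz_free_prop[where s = "\<lambda>\<sigma>. \<sigma>" and f = "\<lambda>_. f" and B = 1]
        uschwartz_free_prop[where s = "\<lambda>\<sigma>. \<sigma>" and f = "\<lambda>_. g" and B = 1] uschwartz_const f g) auto
  note P = duhamel_pairing[OF K measurable_power_kernel_free_prop[OF f g] schwartz_diff[OF f g]]
    duhamel_pairing_integrable[OF K measurable_power_kernel_free_prop[OF f g] schwartz_diff[OF f g]]
  have "(LBINT \<sigma>:{0..1}. lp_mass p f \<sigma>) - (LBINT \<sigma>:{0..1}. lp_mass p g \<sigma>) = (LBINT \<sigma>:{0..1}. lp_mass p f \<sigma> - lp_mass p g \<sigma>)"
    by (intro set_integral_diff(2)[symmetric] lp_mass_set_integrable f g p)
  also have "\<dots> = Re (LBINT \<sigma>:{0..1}. (LINT x|lborel. cnj (?K \<sigma> x) * free_prop \<sigma> (\<lambda>x. f x - g x) x))"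
    unfolding lp_mass_diff[OF f g p] using integral_Re[OF P(2)[unfolded set_integrable_def]]
    by (simp add: set_lebesgue_integral_def)
  also have "\<dots> = Re (LINT x|lborel. cnj (duhamel ?K x) * (f x - g x))" unfolding P(1) ..
  also have "\<dots> = Re (LINT x|lborel. cnj (f x - g x) * duhamel ?K x)"
    by (subst pair_swap) simp
  finally show ?thesis .
qed

text \<open>Isolates what differentiation in time needs from a solution: seminorm bounds uniform on
  a compact interval, and derivatives and limits at its interior points.\<close>

locale dm_flow =
  fixes \<gamma> a b :: real and p :: nat and u :: "real \<Rightarrow> real^'n \<Rightarrow> complex"
  assumes even_p: "even p"
    and uschwartz_u: "uschwartz {a..b} u"
    and u_deriv: "\<And>t x. t \<in> {a<..<b} \<Longrightarrow> ((\<lambda>s. u s x) has_vector_derivative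
      \<i> * (of_real \<gamma> * laplacian (u t) x + dm_nonlin p (u t) x)) (at t)"
    and u_tendsto: "\<And>t js x. t \<in> {a<..<b} \<Longrightarrow> ((\<lambda>s. iter_pd js (u s) x) \<longlongrightarrow> iter_pd js (u t) x) (at t)"
begin

text \<open>The equation says that the time derivative of u is i H. At the same time H is the
  gradient of the energy, which is the reason for conservation.\<close>

definition H :: "real \<Rightarrow> real^'n \<Rightarrow> complex" where
  "H t x = of_real \<gamma> * laplacian (u t) x + dm_nonlin p (u t) x"

lemma schwartz_u: "t \<in> {a..b} \<Longrightarrow> schwartz (u t)"
  by (rule uschwartzD_schwartz[OF uschwartz_u])

lemma schwartz_u': "t \<in> {a<..<b} \<Longrightarrow> schwartz (u t)"
  by (rule schwartz_u) auto

lemma eventually_interval: "t \<in> {a<..<b} \<Longrightarrow> eventually (\<lambda>s. s \<in> {a<..<b}) (at t)"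
  by (intro eventually_at_in_open') auto

lemma uschwartz_pair: "uschwartz ({a..b} \<times> {0..1}) (\<lambda>z. free_prop (snd z) (u (fst z)))"
  by (rule uschwartz_free_prop[where B = 1]) (auto intro!: uschwartz_reindex[OF uschwartz_u])

lemma nonlin_measurable: "t \<in> {a..b} \<Longrightarrow> dm_nonlin p (u t) \<in> borel_measurable borel"
  unfolding dm_nonlin_duhamel by (intro duhamel_measurable measurable_power_nl_free_prop schwartz_u)

lemma nonlin_bound: 
  obtains C where "C \<ge> 0" "\<And>t x. t \<in> {a..b} \<Longrightarrow> norm (dm_nonlin p (u t) x) \<le> C * decay x"
proof -
  have "uschwartz ({a..b} \<times> {0..1}) (\<lambda>z x. power_nl p (free_prop (snd z) (u (fst z)) x))"
    by (intro uschwartz_power_nl uschwartz_pair even_p)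
  from duhamel_bound[OF this] show ?thesis using that unfolding dm_nonlin_duhamel by blast
qed

lemma H_bound:
  obtains C where "C \<ge> 0" "\<And>t x. t \<in> {a..b} \<Longrightarrow> norm (H t x) \<le> C * decay x"
proof -
  obtain C where C: "C \<ge> 0" "\<And>t x. t \<in> {a..b} \<Longrightarrow> norm (dm_nonlin p (u t) x) \<le> C * decay x"
    using nonlin_bound by blast
  obtain B where B: "B \<ge> 0" "\<And>t x. t \<in> {a..b} \<Longrightarrow> norm (of_real \<gamma> * laplacian (u t) x) \<le> B * decay x"
    using uschwartz_decay[OF uschwartz_cmult[OF uschwartz_laplacian[OF uschwartz_u], of "of_real \<gamma>"]] by blast
  have "norm (H t x) \<le> (B + C) * decay x" if "t \<in> {a..b}" for t x
    unfolding H_def distrib_right by (rule norm_triangle_mono[OF B(2)[OF that] C(2)[OF that]])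
  then show ?thesis using that[of "B + C"] B(1) C(1) by auto
qed

lemma H_pair:
  assumes t: "t \<in> {a<..<b}" and g: "schwartz g"
  shows "(LINT x|lborel. cnj (H t x) * g x) =
    of_real \<gamma> * (LINT x|lborel. cnj (laplacian (u t) x) * g x) + (LINT x|lborel. cnj (dm_nonlin p (u t) x) * g x)"
proof -
  obtain C where C: "C \<ge> 0" "\<And>t x. t \<in> {a..b} \<Longrightarrow> norm (dm_nonlin p (u t) x) \<le> C * decay x"
    using nonlin_bound by blast
  have i1: "integrable lborel (\<lambda>x. cnj (dm_nonlin p (u t) x) * g x)"
    by (rule integrable_cnj_mult_schwartz[OF nonlin_measurable C(2) g]) (use t in auto)
  have i2: "integrable lborel (\<lambda>x. cnj (laplacian (u t) x) * g x)"
    by (intro schwartz_integrable schwartz_mult schwartz_cnj schwartz_laplacian schwartz_u' t g)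
  have "(LINT x|lborel. cnj (H t x) * g x) =
      (LINT x|lborel. of_real \<gamma> * (cnj (laplacian (u t) x) * g x) + cnj (dm_nonlin p (u t) x) * g x)"
    unfolding H_def by (intro Bochner_Integration.integral_cong refl) (simp add: algebra_simps)
  then show ?thesis using i1 i2 by simp
qed

text \<open>For each quantity \<open>Q\<close> to be differentiated, \<open>Q s - Q t\<close> is the pairing of \<open>u s - u t\<close> with some
  \<open>M s\<close>.  In this form only \<open>u\<close> itself, but neither its spatial derivatives nor \<open>e\<^sup>i\<^sup>\<sigma>\<^sup>\<Delta> u\<close>, has to be
  differentiated in time.\<close>

lemma time_derivative:
  assumes t: "t \<in> {a<..<b}"
    and meas: "\<And>s. s \<in> {a<..<b} \<Longrightarrow> M s \<in> borel_measurable borel"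
    and bound: "\<And>s x. s \<in> {a<..<b} \<Longrightarrow> norm (M s x) \<le> C * decay x"
    and lim: "\<And>x. ((\<lambda>s. M s x) \<longlongrightarrow> M t x) (at t)"
    and Q: "\<And>s. s \<in> {a<..<b} \<Longrightarrow> Q s - Q t = Re (LINT x|lborel. cnj (u s x - u t x) * M s x)"
  shows "(Q has_real_derivative Im (LINT x|lborel. cnj (H t x) * M t x)) (at t)"
proof -
  obtain B where B: "B \<ge> 0" "\<And>t x. t \<in> {a..b} \<Longrightarrow> norm (H t x) \<le> B * decay x" using H_bound by blast
  \<comment> \<open>For the difference quotients of u a constant bound, passed on by the mean value
    inequality, is enough; integrability in x is contributed by M.\<close>
  have HB: "norm (\<i> * H s x) \<le> B" if "s \<in> {a<..<b}" for s x
    using B(2)[of s x] mult_left_mono[OF decay_le_1 B(1), of x] that by (simp add: norm_mult)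
  have d: "((\<lambda>s. u s x) has_vector_derivative \<i> * H s x) (at s)" if "s \<in> {a<..<b}" for s x
    unfolding H_def by (rule u_deriv[OF that])
  let ?h = "\<lambda>s x. cnj ((u s x - u t x) /\<^sub>R (s - t)) * M s x"
  have "((\<lambda>s. LINT x|lborel. ?h s x) \<longlongrightarrow> (LINT x|lborel. cnj (\<i> * H t x) * M t x)) (at t)"
  proof (rule tendsto_integral_at[where g = "\<lambda>x. B * (C * decay x)"])
    show "((\<lambda>s. ?h s x) \<longlongrightarrow> cnj (\<i> * H t x) * M t x) (at t)" for x
      by (intro tendsto_mult tendsto_cnj lim d[OF t, unfolded has_vector_derivative_iff_quotient])
    show "\<forall>\<^sub>F s in at t. ?h s \<in> borel_measurable lborel \<and> (\<forall>x. norm (?h s x) \<le> B * (C * decay x))"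
      using eventually_interval[OF t] eventually_neq_at_within[of t t UNIV]
    proof eventually_elim
      case (elim s)
      have m: "u s \<in> borel_measurable borel" "u t \<in> borel_measurable borel"
        by (intro schwartz_measurable schwartz_u' elim t)+
      have "?h s \<in> borel_measurable borel"
        using m meas[OF elim(1)] by measurable
      moreover have "norm (?h s x) \<le> B * (C * decay x)" for x
      proof -
        have "norm (u s x - u t x) \<le> B * \<bar>s - t\<bar>"
          by (rule vector_mvt_bound[OF d HB elim(1) t])
        then have "norm ((u s x - u t x) /\<^sub>R (s - t)) \<le> B"
          using elim(2) by (simp add: divide_simps)
        then have "norm ((u s x - u t x) /\<^sub>R (s - t)) * norm (M s x) \<le> B * (C * decay x)"
          by (intro mult_mono bound elim B(1)) auto
        then show ?thesis by (simp only: norm_mult complex_mod_cnj)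
      qed
      ultimately show ?case by simp
    qed
  qed (auto intro: integrable_decay)
  then have "((\<lambda>s. Re (LINT x|lborel. ?h s x)) \<longlongrightarrow> Re (LINT x|lborel. cnj (\<i> * H t x) * M t x)) (at t)"
    by (rule tendsto_Re)
  moreover have "Re (LINT x|lborel. cnj (\<i> * H t x) * M t x) = Im (LINT x|lborel. cnj (H t x) * M t x)"
    by (simp add: mult.assoc)
  moreover have "eventually (\<lambda>s. Re (LINT x|lborel. ?h s x) = (Q s - Q t) /\<^sub>R (s - t)) (at t)"
    using eventually_interval[OF t]
  proof eventually_elim
    case (elim s)
    have "(LINT x|lborel. ?h s x) = (LINT x|lborel. inverse (s - t) *\<^sub>R (cnj (u s x - u t x) * M s x))"
      by (simp only: complex_cnj_scaleR mult_scaleR_left)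
    also have "\<dots> = inverse (s - t) *\<^sub>R (LINT x|lborel. cnj (u s x - u t x) * M s x)"
      by (rule integral_scaleR_right)
    finally show ?case using Q[OF elim] by simp
  qed
  ultimately have "((\<lambda>s. (Q s - Q t) /\<^sub>R (s - t)) \<longlongrightarrow> Im (LINT x|lborel. cnj (H t x) * M t x)) (at t)"
    using Lim_transform_eventually by force
  then show ?thesis
    unfolding has_real_derivative_iff_has_vector_derivative has_vector_derivative_iff_quotient .
qed

end

section \<open>Pairing forms of the variance, of \<open>variance_dot1\<close> and of the
  energy\<close>

lemma variance_pair:
  "(LINT x|lborel. (norm x)\<^sup>2 * (norm (f x))\<^sup>2) =
    Re (LINT x|lborel. cnj (f x) * (of_real ((norm x)\<^sup>2) * f (x::real^'n)))"
proof -
  have "cnj (f x) * (of_real ((norm x)\<^sup>2) * f x) = of_real ((norm x)\<^sup>2 * (norm (f x))\<^sup>2)" for x :: "real^'n"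
    unfolding of_real_mult complex_norm_square[of "f x"] by (simp only: ac_simps)
  then show ?thesis by (simp only: integral_complex_of_real Re_complex_of_real)
qed

text \<open>Replacing x.grad by half the dilation operator alters the pairing by a real multiple of
  the squared L2 norm, invisible to the imaginary part, and makes the operator skew-adjoint.\<close>

lemma variance_dot1_pair:
  fixes u :: "real \<Rightarrow> real^'n \<Rightarrow> complex"
  assumes "schwartz (u t)"
  shows "variance_dot1 u t = 2 * Im (LINT x|lborel. cnj (u t x) * dilation (u t) x)"
proof -
  have sx: "schwartz (x_dot_grad (u t))"
    unfolding x_dot_grad_eq[abs_def] by (intro schwartz_sum schwartz_coord schwartz_pd assms) auto
  have i: "integrable lborel (\<lambda>x. cnj (u t x) * x_dot_grad (u t) x)" "integrable lborel (\<lambda>x. cnj (u t x) * u t x)"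
    by (intro schwartz_integrable schwartz_mult schwartz_cnj sx assms)+
  have n: "cnj (u t x) * u t x = of_real ((norm (u t x))\<^sup>2)" for x
    unfolding complex_norm_square by (rule mult.commute)
  have "(LINT x|lborel. cnj (u t x) * dilation (u t) x) =
      (LINT x|lborel. 2 * (cnj (u t x) * x_dot_grad (u t) x) + of_nat CARD('n) * (cnj (u t x) * u t x))"
    unfolding dilation_eq by (intro Bochner_Integration.integral_cong refl) (simp add: algebra_simps)
  also have "\<dots> = 2 * (LINT x|lborel. cnj (u t x) * x_dot_grad (u t) x) + of_nat CARD('n) * (LINT x|lborel. cnj (u t x) * u t x)"
    using i by simp
  also have "(LINT x|lborel. cnj (u t x) * u t x) = of_real (LINT x|lborel. (norm (u t x))\<^sup>2)"
    unfolding n by (rule integral_complex_of_real)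
  finally show ?thesis unfolding variance_dot1_def by simp
qed

lemma dm_energy_pair:
  assumes "schwartz f" "even p"
  shows "dm_energy \<gamma> p f = (\<gamma> / 2) * Re (LINT x|lborel. cnj (f x) * laplacian f x)
    + 1 / (real p + 2) * (LBINT \<sigma>:{0..1}. lp_mass p f \<sigma>)"
  unfolding dm_energy_def lp_mass_Fubini(2)[OF assms] integral_norm_grad[OF assms(1)]
  by (simp only: mult_minus_left mult_minus_right minus_minus)

context dm_flow
begin

lemma tendsto_u:
  assumes "t \<in> {a<..<b}"
  shows "((\<lambda>s. u s x) \<longlongrightarrow> u t x) (at t)"
    and "((\<lambda>s. laplacian (u s) x) \<longlongrightarrow> laplacian (u t) x) (at t)"
    and "((\<lambda>s. dilation (u s) x) \<longlongrightarrow> dilation (u t) x) (at t)"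
proof -
  have 0: "((\<lambda>s. u s x) \<longlongrightarrow> u t x) (at t)" using u_tendsto[OF assms, of "[]" x] by simp
  have 1: "((\<lambda>s. pd j (u s) x) \<longlongrightarrow> pd j (u t) x) (at t)" for j using u_tendsto[OF assms, of "[j]" x] by simp
  have 2: "((\<lambda>s. pd j (pd j (u s)) x) \<longlongrightarrow> pd j (pd j (u t)) x) (at t)" for j
    using u_tendsto[OF assms, of "[j, j]" x] by simp
  show "((\<lambda>s. u s x) \<longlongrightarrow> u t x) (at t)" by (rule 0)
  show "((\<lambda>s. laplacian (u s) x) \<longlongrightarrow> laplacian (u t) x) (at t)"
    unfolding laplacian_def by (intro tendsto_sum 2)
  show "((\<lambda>s. dilation (u s) x) \<longlongrightarrow> dilation (u t) x) (at t)"
    unfolding dilation_def by (intro tendsto_sum tendsto_add tendsto_mult tendsto_const 0 1)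
qed

lemma uschwartz_bound:
  assumes "uschwartz {a..b} M"
  obtains C where "\<And>s x. s \<in> {a<..<b} \<Longrightarrow> norm (M s x) \<le> C * decay x"
proof -
  obtain C where C: "\<And>s x. s \<in> {a..b} \<Longrightarrow> norm (M s x) \<le> C * decay x" using uschwartz_decay[OF assms] by blast
  show ?thesis by (rule that[of C]) (use C in auto)
qed

lemma time_derivative_schwartz:
  assumes t: "t \<in> {a<..<b}"
    and M: "uschwartz {a..b} M"
    and lim: "\<And>x. ((\<lambda>s. M s x) \<longlongrightarrow> M t x) (at t)"
    and Q: "\<And>s. s \<in> {a<..<b} \<Longrightarrow> Q s - Q t = Re (LINT x|lborel. cnj (u s x - u t x) * M s x)"
  shows "(Q has_real_derivative Im (LINT x|lborel. cnj (H t x) * M t x)) (at t)"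
proof -
  obtain C where C: "\<And>s x. s \<in> {a<..<b} \<Longrightarrow> norm (M s x) \<le> C * decay x" using uschwartz_bound[OF M] by blast
  show ?thesis
    by (rule time_derivative[OF t _ C lim Q]) (auto intro!: schwartz_measurable uschwartzD_schwartz[OF M])
qed

lemma variance_deriv:
  assumes t: "t \<in> {a<..<b}"
  shows "(variance u has_real_derivative \<gamma> * variance_dot1 u t +
    ((4 * real CARD('n) * real p - 16) / (real p + 2) * (LBINT \<sigma>:{0..1}. \<sigma> * lp_mass p (u t) \<sigma>)
      + 8 / (real p + 2) * lp_mass p (u t) 1)) (at t)"
proof -
  let ?r = "\<lambda>f x. of_real ((norm x)\<^sup>2) * f x"
  \<comment> \<open>Multiplication by |x|^2 is symmetric, so the difference of the variances is the
    real part of pairing u s - u t with |x|^2 (u s + u t). At s = t this doubles the multiplier, the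
    source of the factor 2 in both contributions.\<close>
  let ?M = "\<lambda>s x. ?r (u s) x + ?r (u t) x"
  have sw: "schwartz (u s)" if "s \<in> {a<..<b}" for s using schwartz_u'[OF that] .
  have "(variance u has_real_derivative Im (LINT x|lborel. cnj (H t x) * ?M t x)) (at t)"
  proof (rule time_derivative_schwartz[OF t, where M = ?M])
    show "uschwartz {a..b} ?M"
      by (intro uschwartz_add uschwartz_norm2 uschwartz_u uschwartz_const sw t)
    show "((\<lambda>s. ?M s x) \<longlongrightarrow> ?M t x) (at t)" for x
      by (intro tendsto_add tendsto_mult tendsto_const tendsto_u(1)[OF t])
    fix s assume s: "s \<in> {a<..<b}"
    have arith: "x - y = x + p - q - y" if "p = q" for x y p q :: real using that by simp
    have "(LINT x|lborel. cnj (u s x) * ?r (u t) x) = cnj (LINT x|lborel. cnj (u t x) * ?r (u s) x)"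
      by (subst Bochner_Integration.integral_cnj[symmetric], intro Bochner_Integration.integral_cong refl)
         (simp only: complex_cnj_mult complex_cnj_cnj complex_cnj_complex_of_real ac_simps)
    then have "Re (LINT x|lborel. cnj (u s x) * ?r (u t) x) = Re (LINT x|lborel. cnj (u t x) * ?r (u s) x)"
      by (simp only: cnj.sel)
    then show "variance u s - variance u t = Re (LINT x|lborel. cnj (u s x - u t x) * ?M s x)"
      unfolding variance_def variance_pair
        sesquilinear_diff[OF sw[OF s] sw[OF t] schwartz_norm2[OF sw[OF s]] schwartz_norm2[OF sw[OF t]]]
        plus_complex.sel minus_complex.sel by (rule arith)
  qed
  also have "Im (LINT x|lborel. cnj (H t x) * ?M t x) = \<gamma> * variance_dot1 u t +
    ((4 * real CARD('n) * real p - 16) / (real p + 2) * (LBINT \<sigma>:{0..1}. \<sigma> * lp_mass p (u t) \<sigma>)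
      + 8 / (real p + 2) * lp_mass p (u t) 1)"
  proof -
    let ?D = "LINT x|lborel. cnj (laplacian (u t) x) * ?r (u t) x"
      and ?N = "LINT x|lborel. cnj (dm_nonlin p (u t) x) * ?r (u t) x"
    have "(LINT x|lborel. cnj (H t x) * ?M t x) = (LINT x|lborel. 2 * (cnj (H t x) * ?r (u t) x))"
      by (intro Bochner_Integration.integral_cong refl) (simp only: mult_2 distrib_left)
    then have A: "(LINT x|lborel. cnj (H t x) * ?M t x) = 2 * (of_real \<gamma> * ?D + ?N)"
      by (simp only: integral_mult_right_zero H_pair[OF t schwartz_norm2[OF sw[OF t]]])
    have B: "Im (2 * (of_real \<gamma> * y + z)) = \<gamma> * (2 * Im y) + 2 * Im z" for y z by simp
    have E: "2 * Im ?D = variance_dot1 u t"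
      unfolding laplacian_pair_norm2[OF sw[OF t]] variance_dot1_def by simp
    show ?thesis unfolding A B nonlin_pair_norm2[OF sw[OF t] even_p] E ..
  qed
  finally show ?thesis .
qed

lemma variance_dot1_deriv:
  assumes t: "t \<in> {a<..<b}"
  shows "(variance_dot1 u has_real_derivative 8 * \<gamma> * (LINT x|lborel. (norm (grad (u t) x))\<^sup>2) -
    4 * ((real CARD('n) * real p - 4) / (real p + 2) * (LBINT \<sigma>:{0..1}. lp_mass p (u t) \<sigma>)
      + 4 / (real p + 2) * lp_mass p (u t) 1)) (at t)"
proof -
  \<comment> \<open>The factor -2 i turns twice an imaginary part into a real part, and the
    skew-adjoint dilation into a symmetric operator.\<close>
  let ?c = "- 2 * \<i>"
  let ?M = "\<lambda>s x. ?c * dilation (u s) x + ?c * dilation (u t) x"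
  have sw: "schwartz (u s)" if "s \<in> {a<..<b}" for s using schwartz_u'[OF that] .
  have "(variance_dot1 u has_real_derivative Im (LINT x|lborel. cnj (H t x) * ?M t x)) (at t)"
  proof (rule time_derivative_schwartz[OF t, where M = ?M])
    show "uschwartz {a..b} ?M"
      by (intro uschwartz_add uschwartz_cmult uschwartz_dilation uschwartz_u uschwartz_const sw t)
    show "((\<lambda>s. ?M s x) \<longlongrightarrow> ?M t x) (at t)" for x
      by (intro tendsto_add tendsto_mult tendsto_const tendsto_u(3)[OF t])
    fix s assume s: "s \<in> {a<..<b}"
    have d: "(LINT x|lborel. cnj (f x) * (?c * g x)) = ?c * (LINT x|lborel. cnj (f x) * g x)"
      for f g :: "real^'n \<Rightarrow> complex"
      by (subst integral_mult_right_zero[symmetric]) (simp only: ac_simps)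
    have r: "Re (?c * z) = 2 * Im z" for z by simp
    show "variance_dot1 u s - variance_dot1 u t = Re (LINT x|lborel. cnj (u s x - u t x) * ?M s x)"
      unfolding variance_dot1_pair[of u s, OF sw[OF s]] variance_dot1_pair[of u t, OF sw[OF t]]
        sesquilinear_diff[OF sw[OF s] sw[OF t] schwartz_cmult[OF schwartz_dilation[OF sw[OF s]]] schwartz_cmult[OF schwartz_dilation[OF sw[OF t]]]]
      unfolding d plus_complex.sel minus_complex.sel r
      using dilation_pair_swap[OF sw[OF s] sw[OF t]] by simp
  qed
  also have "Im (LINT x|lborel. cnj (H t x) * ?M t x) = 8 * \<gamma> * (LINT x|lborel. (norm (grad (u t) x))\<^sup>2) -
    4 * ((real CARD('n) * real p - 4) / (real p + 2) * (LBINT \<sigma>:{0..1}. lp_mass p (u t) \<sigma>)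
      + 4 / (real p + 2) * lp_mass p (u t) 1)"
  proof -
    let ?D = "LINT x|lborel. cnj (laplacian (u t) x) * dilation (u t) x"
      and ?N = "LINT x|lborel. cnj (dm_nonlin p (u t) x) * dilation (u t) x"
    have e: "z * (?c * y + ?c * y) = (- 4 * \<i>) * (z * y)" for y z by (simp add: algebra_simps)
    have A: "(LINT x|lborel. cnj (H t x) * ?M t x) = (- 4 * \<i>) * (of_real \<gamma> * ?D + ?N)"
      by (simp only: e integral_mult_right_zero H_pair[OF t schwartz_dilation[OF sw[OF t]]])
    have B: "Im ((- 4 * \<i>) * (of_real \<gamma> * y + z)) = - 4 * \<gamma> * Re y - 4 * Re z" for y z by simp
    have E: "- 4 * \<gamma> * (- 2 * r) = 8 * \<gamma> * r" for r by simp
    show ?thesis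
      unfolding A B nonlin_pair_dilation[OF sw[OF t] even_p] laplacian_pair_dilation[OF sw[OF t]] E ..
  qed
  finally show ?thesis .
qed

text \<open>Pointwise convergence passes through the propagator for each fixed \<sigma> and then
  through the average over \<sigma>; uniformity over the product of the time interval and [0,1]
  supplies the majorants.\<close>

lemma tendsto_duhamel:
  assumes t: "t \<in> {a<..<b}"
    and K: "uschwartz ({a..b} \<times> {0..1}) (\<lambda>z. K (fst z) (snd z))"
    and meas: "\<And>s. s \<in> {a<..<b} \<Longrightarrow> (\<lambda>(\<sigma>, x). K s \<sigma> x) \<in> borel_measurable (borel \<Otimes>\<^sub>M borel)"
    and lim: "\<And>\<sigma> x. \<sigma> \<in> {0..1} \<Longrightarrow> ((\<lambda>s. K s \<sigma> x) \<longlongrightarrow> K t \<sigma> x) (at t)"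
  shows "((\<lambda>s. duhamel (K s) x) \<longlongrightarrow> duhamel (K t) x) (at t)"
proof -
  have ev: "eventually (\<lambda>s. s \<in> {a..b}) (at t)"
    using eventually_interval[OF t] by eventually_elim auto
  have u: "uschwartz ({a..b} \<times> {0..1}) (\<lambda>z. free_prop (- snd z) (K (fst z) (snd z)))"
    by (rule uschwartz_free_prop[OF K, where B = 1]) auto
  obtain C where C: "\<And>z x. z \<in> {a..b} \<times> {0..1} \<Longrightarrow> norm (free_prop (- snd z) (K (fst z) (snd z)) x) \<le> C * decay x"
    using uschwartz_decay[OF u] by blast
  show ?thesis unfolding duhamel_def set_lebesgue_integral_def
  proof (rule tendsto_integral_at[where g = "\<lambda>\<sigma>. indicator {0..1} \<sigma> * (C * decay x)"])
    show "((\<lambda>s. indicator {0..1} \<sigma> *\<^sub>R free_prop (- \<sigma>) (K s \<sigma>) x) \<longlongrightarrow>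
        indicator {0..1} \<sigma> *\<^sub>R free_prop (- \<sigma>) (K t \<sigma>) x) (at t)" for \<sigma> :: real
    proof (cases "\<sigma> \<in> {0..1}")
      case True
      have "uschwartz {a..b} (\<lambda>s. K s \<sigma>)"
        using uschwartz_reindex[OF K, of "{a..b}" "\<lambda>s. (s, \<sigma>)"] True by simp
      then show ?thesis
        by (intro tendsto_scaleR tendsto_const tendsto_free_prop[OF _ ev lim[OF True], where B = "\<bar>\<sigma>\<bar>"]) auto
    qed simp
    show "\<forall>\<^sub>F s in at t. (\<lambda>\<sigma>. indicator {0..1} \<sigma> *\<^sub>R free_prop (- \<sigma>) (K s \<sigma>) x) \<in> borel_measurable lborel \<and>
        (\<forall>\<sigma>. norm (indicator {0..1} \<sigma> *\<^sub>R free_prop (- \<sigma>) (K s \<sigma>) x) \<le> indicator {0..1} \<sigma> * (C * decay x))"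
      using eventually_interval[OF t]
    proof eventually_elim
      case (elim s)
      have "(\<lambda>w. free_prop (- fst w) (K s (fst w)) (snd w)) \<in> borel_measurable (borel \<Otimes>\<^sub>M borel)"
        using measurable_strip_free_prop[OF meas[OF elim], of uminus] by (simp add: case_prod_unfold)
      from measurable_compose[OF _ this, of "\<lambda>\<sigma>. (\<sigma>, x)" borel]
      have "(\<lambda>\<sigma>. free_prop (- \<sigma>) (K s \<sigma>) x) \<in> borel_measurable borel" by simp
      then have "(\<lambda>\<sigma>. indicator {0..1} \<sigma> *\<^sub>R free_prop (- \<sigma>) (K s \<sigma>) x) \<in> borel_measurable borel"
        by measurable
      moreover have "norm (indicator {0..1} \<sigma> *\<^sub>R free_prop (- \<sigma>) (K s \<sigma>) x) \<le> indicator {0..1} \<sigma> * (C * decay x)" for \<sigma>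
        using C[of "(s, \<sigma>)" x] elim by (auto split: split_indicator)
      ultimately show ?case by simp
    qed
  qed simp
qed

text \<open>At s = t the multiplier becomes H itself, so the derivative is the imaginary part of the
  integral of |H|^2, which is zero: the Hamiltonian structure of the equation.\<close>

lemma energy_deriv:
  assumes t: "t \<in> {a<..<b}"
  shows "((\<lambda>s. dm_energy \<gamma> p (u s)) has_real_derivative 0) (at t)"
proof -
  let ?g = "of_real (\<gamma> / 2) :: complex" and ?q = "of_real (1 / (real p + 2)) :: complex"
  \<comment> \<open>The second argument stays at time t: the kernel represents the change of the
    potential energy since t, and at s = t it reduces to p + 2 times the nonlinearity.\<close>
  let ?K = "\<lambda>s \<sigma> x. power_kernel p (free_prop \<sigma> (u s) x) (free_prop \<sigma> (u t) x)"
  let ?L = "\<lambda>s x. ?g * laplacian (u s) x + ?g * laplacian (u t) x"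
  let ?M = "\<lambda>s x. ?L s x + ?q * duhamel (?K s) x"
  have sw: "schwartz (u s)" if "s \<in> {a<..<b}" for s using schwartz_u'[OF that] .
  have uK: "uschwartz ({a..b} \<times> {0..1}) (\<lambda>z x. ?K (fst z) (snd z) x)"
    by (intro uschwartz_power_kernel uschwartz_pair uschwartz_free_prop[where s = snd and f = "\<lambda>_. u t" and B = 1] uschwartz_const sw t) auto
  obtain C where C: "\<And>s x. s \<in> {a..b} \<Longrightarrow> norm (duhamel (?K s) x) \<le> C * decay x"
    using duhamel_bound[OF uK] by blast
  have uL: "uschwartz {a..b} ?L"
    by (intro uschwartz_add uschwartz_cmult uschwartz_laplacian uschwartz_u uschwartz_const sw t)
  obtain D where D: "\<And>s x. s \<in> {a<..<b} \<Longrightarrow> norm (?L s x) \<le> D * decay x" using uschwartz_bound[OF uL] by blast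
  have mK: "duhamel (?K s) \<in> borel_measurable borel" if "s \<in> {a<..<b}" for s
    by (intro duhamel_measurable measurable_power_kernel_free_prop sw that t)
  have limK: "((\<lambda>s. duhamel (?K s) x) \<longlongrightarrow> duhamel (?K t) x) (at t)" for x
  proof (rule tendsto_duhamel[OF t uK])
    show "(\<lambda>(\<sigma>, x). ?K s \<sigma> x) \<in> borel_measurable (borel \<Otimes>\<^sub>M borel)" if "s \<in> {a<..<b}" for s
      by (intro measurable_power_kernel_free_prop sw that t)
    have ev: "eventually (\<lambda>s. s \<in> {a..b}) (at t)"
      using eventually_interval[OF t] by eventually_elim auto
    have w: "((\<lambda>s. free_prop \<sigma> (u s) x) \<longlongrightarrow> free_prop \<sigma> (u t) x) (at t)" for \<sigma> x
      by (rule tendsto_free_prop[OF uschwartz_u ev tendsto_u(1)[OF t], where B = "\<bar>\<sigma>\<bar>"]) auto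
    show "((\<lambda>s. ?K s \<sigma> x) \<longlongrightarrow> ?K t \<sigma> x) (at t)" for \<sigma> x
      unfolding power_kernel_def by (intro tendsto_sum tendsto_intros w)
  qed
  have "((\<lambda>s. dm_energy \<gamma> p (u s)) has_real_derivative Im (LINT x|lborel. cnj (H t x) * ?M t x)) (at t)"
  proof (rule time_derivative[OF t, where C = "D + norm ?q * C" and M = ?M])
    show "?M s \<in> borel_measurable borel" if "s \<in> {a<..<b}" for s
      by (intro borel_measurable_add borel_measurable_times borel_measurable_const mK that
          schwartz_measurable schwartz_laplacian sw t)
    show "norm (?M s x) \<le> (D + norm ?q * C) * decay x" if "s \<in> {a<..<b}" for s x
    proof -
      have "norm (?q * duhamel (?K s) x) \<le> norm ?q * (C * decay x)"
        unfolding norm_mult by (intro mult_left_mono C) (use that in auto)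
      with D[OF that, of x] show ?thesis
        unfolding distrib_right mult.assoc by (rule norm_triangle_mono)
    qed
    show "((\<lambda>s. ?M s x) \<longlongrightarrow> ?M t x) (at t)" for x
      by (intro tendsto_add tendsto_mult tendsto_const tendsto_u t limK)
    fix s assume s: "s \<in> {a<..<b}"
    let ?d = "\<lambda>x. u s x - u t x"
    have sd: "schwartz ?d" by (intro schwartz_diff sw s t)
    have i1: "integrable lborel (\<lambda>x. cnj (?d x) * ?L s x)"
      by (intro schwartz_integrable schwartz_mult schwartz_cnj schwartz_add schwartz_cmult schwartz_laplacian sd sw s t)
    have "integrable lborel (\<lambda>x. cnj (cnj (duhamel (?K s) x) * ?d x))"
      by (intro integrable_cnj integrable_cnj_mult_schwartz[OF mK[OF s] C sd]) (use s in auto)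
    then have i2: "integrable lborel (\<lambda>x. cnj (?d x) * duhamel (?K s) x)" by (simp add: mult.commute)
    have l: "(LINT x|lborel. cnj (f x) * (?g * h x)) = ?g * (LINT x|lborel. cnj (f x) * h x)"
      for f h :: "real^'n \<Rightarrow> complex"
      by (subst integral_mult_right_zero[symmetric]) (simp only: ac_simps)
    have rg: "Re (?g * z) = \<gamma> / 2 * Re z" "Re (?q * z) = 1 / (real p + 2) * Re z" for z
      by (simp_all only: Re_complex_of_real Im_complex_of_real times_complex.sel)
    have "(LINT x|lborel. cnj (?d x) * ?M s x) = (LINT x|lborel. cnj (?d x) * ?L s x + ?q * (cnj (?d x) * duhamel (?K s) x))"
      by (intro Bochner_Integration.integral_cong refl) (simp only: distrib_left ac_simps)
    also have "\<dots> = (LINT x|lborel. cnj (?d x) * ?L s x) + ?q * (LINT x|lborel. cnj (?d x) * duhamel (?K s) x)"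
      by (subst Bochner_Integration.integral_add[OF i1 integrable_mult_right[OF i2]]) (simp only: integral_mult_right_zero)
    finally have "Re (LINT x|lborel. cnj (?d x) * ?M s x) =
        Re (LINT x|lborel. cnj (?d x) * ?L s x) + 1 / (real p + 2) * Re (LINT x|lborel. cnj (?d x) * duhamel (?K s) x)"
      by (simp only: plus_complex.sel rg)
    also have "Re (LINT x|lborel. cnj (?d x) * ?L s x) =
        \<gamma> / 2 * Re (LINT x|lborel. cnj (u s x) * laplacian (u s) x) - \<gamma> / 2 * Re (LINT x|lborel. cnj (u t x) * laplacian (u t) x)"
      unfolding sesquilinear_diff[OF sw[OF s] sw[OF t] schwartz_cmult[OF schwartz_laplacian[OF sw[OF s]]] schwartz_cmult[OF schwartz_laplacian[OF sw[OF t]]]]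
      unfolding l plus_complex.sel minus_complex.sel rg laplacian_pair_swap[OF sw[OF s] sw[OF t]] by simp
    finally show "dm_energy \<gamma> p (u s) - dm_energy \<gamma> p (u t) = Re (LINT x|lborel. cnj (?d x) * ?M s x)"
      unfolding dm_energy_pair[OF sw[OF s] even_p] dm_energy_pair[OF sw[OF t] even_p]
        lp_mass_integral_diff[OF sw[OF s] sw[OF t] even_p, symmetric]
      by (simp only: right_diff_distrib)
  qed
  also have "?M t = H t"
  proof
    fix x
    have "duhamel (?K t) x = of_real (real p + 2) * dm_nonlin p (u t) x"
      unfolding power_kernel_diag[OF even_p] duhamel_cmult dm_nonlin_duhamel ..
    moreover have "?q * (of_real (real p + 2) * z) = z" for z
    proof -
      have "?q * of_real (real p + 2) = of_real (1 / (real p + 2) * (real p + 2))" by (simp only: of_real_mult)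
      also have "1 / (real p + 2) * (real p + 2) = 1" by simp
      finally show ?thesis by (simp only: mult.assoc[symmetric]) simp
    qed
    moreover have "?g * z + ?g * z = of_real \<gamma> * z" for z by simp
    ultimately show "?M t x = H t x" unfolding H_def by (simp only:)
  qed
  also have "(LINT x|lborel. cnj (H t x) * H t x) = of_real (LINT x|lborel. (norm (H t x))\<^sup>2)"
    unfolding integral_complex_of_real[symmetric] complex_norm_square by (simp only: mult.commute)
  finally show ?thesis by (simp only: Im_complex_of_real)
qed

lemma energy_constant:
  assumes "s \<in> {a<..<b}" "t \<in> {a<..<b}"
  shows "dm_energy \<gamma> p (u s) = dm_energy \<gamma> p (u t)"
  by (rule DERIV_isconst3[of a b s t "\<lambda>s. dm_energy \<gamma> p (u s)"]) (use assms energy_deriv in auto)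

end

section \<open>Schwartz solutions and the variance inequalities\<close>

lemma schwartz_iter_pd_differentiable: "schwartz f \<Longrightarrow> iter_pd js f differentiable (at x)"
  unfolding schwartz_def by blast

lemma iter_pd_diff:
  assumes "schwartz f" "schwartz g"
  shows "iter_pd js (\<lambda>x. f x - g x) = (\<lambda>x. iter_pd js f x - iter_pd js g x)"
proof (induction js)
  case (Cons j js)
  show ?case
    by (simp add: Cons fun_eq_iff pd_diff schwartz_iter_pd_differentiable assms)
qed simp

lemma schwartz_seminorm_upper:
  assumes "schwartz f" shows "norm x ^ k * norm (iter_pd js f x) \<le> schwartz_seminorm k js f"
  unfolding schwartz_seminorm_def
  by (rule cSUP_upper) (use assms in \<open>auto simp: schwartz_def intro: bounded_imp_bdd_above\<close>)

context
  fixes \<gamma> :: real and p :: nat and u0 :: "real^'n \<Rightarrow> complex" and I u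
  assumes sol: "dm_solution \<gamma> p u0 I u"
begin

lemma sol_schwartz: "t \<in> I \<Longrightarrow> schwartz (u t)"
  using sol unfolding dm_solution_def by blast

lemma sol_open: "open I" "is_interval I" "0 \<in> I"
  using sol unfolding dm_solution_def by blast+

lemma sol_seminorm_tendsto:
  assumes "t \<in> I"
  shows "((\<lambda>s. schwartz_seminorm k js (\<lambda>x. u s x - u t x)) \<longlongrightarrow> 0) (at t)"
proof -
  have "\<forall>t\<in>I. \<forall>k js. ((\<lambda>s. schwartz_seminorm k js (\<lambda>x. u s x - u t x)) \<longlongrightarrow> 0) (at t)"
    using sol unfolding dm_solution_def by (elim conjE)
  with assms show ?thesis by blast
qed

lemma sol_iter_pd_close:
  assumes "s \<in> I" "t \<in> I"
  shows "norm x ^ k * norm (iter_pd js (u s) x - iter_pd js (u t) x) \<le> schwartz_seminorm k js (\<lambda>x. u s x - u t x)"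
  using schwartz_seminorm_upper[OF schwartz_diff[OF sol_schwartz[OF assms(1)] sol_schwartz[OF assms(2)]]]
  by (simp add: iter_pd_diff sol_schwartz assms)

lemma sol_eventually: "t \<in> I \<Longrightarrow> eventually (\<lambda>s. s \<in> I) (at t)"
  by (intro eventually_at_in_open' sol_open)

lemma sol_tendsto:
  assumes t: "t \<in> I"
  shows "((\<lambda>s. iter_pd js (u s) x) \<longlongrightarrow> iter_pd js (u t) x) (at t)"
proof (rule LIM_zero_cancel, rule tendsto_0_le[where K = 1, OF sol_seminorm_tendsto[OF t, of 0 js]])
  show "\<forall>\<^sub>F s in at t. norm (iter_pd js (u s) x - iter_pd js (u t) x) \<le>
      norm (schwartz_seminorm 0 js (\<lambda>x. u s x - u t x)) * 1"
    using sol_eventually[OF t]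
  proof eventually_elim
    case (elim s)
    show ?case using sol_iter_pd_close[OF elim t, of x 0 js] by simp
  qed
qed

lemma sol_locally_bounded:
  assumes t: "t \<in> I"
  shows "\<exists>e>0. \<exists>C. \<forall>s\<in>ball t e. \<forall>x. norm x ^ k * norm (iter_pd js (u s) x) \<le> C"
proof -
  have "eventually (\<lambda>s. schwartz_seminorm k js (\<lambda>x. u s x - u t x) < 1 \<and> s \<in> I) (at t)"
    using order_tendstoD(2)[OF sol_seminorm_tendsto[OF t], of 1] sol_eventually[OF t] by (simp add: eventually_conj)
  then obtain e where e: "e > 0"
    "\<And>s. s \<noteq> t \<Longrightarrow> dist s t < e \<Longrightarrow> schwartz_seminorm k js (\<lambda>x. u s x - u t x) < 1 \<and> s \<in> I"
    unfolding eventually_at by blast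
  obtain C where C: "\<And>x. norm x ^ k * norm (iter_pd js (u t) x) \<le> C"
    using schwartz_seminorm_upper[OF sol_schwartz[OF t]] by blast
  have "norm x ^ k * norm (iter_pd js (u s) x) \<le> C + 1" if "s \<in> ball t e" for s x
  proof (cases "s = t")
    case True
    then show ?thesis using C[of x] by simp
  next
    case False
    with e(2)[of s] that have s: "schwartz_seminorm k js (\<lambda>x. u s x - u t x) < 1" "s \<in> I"
      by (auto simp: dist_commute)
    have "norm x ^ k * norm (iter_pd js (u s) x) \<le>
        norm x ^ k * (norm (iter_pd js (u t) x) + norm (iter_pd js (u s) x - iter_pd js (u t) x))"
      using norm_triangle_sub[of "iter_pd js (u s) x" "iter_pd js (u t) x"] by (intro mult_left_mono) auto
    also have "\<dots> \<le> C + 1"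
      unfolding distrib_left using C[of x] sol_iter_pd_close[OF s(2) t, of x k js] s(1) by linarith
    finally show ?thesis .
  qed
  then show ?thesis using e(1) by blast
qed

text \<open>Continuity in a seminorm bounds it near every time, and compactness of the interval
  makes the bound uniform. The neighbourhoods may depend on k and js, as a finite cover is chosen
  for each seminorm separately.\<close>

lemma sol_uschwartz:
  assumes ab: "{a..b} \<subseteq> I"
  shows "uschwartz {a..b} u"
  unfolding uschwartz_def
proof (intro conjI ballI allI)
  show "iter_pd js (u t) differentiable (at x)" if "t \<in> {a..b}" for t js x
    using that ab by (intro schwartz_iter_pd_differentiable sol_schwartz) auto
  fix k js
  have "\<forall>t\<in>{a..b}. \<exists>e C. e > 0 \<and> (\<forall>s\<in>ball t e. \<forall>x. norm x ^ k * norm (iter_pd js (u s) x) \<le> C)"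
    using sol_locally_bounded[of _ k js] ab by blast
  then obtain e C where eC: "\<And>t. t \<in> {a..b} \<Longrightarrow> e t > 0"
    "\<And>t s x. t \<in> {a..b} \<Longrightarrow> s \<in> ball t (e t) \<Longrightarrow> norm x ^ k * norm (iter_pd js (u s) x) \<le> C t"
    by metis
  obtain T where T: "T \<subseteq> {a..b}" "finite T" "{a..b} \<subseteq> (\<Union>t\<in>T. ball t (e t))"
    by (rule compactE_image[of "{a..b}" "{a..b}" "\<lambda>t. ball t (e t)"])
      (use eC(1) in \<open>auto intro: centre_in_ball[THEN iffD2]\<close>)
  have "norm x ^ k * norm (iter_pd js (u s) x) \<le> (\<Sum>t\<in>T. \<bar>C t\<bar>)" if s: "s \<in> {a..b}" for s x
  proof -
    obtain t where t: "t \<in> T" "s \<in> ball t (e t)" using T(3) s by blast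
    have "norm x ^ k * norm (iter_pd js (u s) x) \<le> C t" using eC(2) t T(1) by blast
    also have "\<dots> \<le> \<bar>C t\<bar>" by simp
    also have "\<dots> \<le> (\<Sum>t\<in>T. \<bar>C t\<bar>)" by (intro member_le_sum t T) auto
    finally show ?thesis .
  qed
  then show "\<exists>C. \<forall>s\<in>{a..b}. \<forall>x. norm x ^ k * norm (iter_pd js (u s) x) \<le> C" by blast
qed

lemma sol_derivative:
  assumes "t \<in> I"
  shows "((\<lambda>s. u s x) has_vector_derivative
    \<i> * (of_real \<gamma> * laplacian (u t) x + dm_nonlin p (u t) x)) (at t)"
proof -
  let ?v = "vector_derivative (\<lambda>s. u s x) (at t)"
  have "\<forall>t\<in>I. \<forall>x. (\<lambda>s. u s x) differentiable (at t) \<and>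
      \<i> * vector_derivative (\<lambda>s. u s x) (at t) + \<gamma> *\<^sub>R laplacian (u t) x + dm_nonlin p (u t) x = 0"
    using sol unfolding dm_solution_def by (elim conjE)
  with assms have d: "(\<lambda>s. u s x) differentiable (at t)"
    and eq: "\<i> * ?v + \<gamma> *\<^sub>R laplacian (u t) x + dm_nonlin p (u t) x = 0" by blast+
  have "\<i> * ?v = - (of_real \<gamma> * laplacian (u t) x + dm_nonlin p (u t) x)"
    using eq unfolding scaleR_conv_of_real add.assoc by (rule eq_neg_iff_add_eq_0[THEN iffD2])
  moreover have "v = \<i> * w" if "\<i> * v = - w" for v w :: complex
  proof -
    have "v = - (\<i> * (\<i> * v))" by (simp flip: mult.assoc)
    then show ?thesis unfolding that by simp
  qed
  ultimately have "?v = \<i> * (of_real \<gamma> * laplacian (u t) x + dm_nonlin p (u t) x)" by blast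
  then show ?thesis using d vector_derivative_works by metis
qed

lemma sol_dm_flow:
  assumes "{a..b} \<subseteq> I" "even p"
  shows "dm_flow \<gamma> a b p u"
proof
  have I: "t \<in> I" if "t \<in> {a<..<b}" for t using that assms(1) by auto
  show "even p" by (rule assms(2))
  show "uschwartz {a..b} u" by (rule sol_uschwartz[OF assms(1)])
  show "((\<lambda>s. u s x) has_vector_derivative
      \<i> * (of_real \<gamma> * laplacian (u t) x + dm_nonlin p (u t) x)) (at t)" if "t \<in> {a<..<b}" for t x
    by (rule sol_derivative[OF I[OF that]])
  show "((\<lambda>s. iter_pd js (u s) x) \<longlongrightarrow> iter_pd js (u t) x) (at t)" if "t \<in> {a<..<b}" for t js x
    by (rule sol_tendsto[OF I[OF that]])
qed

text \<open>Derivatives are available at interior times only, so the compact interval must reach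
  beyond both prescribed times; openness of I allows it.\<close>

lemma sol_interval:
  assumes "c \<in> I" "d \<in> I" "c \<le> d"
  obtains a b where "a < c" "d < b" "{a..b} \<subseteq> I"
proof -
  obtain e1 where e1: "e1 > 0" "cball c e1 \<subseteq> I" using sol_open(1) assms(1) open_contains_cball by blast
  obtain e2 where e2: "e2 > 0" "cball d e2 \<subseteq> I" using sol_open(1) assms(2) open_contains_cball by blast
  have 1: "c - e1 \<in> I" by (rule subsetD[OF e1(2)]) (use e1(1) in \<open>simp add: dist_norm\<close>)
  have 2: "d + e2 \<in> I" by (rule subsetD[OF e2(2)]) (use e2(1) in \<open>simp add: dist_norm\<close>)
  have "{c - e1..d + e2} \<subseteq> I"
    by (auto intro: mem_is_interval_1_I[OF sol_open(2) 1 2])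
  then show ?thesis by (rule that[rotated 2]) (use e1(1) e2(1) in auto)
qed

end

section \<open>Monotone auxiliary functions of time\<close>

lemma unit_integral_nonneg:
  assumes "\<And>\<sigma>. \<sigma> \<in> {0..1} \<Longrightarrow> 0 \<le> (h \<sigma> :: real)"
  shows "0 \<le> (LBINT \<sigma>:{0..1}. h \<sigma>)"
  unfolding set_lebesgue_integral_def
  by (intro Bochner_Integration.integral_nonneg) (use assms in \<open>auto split: split_indicator\<close>)

context dm_flow
begin

text \<open>Normalised so as to be exactly the potential part of the energy.\<close>

definition pot :: "real \<Rightarrow> real" where
  "pot t = (LBINT \<sigma>:{0..1}. lp_mass p (u t) \<sigma>) / (real p + 2)"

definition pot1 :: "real \<Rightarrow> real" where
  "pot1 t = (LBINT \<sigma>:{0..1}. \<sigma> * lp_mass p (u t) \<sigma>) / (real p + 2)"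

definition end_pot :: "real \<Rightarrow> real" where
  "end_pot t = lp_mass p (u t) 1 / (real p + 2)"

lemma pot_nonneg: "0 \<le> pot t" "0 \<le> pot1 t" "0 \<le> end_pot t"
  unfolding pot_def pot1_def end_pot_def
  by (intro divide_nonneg_nonneg unit_integral_nonneg mult_nonneg_nonneg lp_mass_nonneg; simp)+

lemma energy_eq:
  assumes "t \<in> {a<..<b}"
  shows "dm_energy \<gamma> p (u t) = - (\<gamma> / 2) * (LINT x|lborel. (norm (grad (u t) x))\<^sup>2) + pot t"
  unfolding dm_energy_def lp_mass_Fubini(2)[OF schwartz_u'[OF assms] even_p] pot_def by simp

lemma variance_deriv':
  assumes "t \<in> {a<..<b}"
  shows "(variance u has_real_derivative \<gamma> * variance_dot1 u t +
    (4 * (real CARD('n) * real p) - 16) * pot1 t + 8 * end_pot t) (at t)"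
  using variance_deriv[OF assms] by (simp add: pot1_def end_pot_def mult.assoc add.assoc)

text \<open>The gradient term is eliminated through the energy: 8 \<gamma> times the integral of
  |grad u|^2 equals 16 \<open>pot\<close> - 16 E. This moves the coefficient of \<open>pot\<close>
  from 4 d p - 16 to 4 d p - 32, nonnegative exactly when d p \<ge> 8.\<close>

lemma variance_dot1_deriv':
  assumes "t \<in> {a<..<b}"
  shows "(variance_dot1 u has_real_derivative - 16 * dm_energy \<gamma> p (u t)
    - (4 * (real CARD('n) * real p) - 32) * pot t - 16 * end_pot t) (at t)"
proof -
  let ?G = "LINT x|lborel. (norm (grad (u t) x))\<^sup>2"
  have d: "(real CARD('n) * real p - 4) / (real p + 2) * (LBINT \<sigma>:{0..1}. lp_mass p (u t) \<sigma>) =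
      (real CARD('n) * real p - 4) * pot t"
    by (simp add: pot_def)
  have e: "4 / (real p + 2) * lp_mass p (u t) 1 = 4 * end_pot t" by (simp add: end_pot_def)
  have f: "8 * \<gamma> * ?G - 4 * ((real CARD('n) * real p - 4) * pot t + 4 * end_pot t) =
      - 16 * dm_energy \<gamma> p (u t) - (4 * (real CARD('n) * real p) - 32) * pot t - 16 * end_pot t"
    unfolding energy_eq[OF assms] by (simp add: algebra_simps)
  show ?thesis using variance_dot1_deriv[OF assms] unfolding d e f .
qed

context
  fixes E t :: real
  assumes dp: "real CARD('n) * real p \<ge> 8"
    and t: "t \<le> 0" "a < t" "0 < b"
    and E: "\<And>\<tau>. \<tau> \<in> {a<..<b} \<Longrightarrow> dm_energy \<gamma> p (u \<tau>) = E"
begin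

text \<open>Adding 16 E \<tau> removes the energy from the derivative of
  \<open>variance_dot1\<close>, and only nonpositive terms remain.\<close>

lemma dot1_lower: "variance_dot1 u t \<ge> variance_dot1 u 0 - 16 * E * t"
proof -
  have "variance_dot1 u 0 + 16 * E * 0 \<le> variance_dot1 u t + 16 * E * t"
  proof (rule DERIV_nonpos_imp_nonincreasing[OF t(1)])
    fix \<tau> assume \<tau>: "t \<le> \<tau>" "\<tau> \<le> 0"
    then have ab: "\<tau> \<in> {a<..<b}" using t by auto
    have y: "(variance_dot1 u has_real_derivative
        - 16 * E - (4 * (real CARD('n) * real p) - 32) * pot \<tau> - 16 * end_pot \<tau>) (at \<tau>)"
      using variance_dot1_deriv'[OF ab] unfolding E[OF ab] .
    have "((\<lambda>\<tau>. variance_dot1 u \<tau> + 16 * E * \<tau>) has_real_derivative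
        - ((4 * (real CARD('n) * real p) - 32) * pot \<tau>) - 16 * end_pot \<tau>) (at \<tau>)"
      by (auto intro!: derivative_eq_intros y simp: algebra_simps)
    moreover have "0 \<le> (4 * (real CARD('n) * real p) - 32) * pot \<tau>"
      using dp pot_nonneg[of \<tau>] by (intro mult_nonneg_nonneg) linarith+
    then have "- ((4 * (real CARD('n) * real p) - 32) * pot \<tau>) - 16 * end_pot \<tau> \<le> 0"
      using pot_nonneg(3)[of \<tau>] by linarith
    ultimately show "\<exists>y. ((\<lambda>\<tau>. variance_dot1 u \<tau> + 16 * E * \<tau>) has_real_derivative y) (at \<tau>) \<and> y \<le> 0" by blast
  qed
  then show ?thesis by simp
qed

lemma variance_upper_defocusing:
  assumes \<gamma>: "\<gamma> = -1" and t2: "- 1 / 2 \<le> t"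
  shows "variance u t \<le> variance u 0 - variance_dot1 u 0 * t + (2 * (real CARD('n) * real p) - 8) * E * t\<^sup>2"
proof -
  let ?k = "real CARD('n) * real p"
  \<comment> \<open>At \<tau> = t this is the variance at t; at \<tau> = 0, where the weight is - t,
    it is the asserted right-hand side.\<close>
  let ?\<psi> = "\<lambda>\<tau>. variance u \<tau> + (\<tau> - t) * variance_dot1 u \<tau> + (2 * ?k - 8) * E * (\<tau> - t)\<^sup>2"
  have "?\<psi> t \<le> ?\<psi> 0"
  proof (rule DERIV_nonneg_imp_nondecreasing[OF t(1)])
    fix \<tau> assume \<tau>: "t \<le> \<tau>" "\<tau> \<le> 0"
    then have ab: "\<tau> \<in> {a<..<b}" using t by auto
    let ?y' = "- 16 * E - (4 * ?k - 32) * pot \<tau> - 16 * end_pot \<tau>"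
    let ?v' = "- variance_dot1 u \<tau> + (4 * ?k - 16) * pot1 \<tau> + 8 * end_pot \<tau>"
    let ?D = "?v' + (variance_dot1 u \<tau> + (\<tau> - t) * ?y') + (2 * ?k - 8) * E * (2 * (\<tau> - t))"
    have v: "(variance u has_real_derivative ?v') (at \<tau>)" using variance_deriv'[OF ab] \<gamma> by simp
    have y: "(variance_dot1 u has_real_derivative ?y') (at \<tau>)" using variance_dot1_deriv'[OF ab] unfolding E[OF ab] .
    have "(?\<psi> has_real_derivative ?D) (at \<tau>)"
      by (auto intro!: derivative_eq_intros v y simp: algebra_simps)
    moreover have "?D \<ge> 0"
    proof -
      have potE: "pot \<tau> \<le> E"
      proof -
        have "0 \<le> (LINT x|lborel. (norm (grad (u \<tau>) x))\<^sup>2)"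
          by (intro Bochner_Integration.integral_nonneg) simp
        moreover have "E = (LINT x|lborel. (norm (grad (u \<tau>) x))\<^sup>2) / 2 + pot \<tau>"
          using energy_eq[OF ab] E[OF ab] \<gamma> by simp
        ultimately show ?thesis by linarith
      qed
      have k: "0 \<le> 4 * ?k - 16" "0 \<le> 4 * ?k - 32" using dp by argo+
      have h: "0 \<le> \<tau> - t" "\<tau> - t \<le> 1 / 2" using \<tau> t2 by auto
      \<comment> \<open>The two copies of \<open>variance_dot1\<close> cancel. The coefficient of E
        is 2 (2 d p - 8) - 16 = 4 d p - 32, the same as that of \<open>pot\<close>, so both combine
        into E - \<open>pot\<close>; the factor 8 - 16 (\<tau> - t) is where t \<ge> -1/2
        enters.\<close>
      have "?D = (4 * ?k - 16) * pot1 \<tau> + (8 - 16 * (\<tau> - t)) * end_pot \<tau> + (\<tau> - t) * ((4 * ?k - 32) * (E - pot \<tau>))"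
        by (simp add: algebra_simps)
      also have "\<dots> \<ge> 0"
        by (intro add_nonneg_nonneg mult_nonneg_nonneg k pot_nonneg) (use h potE in auto)
      finally show ?thesis .
    qed
    ultimately show "\<exists>y. (?\<psi> has_real_derivative y) (at \<tau>) \<and> 0 \<le> y" by blast
  qed
  then show ?thesis by (simp add: algebra_simps)
qed

text \<open>Dropping nonnegative terms, the derivative of the variance is at least
  \<open>variance_dot1\<close>, hence at least its value at 0 minus 16 E \<tau>; integrating from t
  to 0 gives 8 E t^2. The lower bound is a hypothesis at every \<tau> because the context fixes one
  endpoint t and \<open>dot1_lower\<close> speaks of that endpoint only.\<close>

lemma variance_upper_focusing:
  assumes \<gamma>: "\<gamma> = 1"
    and lower: "\<And>\<tau>. t \<le> \<tau> \<Longrightarrow> \<tau> \<le> 0 \<Longrightarrow> variance_dot1 u \<tau> \<ge> variance_dot1 u 0 - 16 * E * \<tau>"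
  shows "variance u t \<le> variance u 0 + variance_dot1 u 0 * t - 8 * E * t\<^sup>2"
proof -
  let ?k = "real CARD('n) * real p"
  let ?\<psi> = "\<lambda>\<tau>. variance u \<tau> - variance_dot1 u 0 * \<tau> + 8 * E * \<tau>\<^sup>2"
  have "?\<psi> t \<le> ?\<psi> 0"
  proof (rule DERIV_nonneg_imp_nondecreasing[OF t(1)])
    fix \<tau> assume \<tau>: "t \<le> \<tau>" "\<tau> \<le> 0"
    then have ab: "\<tau> \<in> {a<..<b}" using t by auto
    let ?v' = "variance_dot1 u \<tau> + (4 * ?k - 16) * pot1 \<tau> + 8 * end_pot \<tau>"
    let ?D = "?v' - variance_dot1 u 0 + 8 * E * (2 * \<tau>)"
    have v: "(variance u has_real_derivative ?v') (at \<tau>)" using variance_deriv'[OF ab] \<gamma> by simp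
    have "(?\<psi> has_real_derivative ?D) (at \<tau>)"
      by (auto intro!: derivative_eq_intros v)
    moreover have "?D \<ge> 0"
    proof -
      have "0 \<le> 4 * ?k - 16" using dp by argo
      then have "0 \<le> (4 * ?k - 16) * pot1 \<tau>" by (rule mult_nonneg_nonneg[OF _ pot_nonneg(2)])
      moreover have "0 \<le> y + P + 8 * e - y0 + X" if "y \<ge> y0 - X" "0 \<le> P" "0 \<le> e" for y y0 P e X :: real
        using that by argo
      moreover have "8 * E * (2 * \<tau>) = 16 * E * \<tau>" by simp
      ultimately show ?thesis using lower[OF \<tau>] pot_nonneg(3)[of \<tau>] by (simp only:)
    qed
    ultimately show "\<exists>y. (?\<psi> has_real_derivative y) (at \<tau>) \<and> 0 \<le> y" by blast
  qed
  then show ?thesis by simp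
qed

end

end

theorem proposition1p5:
  fixes p :: nat
  assumes "p \<ge> 2" and "even p" and "real p \<ge> 8 / real CARD('n::finite)"
  shows "\<exists>C>0. \<forall>\<gamma>\<in>{-1, 1}. \<forall>(u0 :: real^'n \<Rightarrow> complex) (u :: real \<Rightarrow> real^'n \<Rightarrow> complex) I.
    schwartz u0 \<and> dm_maximal_solution \<gamma> p u0 I u \<longrightarrow>
    (\<forall>s\<in>I. let E = dm_energy \<gamma> p (u s) in
      (\<gamma> = -1 \<longrightarrow> (\<forall>t\<in>I. - 1 / 2 \<le> t \<and> t \<le> 0 \<longrightarrow>
         variance u t \<le> variance u 0 - variance_dot1 u 0 * t + C * E * t\<^sup>2)) \<and>
      (\<gamma> = 1 \<longrightarrow> (\<forall>t\<in>I. t < 0 \<longrightarrow>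
         variance u t \<le> variance u 0 + variance_dot1 u 0 * t - 8 * E * t\<^sup>2)) \<and>
      (\<forall>t\<in>I. t < 0 \<longrightarrow> variance_dot1 u t \<ge> variance_dot1 u 0 - 16 * E * t))"
proof -
  let ?k = "real CARD('n) * real p"
  have dp: "?k \<ge> 8" using assms(3) by (simp add: divide_le_eq mult.commute)
  have main: "(\<gamma> = -1 \<and> - 1 / 2 \<le> t \<longrightarrow>
         variance u t \<le> variance u 0 - variance_dot1 u 0 * t + (2 * ?k - 8) * dm_energy \<gamma> p (u s) * t\<^sup>2) \<and>
      (\<gamma> = 1 \<longrightarrow> variance u t \<le> variance u 0 + variance_dot1 u 0 * t - 8 * dm_energy \<gamma> p (u s) * t\<^sup>2) \<and>
      variance_dot1 u t \<ge> variance_dot1 u 0 - 16 * dm_energy \<gamma> p (u s) * t"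
    if sol: "dm_solution \<gamma> p u0 I u" and s: "s \<in> I" and t: "t \<in> I" "t \<le> 0"
    for \<gamma> s t I and u0 :: "real^'n \<Rightarrow> complex" and u
  proof -
    \<comment> \<open>The interval must contain s besides t and 0, since the energy is taken at the
      arbitrary time s and compared by conservation with its values between t and 0.\<close>
    have "min s t \<in> I" "max s 0 \<in> I" "min s t \<le> max s 0"
      using s t sol_open(3)[OF sol] by (auto simp: min_def max_def)
    from sol_interval[OF sol this] obtain a b where ab: "a < min s t" "max s 0 < b" "{a..b} \<subseteq> I" by blast
    interpret dm_flow \<gamma> a b p u by (rule sol_dm_flow[OF sol ab(3) assms(2)])
    have E: "dm_energy \<gamma> p (u \<tau>) = dm_energy \<gamma> p (u s)" if "\<tau> \<in> {a<..<b}" for \<tau>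
      by (rule energy_constant[OF that]) (use ab in auto)
    \<comment> \<open>The lemma is applied afresh with \<tau> as its endpoint, which gives the bound
      at all the times required in the focusing case.\<close>
    have lower: "variance_dot1 u \<tau> \<ge> variance_dot1 u 0 - 16 * dm_energy \<gamma> p (u s) * \<tau>"
      if "t \<le> \<tau>" "\<tau> \<le> 0" for \<tau>
      by (rule dot1_lower[OF dp that(2) _ _ E]) (use that ab in auto)
    show ?thesis
      using lower[of t] t ab
        variance_upper_defocusing[OF dp t(2) _ _ E] variance_upper_focusing[OF dp t(2) _ _ E _ lower]
      by auto
  qed
  show ?thesis
  proof (intro exI[of _ "2 * ?k - 8"] conjI ballI allI impI)
    show "2 * ?k - 8 > 0" using dp by linarith
  next
    fix \<gamma> :: real and u0 u I s
    assume "schwartz u0 \<and> dm_maximal_solution \<gamma> p (u0 :: real^'n \<Rightarrow> complex) I u" and s: "s \<in> I"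
    then have sol: "dm_solution \<gamma> p u0 I u" by (simp add: dm_maximal_solution_def)
    note m = main[OF sol s]
    show "let E = dm_energy \<gamma> p (u s) in
      (\<gamma> = -1 \<longrightarrow> (\<forall>t\<in>I. - 1 / 2 \<le> t \<and> t \<le> 0 \<longrightarrow>
         variance u t \<le> variance u 0 - variance_dot1 u 0 * t + (2 * ?k - 8) * E * t\<^sup>2)) \<and>
      (\<gamma> = 1 \<longrightarrow> (\<forall>t\<in>I. t < 0 \<longrightarrow>
         variance u t \<le> variance u 0 + variance_dot1 u 0 * t - 8 * E * t\<^sup>2)) \<and>
      (\<forall>t\<in>I. t < 0 \<longrightarrow> variance_dot1 u t \<ge> variance_dot1 u 0 - 16 * E * t)"
      unfolding Let_def
    proof (intro conjI impI ballI)
      fix t assume t: "\<gamma> = -1" "t \<in> I" "- 1 / 2 \<le> t \<and> t \<le> 0"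
      show "variance u t \<le> variance u 0 - variance_dot1 u 0 * t + (2 * ?k - 8) * dm_energy \<gamma> p (u s) * t\<^sup>2"
        by (rule m[OF t(2) conjunct2[OF t(3)], THEN conjunct1, THEN mp, OF conjI[OF t(1) conjunct1[OF t(3)]]])
    next
      fix t assume t: "\<gamma> = 1" "t \<in> I" "t < 0"
      show "variance u t \<le> variance u 0 + variance_dot1 u 0 * t - 8 * dm_energy \<gamma> p (u s) * t\<^sup>2"
        by (rule m[OF t(2) less_imp_le[OF t(3)], THEN conjunct2, THEN conjunct1, THEN mp, OF t(1)])
    next
      fix t assume t: "t \<in> I" "t < 0"
      show "variance_dot1 u 0 - 16 * dm_energy \<gamma> p (u s) * t \<le> variance_dot1 u t"
        by (rule m[OF t(1) less_imp_le[OF t(2)], THEN conjunct2, THEN conjunct2])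
    qed
  qed
qed

end
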